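(* Assume that $\rho(\widetilde{\mathbf{S}})<1$. Then, as the number of iterations tends to infinity, the sequence $(\mathbf{Q}_q^{(n)})_{q\in\Omega}$ generated by the asynchronous MIMO iterative waterfilling algorithm converges to the unique Nash equilibrium of game $\mathscr{G}$, for any set of feasible initial conditions $\mathbf{Q}_q^{(0)}\in\mathscr{Q}_q$, $q\in\Omega$, and any updating schedule.
   Context: Setting. $\Omega=\{1,\ldots,Q\}$. For $r,q\in\Omega$, $\mathbf{H}_{rq}\in\mathbb{C}^{n_{R_q}\times n_{T_r}}$ are arbitrary matrices (possibly rectangular and rank deficient) with $\mathbf{H}_{qq}\neq\mathbf{0}$, $\mathbf{R}_{n_q}\in\mathbb{C}^{n_{R_q}\times n_{R_q}}$ is Hermitian positive definite, and $P_q>0$. The strategy sets are $\mathscr{Q}_q=\{\mathbf{Q}\in\mathbb{C}^{n_{T_q}\times n_{T_q}}:\mathbf{Q}\succeq\mathbf{0},\ \mathrm{Tr}(\mathbf{Q})=P_q\}$, $\mathscr{Q}_{-q}=\prod_{r\ne q}\mathscr{Q}_r$, and for $\mathbf{Q}_{-q}=(\mathbf{Q}_r)_{r\neq q}\in\mathscr{Q}_{-q}$, $\mathbf{R}_{-q}(\mathbf{Q}_{-q})=\mathbf{R}_{n_q}+\sum_{r\neq q}\mathbf{H}_{rq}\mathbf{Q}_r\mathbf{H}_{rq}^H$. Game $\mathscr{G}$: player $q\in\Omega$ chooses $\mathbf{Q}_q\in\mathscr{Q}_q$ to maximize $R_q(\mathbf{Q}_q,\mathbf{Q}_{-q})=\log\det\big(\mathbf{I}+\mathbf{H}_{qq}^H\mathbf{R}_{-q}^{-1}(\mathbf{Q}_{-q})\mathbf{H}_{qq}\mathbf{Q}_q\big)$.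 A Nash equilibrium is $(\mathbf{Q}_q^\star)_{q\in\Omega}$ with $\mathbf{Q}_q^\star\in\mathscr{Q}_q$ and $R_q(\mathbf{Q}_q^\star,\mathbf{Q}_{-q}^\star)\ge R_q(\mathbf{Q}_q,\mathbf{Q}_{-q}^\star)$ for all $\mathbf{Q}_q\in\mathscr{Q}_q$ and all $q$. Waterfilling operator. Write the reduced eigendecomposition $\mathbf{H}_{qq}^H\mathbf{R}_{-q}^{-1}(\mathbf{Q}_{-q})\mathbf{H}_{qq}=\mathbf{U}_q\mathbf{D}_q\mathbf{U}_q^H$, with $\mathbf{U}_q\in\mathbb{C}^{n_{T_q}\times r_q}$ having orthonormal columns, $\mathbf{D}_q$ an $r_q\times r_q$ diagonal matrix with positive diagonal entries, $r_q=\mathrm{rank}(\mathbf{H}_{qq})$. Then $\mathbf{WF}_q(\mathbf{Q}_{-q})=\mathbf{U}_q(\mu_q\mathbf{I}-\mathbf{D}_q^{-1})^+\mathbf{U}_q^H$, where $(\cdot)^+=\max(0,\cdot)$ acts on the diagonal entries and $\mu_q$ is chosen so that $\mathrm{Tr}\{(\mu_q\mathbf{I}-\mathbf{D}_q^{-1})^+\}=P_q$. It is the best response of player $q$ to $\mathbf{Q}_{-q}$. Asynchronous MIMO iterative waterfilling algorithm. An updating schedule consists of sets $\mathcal{T}_q\subseteq\{0,1,2,\ldots\}$ (times at which user $q$ updates) and integers $\tau_r^q(n)$ (the most recent time at which the interference from user $r$ is perceived by user $q$ at iteration $n$) satisfying the standard totally asynchronous conditions: $0\le\tau_r^q(n)\le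 n$; each $\mathcal{T}_q$ is infinite; and for every sequence $\{n_k\}\subseteq\mathcal{T}_q$ tending to infinity, $\lim_{k\to\infty}\tau_r^q(n_k)=\infty$. Starting from $\mathbf{Q}_q^{(0)}\in\mathscr{Q}_q$, for $n=0,1,2,\ldots$ and all $q\in\Omega$, $$\mathbf{Q}_q^{(n+1)}=\begin{cases}\mathbf{WF}_q\big((\mathbf{Q}_r^{(\tau_r^q(n))})_{r\neq q}\big), & n\in\mathcal{T}_q,\\ \mathbf{Q}_q^{(n)}, & \text{otherwise.}\end{cases}$$ Notation. $\rho$ is the spectral radius, $(\cdot)^\sharp$ the Moore-Penrose pseudoinverse, $\mathbf{A}^{\sharp H}=(\mathbf{A}^\sharp)^H$, and $\mathcal{R}(\cdot)$, $\mathcal{N}(\cdot)$ denote range and null space. Matrix $\widetilde{\mathbf{S}}\in\mathbb{R}_+^{Q\times Q}$: $[\widetilde{\mathbf{S}}]_{qq}=0$, and for $r\neq q$, $$[\widetilde{\mathbf{S}}]_{qr}=\begin{cases}\rho\big(\mathbf{H}_{rq}^H\mathbf{H}_{qq}^{\sharp H}\mathbf{H}_{qq}^{\sharp}\mathbf{H}_{rq}\big), & \text{if }\mathrm{rank}(\mathbf{H}_{qq})=n_{R_q},\\ \rho\big(\mathbf{H}_{rq}^H\mathbf{P}_{rq}^{\star H}\mathbf{H}_{qq}^{\sharp H}\mathbf{H}_{qq}^{\sharp}\mathbf{P}_{rq}^{\star}\mathbf{H}_{rq}\big), & \text{otherwise,}\end{cases}$$ where $\mathbf{P}_{rq}^\star$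 is (the $\mathbf{P}_{rq}$-component of) a solution of: maximize $\rho\big(\mathbf{H}_{rq}^H\mathbf{P}_{rq}^H\mathbf{H}_{qq}^{\sharp H}\mathbf{H}_{qq}^{\sharp}\mathbf{P}_{rq}\mathbf{H}_{rq}\big)$ over $\mathbf{P}_{rq}\in\mathbb{C}^{n_{R_q}\times n_{R_q}}$ and $\mathbf{Q}_{-q}\in\mathscr{Q}_{-q}$ subject to $\mathbf{P}_{rq}=\mathbf{P}_{rq}^2$, $\mathcal{R}(\mathbf{P}_{rq})=\mathcal{R}(\mathbf{H}_{qq})$, $\mathcal{N}(\mathbf{P}_{rq})=\mathcal{N}\big(\mathbf{H}_{qq}^H\mathbf{R}_{-q}^{-1}(\mathbf{Q}_{-q})\big)$. *)

theory Defs
  imports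
    "HOL-Library.FuncSet"
    "Jordan_Normal_Form.Gauss_Jordan_Elimination"
    "Jordan_Normal_Form.Schur_Decomposition"
    "Jordan_Normal_Form.DL_Rank"
    "Jordan_Normal_Form.Matrix_Kernel"
    "Jordan_Normal_Form.Spectral_Radius"
begin

subsection \<open>Complex matrices\<close>

definition hermitian_mat :: "complex mat \<Rightarrow> bool" where
  "hermitian_mat A \<longleftrightarrow> mat_adjoint A = A"

text \<open>On complex numbers, \<open>0 \<le> z\<close> means that \<open>z\<close> is real and nonnegative; \<open>(A *\<^sub>v v) \<bullet>c v\<close>
  is the quadratic form \<open>v\<^sup>H A v\<close>.\<close>

definition psd_mat :: "nat \<Rightarrow> complex mat \<Rightarrow> bool" where
  "psd_mat n A \<longleftrightarrow> A \<in> carrier_mat n n \<and> hermitian_mat A \<and>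
     (\<forall>v \<in> carrier_vec n. 0 \<le> (A *\<^sub>v v) \<bullet>c v)"

definition pd_mat :: "nat \<Rightarrow> complex mat \<Rightarrow> bool" where
  "pd_mat n A \<longleftrightarrow> A \<in> carrier_mat n n \<and> hermitian_mat A \<and>
     (\<forall>v \<in> carrier_vec n. v \<noteq> 0\<^sub>v n \<longrightarrow> 0 < (A *\<^sub>v v) \<bullet>c v)"

definition mat_trace :: "complex mat \<Rightarrow> complex" where
  "mat_trace A = (\<Sum>i<dim_row A. A $$ (i, i))"

definition mat_range :: "complex mat \<Rightarrow> complex vec set" where
  "mat_range A = (\<lambda>v. A *\<^sub>v v) ` carrier_vec (dim_col A)"

definition mat_rank :: "complex mat \<Rightarrow> nat" where
  "mat_rank A = vec_space.rank (dim_row A) A"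

definition mat_inv :: "complex mat \<Rightarrow> complex mat" where
  "mat_inv A = the (mat_inverse A)"

definition is_pseudo_inverse :: "complex mat \<Rightarrow> complex mat \<Rightarrow> bool" where
  "is_pseudo_inverse A X \<longleftrightarrow> X \<in> carrier_mat (dim_col A) (dim_row A) \<and>
     A * X * A = A \<and> X * A * X = X \<and> hermitian_mat (A * X) \<and> hermitian_mat (X * A)"

definition pseudo_inverse :: "complex mat \<Rightarrow> complex mat" where
  "pseudo_inverse A = (THE X. is_pseudo_inverse A X)"


subsection \<open>The game\<close>

text \<open>\<open>channel G r q\<close> is the channel matrix from transmitter \<open>r\<close> to receiver \<open>q\<close>.\<close>

record mimo_system =
  num_users :: nat
  tx_dim :: "nat \<Rightarrow> nat"
  rx_dim :: "nat \<Rightarrow> nat"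
  channel :: "nat \<Rightarrow> nat \<Rightarrow> complex mat"
  noise_cov :: "nat \<Rightarrow> complex mat"
  power :: "nat \<Rightarrow> real"

definition players :: "mimo_system \<Rightarrow> nat set" where
  "players G = {1..num_users G}"

definition mimo_game :: "mimo_system \<Rightarrow> bool" where
  "mimo_game G \<longleftrightarrow> 1 \<le> num_users G \<and>
     (\<forall>r \<in> players G. \<forall>q \<in> players G. channel G r q \<in> carrier_mat (rx_dim G q) (tx_dim G r)) \<and>
     (\<forall>q \<in> players G. channel G q q \<noteq> 0\<^sub>m (rx_dim G q) (tx_dim G q)) \<and>
     (\<forall>q \<in> players G. pd_mat (rx_dim G q) (noise_cov G q)) \<and>
     (\<forall>q \<in> players G. 0 < power G q)"

definition strategies :: "mimo_system \<Rightarrow> nat \<Rightarrow> complex mat set" where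
  "strategies G q = {X. psd_mat (tx_dim G q) X \<and> mat_trace X = complex_of_real (power G q)}"

definition profiles :: "mimo_system \<Rightarrow> (nat \<Rightarrow> complex mat) set" where
  "profiles G = (\<Pi>\<^sub>E q \<in> players G. strategies G q)"

definition others_profiles :: "mimo_system \<Rightarrow> nat \<Rightarrow> (nat \<Rightarrow> complex mat) set" where
  "others_profiles G q = (\<Pi>\<^sub>E r \<in> players G - {q}. strategies G r)"

text \<open>The sum over the other players is written entrywise, since matrices with explicit
  dimensions do not form a monoid type.  Here and below only the components \<open>X r\<close> with
  \<open>r \<in> players G - {q}\<close> of the argument \<open>X\<close> matter, so a full profile may be passed as well.\<close>

definition noise_plus_interference :: "mimo_system \<Rightarrow> nat \<Rightarrow> (nat \<Rightarrow> complex mat) \<Rightarrow> complex mat" where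
  "noise_plus_interference G q X = noise_cov G q +
     mat (rx_dim G q) (rx_dim G q) (\<lambda>ij.
       \<Sum>r \<in> players G - {q}. (channel G r q * X r * mat_adjoint (channel G r q)) $$ ij)"

definition effective_channel :: "mimo_system \<Rightarrow> nat \<Rightarrow> (nat \<Rightarrow> complex mat) \<Rightarrow> complex mat" where
  "effective_channel G q X =
     mat_adjoint (channel G q q) * mat_inv (noise_plus_interference G q X) * channel G q q"

text \<open>For feasible arguments the determinant is real and at least 1, so \<open>Re\<close> is only a type
  conversion.\<close>

definition rate :: "mimo_system \<Rightarrow> nat \<Rightarrow> complex mat \<Rightarrow> (nat \<Rightarrow> complex mat) \<Rightarrow> real" where
  "rate G q Y X = ln (Re (det (1\<^sub>m (tx_dim G q) + effective_channel G q X * Y)))"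

definition nash_equilibrium :: "mimo_system \<Rightarrow> (nat \<Rightarrow> complex mat) \<Rightarrow> bool" where
  "nash_equilibrium G X \<longleftrightarrow> X \<in> profiles G \<and>
     (\<forall>q \<in> players G. \<forall>Y \<in> strategies G q. rate G q Y X \<le> rate G q (X q) X)"


subsection \<open>Waterfilling\<close>

definition diag_of_real :: "nat \<Rightarrow> (nat \<Rightarrow> real) \<Rightarrow> complex mat" where
  "diag_of_real k d = mat_diag k (\<lambda>i. complex_of_real (d i))"

definition reduced_eigendecomposition ::
    "nat \<Rightarrow> nat \<Rightarrow> complex mat \<Rightarrow> complex mat \<Rightarrow> (nat \<Rightarrow> real) \<Rightarrow> bool" where
  "reduced_eigendecomposition n k A U d \<longleftrightarrow>
     U \<in> carrier_mat n k \<and> mat_adjoint U * U = 1\<^sub>m k \<and> (\<forall>i<k. 0 < d i) \<and>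
     A = U * diag_of_real k d * mat_adjoint U"

definition is_waterfilling ::
    "mimo_system \<Rightarrow> nat \<Rightarrow> (nat \<Rightarrow> complex mat) \<Rightarrow> complex mat \<Rightarrow> bool" where
  "is_waterfilling G q X W \<longleftrightarrow>
     (let k = mat_rank (channel G q q) in
      \<exists>U d \<mu>. reduced_eigendecomposition (tx_dim G q) k (effective_channel G q X) U d \<and>
        (\<Sum>i<k. max 0 (\<mu> - inverse (d i))) = power G q \<and>
        W = U * diag_of_real k (\<lambda>i. max 0 (\<mu> - inverse (d i))) * mat_adjoint U)"

text \<open>The matrix does not depend on the choice of the eigendecomposition.\<close>

definition waterfilling :: "mimo_system \<Rightarrow> nat \<Rightarrow> (nat \<Rightarrow> complex mat) \<Rightarrow> complex mat" where
  "waterfilling G q X = (SOME W. is_waterfilling G q X W)"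


subsection \<open>The asynchronous algorithm\<close>

text \<open>\<open>T q\<close> is the set of update times of user \<open>q\<close>, and \<open>\<tau> q r n\<close> stands for \<open>\<tau>\<^sub>r\<^sup>q(n)\<close>, the time
  of the interference from \<open>r\<close> that \<open>q\<close> perceives at iteration \<open>n\<close>.\<close>

definition asynchronous_schedule ::
    "mimo_system \<Rightarrow> (nat \<Rightarrow> nat set) \<Rightarrow> (nat \<Rightarrow> nat \<Rightarrow> nat \<Rightarrow> nat) \<Rightarrow> bool" where
  "asynchronous_schedule G T \<tau> \<longleftrightarrow>
     (\<forall>q \<in> players G. infinite (T q)) \<and>
     (\<forall>q \<in> players G. \<forall>r \<in> players G - {q}.
        (\<forall>n. \<tau> q r n \<le> n) \<and>
        (\<forall>s :: nat \<Rightarrow> nat. (\<forall>k. s k \<in> T q) \<and> filterlim s at_top sequentially \<longrightarrow>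
           filterlim (\<lambda>k. \<tau> q r (s k)) at_top sequentially))"

definition iterative_waterfilling ::
    "mimo_system \<Rightarrow> (nat \<Rightarrow> nat set) \<Rightarrow> (nat \<Rightarrow> nat \<Rightarrow> nat \<Rightarrow> nat) \<Rightarrow> (nat \<Rightarrow> nat \<Rightarrow> complex mat) \<Rightarrow> bool" where
  "iterative_waterfilling G T \<tau> X \<longleftrightarrow>
     (\<forall>q \<in> players G. X 0 q \<in> strategies G q) \<and>
     (\<forall>n. \<forall>q \<in> players G. X (Suc n) q =
        (if n \<in> T q then waterfilling G q (\<lambda>r. X (\<tau> q r n) r) else X n q))"

definition converges_to ::
    "mimo_system \<Rightarrow> (nat \<Rightarrow> nat \<Rightarrow> complex mat) \<Rightarrow> (nat \<Rightarrow> complex mat) \<Rightarrow> bool" where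
  "converges_to G X L \<longleftrightarrow>
     (\<forall>q \<in> players G. \<forall>i < tx_dim G q. \<forall>j < tx_dim G q.
        (\<lambda>n. X n q $$ (i, j)) \<longlonglongrightarrow> L q $$ (i, j))"


subsection \<open>The interference matrix\<close>

definition projected_gain :: "mimo_system \<Rightarrow> nat \<Rightarrow> nat \<Rightarrow> complex mat \<Rightarrow> real" where
  "projected_gain G r q P = spectral_radius
     (mat_adjoint (channel G r q) * mat_adjoint P * mat_adjoint (pseudo_inverse (channel G q q))
        * pseudo_inverse (channel G q q) * P * channel G r q)"

definition projection_feasible ::
    "mimo_system \<Rightarrow> nat \<Rightarrow> complex mat \<times> (nat \<Rightarrow> complex mat) \<Rightarrow> bool" where
  "projection_feasible G q = (\<lambda>(P, X).
     P \<in> carrier_mat (rx_dim G q) (rx_dim G q) \<and> X \<in> others_profiles G q \<and>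
     P = P * P \<and> mat_range P = mat_range (channel G q q) \<and>
     mat_kernel P =
       mat_kernel (mat_adjoint (channel G q q) * mat_inv (noise_plus_interference G q X)))"

definition optimal_projection :: "mimo_system \<Rightarrow> nat \<Rightarrow> nat \<Rightarrow> complex mat" where
  "optimal_projection G r q =
     fst (arg_max (\<lambda>(P, X). projected_gain G r q P) (projection_feasible G q))"

definition interference_coeff :: "mimo_system \<Rightarrow> nat \<Rightarrow> nat \<Rightarrow> real" where
  "interference_coeff G q r =
     (if r = q then 0
      else if mat_rank (channel G q q) = rx_dim G q then
        spectral_radius (mat_adjoint (channel G r q)
          * mat_adjoint (pseudo_inverse (channel G q q))
          * pseudo_inverse (channel G q q) * channel G r q)
      else projected_gain G r q (optimal_projection G r q))"

text \<open>Matrix indices start at 0, players at 1.  The entries are embedded into the complex numbers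
  because \<^const>\<open>spectral_radius\<close> is defined for complex matrices.\<close>

definition interference_matrix :: "mimo_system \<Rightarrow> complex mat" where
  "interference_matrix G = mat (num_users G) (num_users G)
     (\<lambda>(i, j). complex_of_real (interference_coeff G (Suc i) (Suc j)))"

end

theory Submission
  imports Defs "HOL-Analysis.L2_Norm" "HOL-Analysis.Elementary_Metric_Spaces"
begin

text \<open>
  Write \<open>H = H\<^bsub>qq\<^esub>\<close>, let \<open>R\<close> be the noise plus interference covariance of player \<open>q\<close> and
  \<open>H\<^sup>H R\<^sup>-\<^sup>1 H = U D U\<^sup>H\<close>.  The waterfilling matrix is the Frobenius projection of
  \<open>- U D\<^sup>-\<^sup>1 U\<^sup>H\<close> onto the strategies supported on the range of \<open>H\<^sup>H\<close>, which does not depend on \<open>R\<close>;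
  hence it is a nonexpansive function of \<open>U D\<^sup>-\<^sup>1 U\<^sup>H\<close>.  With the weighted pseudo-inverse
  \<open>Z = U D\<^sup>-\<^sup>1 U\<^sup>H H\<^sup>H R\<^sup>-\<^sup>1\<close> one has \<open>U D\<^sup>-\<^sup>1 U\<^sup>H = Z R Z\<^sup>H\<close>, and for two covariances
  \<open>R\<^sub>1, R\<^sub>2\<close> the exact identity \<open>Z\<^sub>1 R\<^sub>1 Z\<^sub>1\<^sup>H - Z\<^sub>2 R\<^sub>2 Z\<^sub>2\<^sup>H = Z\<^sub>1 (R\<^sub>1 - R\<^sub>2) Z\<^sub>2\<^sup>H\<close> replaces
  the mean value theorem.  The feasible projections are exactly \<open>P = H Z\<close>, and \<open>Z = H\<^sup>\<sharp> P\<close>, so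
  the contribution of player \<open>r\<close> to the right-hand side is at most the \<open>(q, r)\<close> entry of the
  interference matrix times the change of \<open>Q\<^sub>r\<close>.  Spectral radius below 1 turns this into a
  contraction in a weighted maximum norm, for which totally asynchronous iterations converge.  The
  Nash equilibria are the waterfilling fixed points because \<open>ln det B \<le> tr B - n\<close> for positive
  definite \<open>B\<close>, with equality only at the identity.
\<close>

subsection \<open>Adjoint, trace and Frobenius norm\<close>

text \<open>If \<open>H\<close> is invertible, \<open>U D\<^sup>-\<^sup>1 U\<^sup>H\<close> is
  \<open>H\<^sup>-\<^sup>1 R\<close> times the adjoint of \<open>H\<^sup>-\<^sup>1\<close>, which is
  linear in \<open>R\<close>. For a rank deficient or tall \<open>H\<close> the inverse
  \<open>Z\<close> itself moves with \<open>R\<close>, and this nonlinearity is the obstacle. It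
  disappears because \<open>Z H\<close> is the orthogonal projector onto the range of
  \<open>H\<^sup>H\<close> for every \<open>R\<close>: in a mixed product of \<open>Z1\<close>,
  \<open>R1\<close> and the adjoint of \<open>Z2\<close>, the factor \<open>Z2\<close> matters only
  through \<open>Z2 H\<close>, which equals \<open>Z1 H\<close>. The price is that the two factors
  around the difference belong to different profiles. So the middle factor is measured in the
  Frobenius norm and the outer ones in the operator norm, whose square is the spectral radius of a
  Gram matrix; each outer factor contributes at most the square root of one and the same
  coefficient. That bound needs the maximum in the coefficient to be attained, since
  \<open>arg_max\<close> is a mere choice; hence the compactness argument. The equilibrium itself is
  the limit of the simultaneous iteration.\<close>

notation mat_adjoint ("_\<^sup>H" [1000] 999)

abbreviation diag where "diag \<equiv> diag_of_real"

lemma mat_adjoint_dim [simp]: "dim_row (A\<^sup>H) = dim_col A" "dim_col (A\<^sup>H) = dim_row A"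
  by (auto simp: mat_adjoint_def)

lemma mat_adjoint_carrier [simp]: "A\<^sup>H \<in> carrier_mat m n \<longleftrightarrow> A \<in> carrier_mat n m"
  by (metis carrier_matD carrier_matI mat_adjoint_dim)

lemma mat_adjoint_index [simp]:
  "i < dim_col A \<Longrightarrow> j < dim_row A \<Longrightarrow> A\<^sup>H $$ (i, j) = conjugate (A $$ (j, i))"
  by (simp add: mat_adjoint_def mat_of_rows_index)

lemma mat_adjoint_adjoint [simp]: "(A\<^sup>H)\<^sup>H = (A :: complex mat)"
  by (rule eq_matI) auto

lemma mat_adjoint_one [simp]: "(1\<^sub>m n)\<^sup>H = (1\<^sub>m n :: complex mat)"
  by (rule eq_matI) auto

lemma mat_adjoint_mult:
  fixes A :: "complex mat"
  assumes "A \<in> carrier_mat n m" "B \<in> carrier_mat m k"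
  shows "(A * B)\<^sup>H = B\<^sup>H * A\<^sup>H"
  using assms by (intro eq_matI) (auto simp: scalar_prod_def mult.commute)

lemma mat_adjoint_add:
  fixes A :: "complex mat"
  assumes "A \<in> carrier_mat n m" "B \<in> carrier_mat n m"
  shows "(A + B)\<^sup>H = A\<^sup>H + B\<^sup>H"
  using assms by (intro eq_matI) auto

lemma mat_adjoint_minus:
  fixes A :: "complex mat"
  assumes "A \<in> carrier_mat n m" "B \<in> carrier_mat n m"
  shows "(A - B)\<^sup>H = A\<^sup>H - B\<^sup>H"
  using assms by (intro eq_matI) auto

lemma mat_mult_assoc:
  fixes A :: "'a :: semiring_0 mat"
  assumes "dim_col A = dim_row B" "dim_col B = dim_row C"
  shows "A * B * C = A * (B * C)"
  using assms by (intro assoc_mult_mat[OF carrier_matI[OF refl refl] carrier_matI carrier_matI]) auto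

lemma mat_adjoint_mult_dim:
  fixes A :: "complex mat"
  assumes "dim_col A = dim_row B"
  shows "(A * B)\<^sup>H = B\<^sup>H * A\<^sup>H"
  using assms by (intro mat_adjoint_mult[OF carrier_matI[OF refl refl] carrier_matI]) auto

lemmas mat_algebra = mat_mult_assoc mat_adjoint_mult_dim

lemma diag_of_real_carrier [simp]: "diag k d \<in> carrier_mat k k"
  by (simp add: diag_of_real_def)

lemma diag_of_real_dim [simp]: "dim_row (diag k d) = k" "dim_col (diag k d) = k"
  using diag_of_real_carrier[of k d] by blast+

lemma diag_of_real_index [simp]:
  "i < k \<Longrightarrow> j < k \<Longrightarrow> diag k d $$ (i, j) = (if i = j then complex_of_real (d i) else 0)"
  by (simp add: diag_of_real_def mat_diag_def)

lemma mat_adjoint_diag_of_real [simp]: "(diag k d)\<^sup>H = diag k d"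
  by (rule eq_matI) auto

lemma diag_of_real_mult [simp]:
  "diag k d * diag k e = diag k (\<lambda>i. d i * e i)"
  by (simp add: diag_of_real_def)

lemma diag_of_real_one: "(\<And>i. i < k \<Longrightarrow> d i = 1) \<Longrightarrow> diag k d = 1\<^sub>m k"
  by (rule eq_matI) auto

lemma diag_of_real_cong: "(\<And>i. i < k \<Longrightarrow> d i = e i) \<Longrightarrow> diag k d = diag k e"
  by (rule eq_matI) auto

lemma diag_of_real_mult_left:
  assumes "A \<in> carrier_mat k m"
  shows "diag k d * A = mat k m (\<lambda>(i, j). complex_of_real (d i) * A $$ (i, j))"
  unfolding diag_of_real_def by (rule mat_diag_mult_left[OF assms])

lemma mat_trace_mult:
  assumes "A \<in> carrier_mat n m" "B \<in> carrier_mat m n"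
  shows "mat_trace (A * B) = (\<Sum>i<n. \<Sum>j<m. A $$ (i, j) * B $$ (j, i))"
  using assms by (auto simp: mat_trace_def scalar_prod_def atLeast0LessThan intro!: sum.cong)

lemma mat_trace_comm:
  assumes "A \<in> carrier_mat n m" "B \<in> carrier_mat m n"
  shows "mat_trace (A * B) = mat_trace (B * A)"
  unfolding mat_trace_mult[OF assms] mat_trace_mult[OF assms(2,1)]
  by (subst sum.swap) (simp add: mult.commute)

lemma mat_trace_add:
  assumes "A \<in> carrier_mat n n" "B \<in> carrier_mat n n"
  shows "mat_trace (A + B) = mat_trace A + mat_trace B"
  using assms by (simp add: mat_trace_def sum.distrib)

lemma mat_trace_minus:
  assumes "A \<in> carrier_mat n n" "B \<in> carrier_mat n n"
  shows "mat_trace (A - B) = mat_trace A - mat_trace B"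
  using assms by (simp add: mat_trace_def sum_subtractf)

lemma mat_trace_diag_mult:
  assumes "Z \<in> carrier_mat k k"
  shows "mat_trace (diag k d * Z) = (\<Sum>i<k. complex_of_real (d i) * Z $$ (i, i))"
  by (subst diag_of_real_mult_left[OF assms]) (auto simp: mat_trace_def)

section \<open>The Frobenius norm and the trace pairing\<close>

definition frob_norm :: "complex mat \<Rightarrow> real" where
  "frob_norm A =
     L2_set (\<lambda>ij. cmod (A $$ ij)) ({..<dim_row A} \<times> {..<dim_col A})"

lemma frob_norm_nonneg [simp]: "0 \<le> frob_norm A"
  by (simp add: frob_norm_def L2_set_nonneg)

lemma frob_norm_square:
  assumes "A \<in> carrier_mat n m"
  shows "(frob_norm A)\<^sup>2 = (\<Sum>i<n. \<Sum>j<m. (cmod (A $$ (i, j)))\<^sup>2)"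
  using assms by (auto simp: frob_norm_def L2_set_def sum_nonneg sum.cartesian_product)

lemma frob_norm_triangle:
  assumes "A \<in> carrier_mat n m" "B \<in> carrier_mat n m"
  shows "frob_norm (A + B) \<le> frob_norm A + frob_norm B"
proof -
  let ?I = "{..<n} \<times> {..<m}"
  have "frob_norm (A + B) = L2_set (\<lambda>ij. cmod ((A + B) $$ ij)) ?I"
    using assms by (simp add: frob_norm_def)
  also have "\<dots> \<le> L2_set (\<lambda>ij. cmod (A $$ ij) + cmod (B $$ ij)) ?I"
    using assms by (intro L2_set_mono) (auto intro: norm_triangle_ineq)
  also have "\<dots> \<le> L2_set (\<lambda>ij. cmod (A $$ ij)) ?I + L2_set (\<lambda>ij. cmod (B $$ ij)) ?I"
    by (rule L2_set_triangle_ineq)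
  finally show ?thesis
    using assms by (simp add: frob_norm_def)
qed

lemma frob_norm_minus_commute:
  assumes "A \<in> carrier_mat n m" "B \<in> carrier_mat n m"
  shows "frob_norm (A - B) = frob_norm (B - A)"
  using assms by (auto simp: frob_norm_def norm_minus_commute intro!: L2_set_cong)

lemma frob_norm_adjoint [simp]: "frob_norm (A\<^sup>H) = frob_norm A"
proof -
  have "(frob_norm (A\<^sup>H))\<^sup>2 = (frob_norm A)\<^sup>2"
    unfolding frob_norm_square[OF carrier_matI[OF refl refl]]
    by (subst sum.swap) simp
  then show ?thesis
    by (simp add: power2_eq_iff_nonneg)
qed

lemma norm_entry_le_frobenius:
  assumes "i < dim_row A" "j < dim_col A"
  shows "cmod (A $$ (i, j)) \<le> frob_norm A"
  unfolding frob_norm_def using assms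
  by (intro member_le_L2_set[of _ "(i, j)" "\<lambda>ij. cmod (A $$ ij)"]) auto

lemma frob_norm_zero [simp]: "frob_norm (0\<^sub>m n m) = 0"
  by (auto simp: frob_norm_def L2_set_def intro!: sum.neutral)

lemma frob_norm_diff_eq_0:
  assumes "A \<in> carrier_mat n m" "B \<in> carrier_mat n m" "frob_norm (A - B) \<le> 0"
  shows "A = B"
proof (rule eq_matI)
  fix i j assume "i < dim_row B" "j < dim_col B"
  then show "A $$ (i, j) = B $$ (i, j)"
    using norm_entry_le_frobenius[of i "A - B" j] assms order.trans by fastforce
qed (use assms in auto)

text \<open>Cauchy-Schwarz: the trace of \<open>A * B\<close> is the entrywise inner product of
  \<open>A\<close> with the adjoint of \<open>B\<close>.\<close>

lemma norm_trace_mult_le: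
  assumes "A \<in> carrier_mat n m" "B \<in> carrier_mat m n"
  shows "cmod (mat_trace (A * B)) \<le> frob_norm A * frob_norm B"
proof -
  let ?I = "{..<n} \<times> {..<m}"
  have "mat_trace (A * B) = (\<Sum>ij\<in>?I. A $$ ij * cnj (B\<^sup>H $$ ij))"
    using assms by (auto simp: mat_trace_mult[OF assms] sum.cartesian_product intro!: sum.cong)
  also have "cmod \<dots> \<le> (\<Sum>ij\<in>?I. \<bar>cmod (A $$ ij)\<bar> * \<bar>cmod (B\<^sup>H $$ ij)\<bar>)"
    by (rule order.trans[OF norm_sum]) (simp add: norm_mult)
  also have "\<dots> \<le> L2_set (\<lambda>ij. cmod (A $$ ij)) ?I * L2_set (\<lambda>ij. cmod (B\<^sup>H $$ ij)) ?I"
    by (rule L2_set_mult_ineq)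
  also have "\<dots> = frob_norm A * frob_norm (B\<^sup>H)"
    using assms by (simp add: frob_norm_def)
  finally show ?thesis by simp
qed

lemma trace_adjoint_mult_self:
  assumes "A \<in> carrier_mat n m"
  shows "mat_trace (A\<^sup>H * A) = complex_of_real ((frob_norm A)\<^sup>2)"
proof -
  have "mat_trace (A\<^sup>H * A) = (\<Sum>i<m. \<Sum>j<n. A\<^sup>H $$ (i, j) * A $$ (j, i))"
    using assms by (intro mat_trace_mult) auto
  also have "\<dots> = (\<Sum>i<m. \<Sum>j<n. complex_of_real ((cmod (A $$ (j, i)))\<^sup>2))"
    using assms by (intro sum.cong) (auto simp: complex_norm_square mult.commute simp del: of_real_power)
  finally show ?thesis
    unfolding frob_norm_square[OF assms] by (subst sum.swap) simp
qed

section \<open>The Euclidean norm of vectors and operator bounds\<close>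

definition vec_norm2 :: "complex vec \<Rightarrow> real" where
  "vec_norm2 v = L2_set (\<lambda>i. cmod (v $ i)) {..<dim_vec v}"

lemma vec_norm2_nonneg [simp]: "0 \<le> vec_norm2 v"
  by (simp add: vec_norm2_def L2_set_nonneg)

lemma vec_norm2_square: "(vec_norm2 v)\<^sup>2 = (\<Sum>i<dim_vec v. (cmod (v $ i))\<^sup>2)"
  by (auto simp: vec_norm2_def L2_set_def sum_nonneg)

lemma cscalar_prod_self: "v \<bullet>c v = complex_of_real ((vec_norm2 v)\<^sup>2)"
  by (simp add: vec_norm2_square scalar_prod_def atLeast0LessThan complex_norm_square
      del: of_real_power)

lemma vec_norm2_eq_0: "v \<in> carrier_vec n \<Longrightarrow> vec_norm2 v = 0 \<longleftrightarrow> v = 0\<^sub>v n"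
  using conjugate_square_eq_0_vec[of v n] by (simp add: cscalar_prod_self)

lemma vec_norm2_triangle:
  assumes "v \<in> carrier_vec n" "w \<in> carrier_vec n"
  shows "vec_norm2 (v + w) \<le> vec_norm2 v + vec_norm2 w"
proof -
  have "vec_norm2 (v + w) = L2_set (\<lambda>i. cmod ((v + w) $ i)) {..<n}"
    using assms by (simp add: vec_norm2_def)
  also have "\<dots> \<le> L2_set (\<lambda>i. cmod (v $ i) + cmod (w $ i)) {..<n}"
    using assms by (intro L2_set_mono) (auto intro: norm_triangle_ineq)
  also have "\<dots> \<le> L2_set (\<lambda>i. cmod (v $ i)) {..<n} + L2_set (\<lambda>i. cmod (w $ i)) {..<n}"
    by (rule L2_set_triangle_ineq)
  finally show ?thesis
    using assms by (simp add: vec_norm2_def)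
qed

lemma vec_norm2_smult: "vec_norm2 (c \<cdot>\<^sub>v v) = cmod c * vec_norm2 v"
  by (auto simp: vec_norm2_def L2_set_right_distrib norm_mult intro!: L2_set_cong)

lemma vec_norm2_mult_le:
  assumes "A \<in> carrier_mat n m" "v \<in> carrier_vec m"
  shows "vec_norm2 (A *\<^sub>v v) \<le> frob_norm A * vec_norm2 v"
proof -
  have "(cmod ((A *\<^sub>v v) $ i))\<^sup>2 \<le> (\<Sum>j<m. (cmod (A $$ (i, j)))\<^sup>2) * (vec_norm2 v)\<^sup>2" if "i < n" for i
  proof -
    have "cmod ((A *\<^sub>v v) $ i) \<le> (\<Sum>j<m. \<bar>cmod (A $$ (i, j))\<bar> * \<bar>cmod (v $ j)\<bar>)"
      using assms that
      by (auto simp: scalar_prod_def atLeast0LessThan norm_mult intro!: order.trans[OF norm_sum])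
    also have "\<dots> \<le> L2_set (\<lambda>j. cmod (A $$ (i, j))) {..<m} * vec_norm2 v"
      using assms unfolding vec_norm2_def by (intro order.trans[OF L2_set_mult_ineq]) auto
    finally have "(cmod ((A *\<^sub>v v) $ i))\<^sup>2 \<le> (L2_set (\<lambda>j. cmod (A $$ (i, j))) {..<m} * vec_norm2 v)\<^sup>2"
      by (intro power_mono) auto
    then show ?thesis
      by (simp add: power_mult_distrib L2_set_def sum_nonneg)
  qed
  then have "(\<Sum>i<n. (cmod ((A *\<^sub>v v) $ i))\<^sup>2) \<le> (\<Sum>i<n. (\<Sum>j<m. (cmod (A $$ (i, j)))\<^sup>2) * (vec_norm2 v)\<^sup>2)"
    by (intro sum_mono) auto
  then have "(vec_norm2 (A *\<^sub>v v))\<^sup>2 \<le> (frob_norm A * vec_norm2 v)\<^sup>2"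
    using assms by (simp add: vec_norm2_square[of "A *\<^sub>v v"] power_mult_distrib
        frob_norm_square[OF assms(1)] sum_distrib_right)
  then show ?thesis
    by (rule power2_le_imp_le) simp
qed

lemma frob_norm_cols:
  "(frob_norm A)\<^sup>2 = (\<Sum>j<dim_col A. (vec_norm2 (col A j))\<^sup>2)"
  unfolding frob_norm_square[OF carrier_matI[OF refl refl]] vec_norm2_square
  by (subst sum.swap) auto

text \<open>The columns of \<open>A * B\<close> are the images of the columns of \<open>B\<close>,
  and the squared Frobenius norm adds up squared column norms. Left multiplication thus costs only
  an operator bound, which is how spectral radii enter Frobenius estimates.\<close>

lemma frob_norm_mult_le_op_bound:
  assumes "A \<in> carrier_mat n m" "B \<in> carrier_mat m k"
    and "0 \<le> c" "\<And>v. v \<in> carrier_vec m \<Longrightarrow> vec_norm2 (A *\<^sub>v v) \<le> c * vec_norm2 v"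
  shows "frob_norm (A * B) \<le> c * frob_norm B"
proof -
  have "(vec_norm2 (col (A * B) j))\<^sup>2 \<le> c\<^sup>2 * (vec_norm2 (col B j))\<^sup>2" if "j < k" for j
  proof -
    have "col (A * B) j = A *\<^sub>v col B j"
      by (rule col_mult2[OF assms(1,2) that])
    then have "vec_norm2 (col (A * B) j) \<le> c * vec_norm2 (col B j)"
      using assms(2,4) that by auto
    then show ?thesis
      unfolding power_mult_distrib[symmetric] by (intro power_mono) auto
  qed
  then have "(frob_norm (A * B))\<^sup>2 \<le> (c * frob_norm B)\<^sup>2"
    using assms(1,2)
    by (auto simp: frob_norm_cols power_mult_distrib sum_distrib_left intro!: sum_mono)
  then show ?thesis
    by (rule power2_le_imp_le) (use assms(3) in simp)
qed

lemma frob_norm_mult: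
  assumes "A \<in> carrier_mat n m" "B \<in> carrier_mat m k"
  shows "frob_norm (A * B) \<le> frob_norm A * frob_norm B"
  using assms by (intro frob_norm_mult_le_op_bound vec_norm2_mult_le) auto

lemma cscalar_prod_mult_mat_vec:
  fixes A :: "complex mat"
  assumes "A \<in> carrier_mat n m" "v \<in> carrier_vec m" "w \<in> carrier_vec n"
  shows "(A *\<^sub>v v) \<bullet>c w = v \<bullet>c (A\<^sup>H *\<^sub>v w)"
proof -
  have "(A *\<^sub>v v) \<bullet>c w = (\<Sum>i<n. \<Sum>j<m. A $$ (i, j) * v $ j * cnj (w $ i))"
    using assms by (simp add: scalar_prod_def atLeast0LessThan sum_distrib_right)
  also have "\<dots> = (\<Sum>j<m. \<Sum>i<n. A $$ (i, j) * v $ j * cnj (w $ i))"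
    by (rule sum.swap)
  also have "\<dots> = v \<bullet>c (A\<^sup>H *\<^sub>v w)"
    using assms by (simp add: scalar_prod_def atLeast0LessThan sum_distrib_left mult_ac)
  finally show ?thesis .
qed

text \<open>Reads entries of a compression as values of the sesquilinear form of \<open>W\<close> on
  columns of \<open>U\<close>, so that diagonal entries inherit the sign of the quadratic
  form.\<close>

lemma adjoint_sandwich_index:
  fixes U :: "complex mat"
  assumes "U \<in> carrier_mat n k" "W \<in> carrier_mat n n" "i < k" "j < k"
  shows "(U\<^sup>H * W * U) $$ (i, j) = (W *\<^sub>v col U j) \<bullet>c col U i"
proof -
  have "(U\<^sup>H * W * U) $$ (i, j) = (U\<^sup>H * (W * U)) $$ (i, j)"
    using assms by (subst assoc_mult_mat[of _ k n _ n _ k]) auto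
  also have "\<dots> = row (U\<^sup>H) i \<bullet> col (W * U) j"
    using assms by auto
  also have "row (U\<^sup>H) i = conjugate (col U i)"
    using assms by (intro eq_vecI) auto
  also have "col (W * U) j = W *\<^sub>v col U j"
    by (rule col_mult2[OF assms(2,1,4)])
  also have "conjugate (col U i) \<bullet> (W *\<^sub>v col U j) = (W *\<^sub>v col U j) \<bullet>c col U i"
    using assms by (intro comm_scalar_prod[of _ n]) auto
  finally show ?thesis .
qed

lemma unitary_right:
  fixes U :: "complex mat"
  assumes "U \<in> carrier_mat n n" "U\<^sup>H * U = 1\<^sub>m n"
  shows "U * U\<^sup>H = 1\<^sub>m n"
  using assms by (intro mat_mult_left_right_inverse[of "U\<^sup>H" n U]) auto

subsection \<open>The spectral theorem\<close>

text \<open>Gram-Schmidt, applied to a basis that begins with \<open>v\<close>, leaves its first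
  vector unchanged.\<close>

lemma unitary_extension:
  assumes v: "v \<in> carrier_vec n" and v1: "vec_norm2 v = 1"
  shows "\<exists>W. W \<in> carrier_mat n n \<and> W\<^sup>H * W = 1\<^sub>m n \<and> col W 0 = v"
proof -
  interpret cof_vec_space n "TYPE(complex)" .
  have v0: "v \<noteq> 0\<^sub>v n"
    using v1 vec_norm2_eq_0[OF v] by auto
  then have n0: "0 < n"
    using v by (cases n) auto
  note b = basis_completion[OF v v0]
  define ws where "ws = gram_schmidt n (basis_completion v)"
  note g = gram_schmidt_result[OF b(2) b(4) b(5) refl, folded ws_def]
  have len: "length ws = n"
    using g(4) b(6) by simp
  have hd: "ws ! 0 = v"
  proof -
    have "basis_completion v = v # tl (basis_completion v)"
      using b(6,7) n0 by (cases "basis_completion v") auto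
    then have "hd ws = v"
      using gram_schmidt_hd[OF v] unfolding ws_def by metis
    then show ?thesis
      using len n0 by (cases ws) auto
  qed
  have wsc: "ws ! i \<in> carrier_vec n" if "i < n" for i
    using g(3) len that nth_mem by blast
  have norm_nz: "vec_norm2 (ws ! i) \<noteq> 0" if "i < n" for i
    using corthogonalD[OF g(2), of i i] len that by (auto simp: cscalar_prod_self)
  \<comment> \<open>The vectors \<open>ws\<close> are orthogonal but not normalized, hence the
    division by their norms; column 0 is unaffected because \<open>v\<close> has norm 1.\<close>
  define W where "W = mat n n (\<lambda>(i, j). ws ! j $ i / complex_of_real (vec_norm2 (ws ! j)))"
  have "(W\<^sup>H * W) $$ (i, j) = (if i = j then 1 else 0)" if ij: "i < n" "j < n" for i j
  proof -
    have "(W\<^sup>H * W) $$ (i, j) = (\<Sum>k<n. ws ! j $ k * cnj (ws ! i $ k)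
        / (complex_of_real (vec_norm2 (ws ! i)) * complex_of_real (vec_norm2 (ws ! j))))"
      using ij by (simp add: W_def scalar_prod_def atLeast0LessThan mult.commute)
    also have "\<dots> = ws ! j \<bullet>c ws ! i
        / (complex_of_real (vec_norm2 (ws ! i)) * complex_of_real (vec_norm2 (ws ! j)))"
      using wsc[OF ij(1)] wsc[OF ij(2)]
      by (simp add: scalar_prod_def atLeast0LessThan sum_divide_distrib)
    also have "\<dots> = (if i = j then 1 else 0)"
      using corthogonalD[OF g(2), of j i] len ij norm_nz[OF ij(1)]
      by (auto simp: cscalar_prod_self power2_eq_square)
    finally show ?thesis .
  qed
  then have "W\<^sup>H * W = 1\<^sub>m n"
    by (intro eq_matI) (auto simp: W_def)
  moreover have "col W 0 = v"
    using n0 hd v v1 by (intro eq_vecI) (auto simp: W_def)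
  moreover have "W \<in> carrier_mat n n"
    by (simp add: W_def)
  ultimately show ?thesis by blast
qed

lemma unit_eigenvector_exists:
  fixes A :: "complex mat"
  assumes "A \<in> carrier_mat n n" "eigenvalue A e"
  obtains v where "v \<in> carrier_vec n" "vec_norm2 v = 1" "A *\<^sub>v v = e \<cdot>\<^sub>v v"
proof -
  from assms(2) obtain w where w: "w \<in> carrier_vec n" "w \<noteq> 0\<^sub>v n" "A *\<^sub>v w = e \<cdot>\<^sub>v w"
    using assms(1) unfolding eigenvalue_def eigenvector_def by auto
  define c where "c = complex_of_real (inverse (vec_norm2 w))"
  have w0: "vec_norm2 w \<noteq> 0"
    using w vec_norm2_eq_0 by auto
  have "A *\<^sub>v (c \<cdot>\<^sub>v w) = c \<cdot>\<^sub>v (A *\<^sub>v w)"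
    using assms w by (intro mult_mat_vec) auto
  also have "\<dots> = e \<cdot>\<^sub>v (c \<cdot>\<^sub>v w)"
    by (simp add: w(3) smult_smult_assoc mult.commute)
  finally show ?thesis
    using w w0 by (intro that[of "c \<cdot>\<^sub>v w"]) (auto simp: vec_norm2_smult c_def norm_inverse)
qed

lemma hermitian_matD:
  assumes "hermitian_mat A" "i < dim_row A" "j < dim_col A"
  shows "A $$ (i, j) = cnj (A $$ (j, i))"
  using assms mat_adjoint_index[of i A j] mat_adjoint_dim[of A]
  unfolding hermitian_mat_def by (metis complex_cnj_cnj conjugate_complex_def mat_adjoint_index)

lemma hermitian_sandwich:
  assumes "A \<in> carrier_mat n n" "hermitian_mat A" "B \<in> carrier_mat n m"
  shows "hermitian_mat (B\<^sup>H * A * B)"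
  using assms unfolding hermitian_mat_def
  by (subst mat_adjoint_mult[of _ m n _ m]) (auto simp: mat_adjoint_mult[of _ m n _ n])

lemma mat_adjoint_four_block:
  fixes A :: "complex mat"
  assumes "A \<in> carrier_mat n1 m1" "B \<in> carrier_mat n1 m2" "C \<in> carrier_mat n2 m1" "D \<in> carrier_mat n2 m2"
  shows "(four_block_mat A B C D)\<^sup>H = four_block_mat (A\<^sup>H) (C\<^sup>H) (B\<^sup>H) (D\<^sup>H)"
  using assms by (intro eq_matI) (auto)

lemma mat_adjoint_zero [simp]: "(0\<^sub>m n m :: complex mat)\<^sup>H = 0\<^sub>m m n"
  by (rule eq_matI) auto

text \<open>Deflation: in an orthonormal basis that starts with a unit eigenvector, the first column
  of the matrix is a multiple of the first unit vector. Hermitian symmetry clears the first row as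
  well, and the induction hypothesis treats the remaining minor.\<close>

theorem hermitian_spectral:
  assumes "A \<in> carrier_mat n n" "hermitian_mat A"
  shows "\<exists>U d. U \<in> carrier_mat n n \<and> U\<^sup>H * U = 1\<^sub>m n \<and> A = U * diag n d * U\<^sup>H"
  using assms
proof (induction n arbitrary: A)
  case 0
  then show ?case
    by (intro exI[of _ "1\<^sub>m 0"] exI[of _ "\<lambda>_. 0"]) auto
next
  case (Suc m)
  let ?n = "Suc m"
  note A = \<open>A \<in> carrier_mat ?n ?n\<close>
  obtain e where e: "eigenvalue A e"
    using spectrum_non_empty[OF A] by (auto simp: spectrum_def)
  obtain v where v: "v \<in> carrier_vec ?n" "vec_norm2 v = 1" "A *\<^sub>v v = e \<cdot>\<^sub>v v"
    using unit_eigenvector_exists[OF A e] .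
  obtain W where W: "W \<in> carrier_mat ?n ?n" "W\<^sup>H * W = 1\<^sub>m ?n" "col W 0 = v"
    using unitary_extension[OF v(1,2)] by blast
  note WW = unitary_right[OF W(1,2)]
  define B where "B = W\<^sup>H * A * W"
  have B: "B \<in> carrier_mat ?n ?n"
    using A W by (simp add: B_def)
  have Bh: "hermitian_mat B"
    unfolding B_def by (rule hermitian_sandwich[OF A Suc.prems(2) W(1)])
  have B0: "B $$ (i, 0) = (if i = 0 then e else 0)" if "i < ?n" for i
  proof -
    have wi: "col W i \<in> carrier_vec ?n"
      using W(1) that by auto
    have "B $$ (i, 0) = (A *\<^sub>v v) \<bullet>c col W i"
      unfolding B_def using adjoint_sandwich_index[OF W(1) A that, of 0] W(3) by simp
    also have "\<dots> = e * (v \<bullet>c col W i)"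
      unfolding v(3) using v(1) wi by simp
    also have "v \<bullet>c col W i = (W\<^sup>H * 1\<^sub>m ?n * W) $$ (i, 0)"
      using adjoint_sandwich_index[OF W(1) one_carrier_mat that, of 0] W(3) v(1) by simp
    also have "\<dots> = (if i = 0 then 1 else 0)"
      using W that by simp
    finally show ?thesis by simp
  qed
  \<comment> \<open>The eigenvalue sits on the diagonal of the Hermitian \<open>B\<close>, so it
    equals its own conjugate.\<close>
  have e_real: "e = complex_of_real (Re e)"
    using hermitian_matD[OF Bh, of 0 0] B B0[of 0] by (auto simp: complex_eq_iff)
  have B0': "B $$ (0, j) = (if j = 0 then e else 0)" if "j < ?n" for j
    using hermitian_matD[OF Bh, of 0 j] B B0[OF that] that e_real
    by (auto split: if_splits)
  define A' where "A' = mat m m (\<lambda>(i, j). B $$ (Suc i, Suc j))"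
  have A': "A' \<in> carrier_mat m m"
    by (simp add: A'_def)
  have "hermitian_mat A'"
    unfolding hermitian_mat_def
  proof (rule eq_matI)
    fix i j assume "i < dim_row A'" "j < dim_col A'"
    then show "A'\<^sup>H $$ (i, j) = A' $$ (i, j)"
      using hermitian_matD[OF Bh, of "Suc i" "Suc j"] B by (simp add: A'_def)
  qed (simp_all add: A'_def)
  from Suc.IH[OF A' this] obtain U' d' where U': "U' \<in> carrier_mat m m" "U'\<^sup>H * U' = 1\<^sub>m m"
    "A' = U' * diag m d' * U'\<^sup>H" by blast
  define d where "d = case_nat (Re e) d'"
  \<comment> \<open>Extends the diagonalization of the minor by a fixed first coordinate;
    \<open>W * V\<close> is the unitary matrix sought.\<close>
  define V where "V = four_block_mat (1\<^sub>m 1) (0\<^sub>m 1 m) (0\<^sub>m m 1) U'"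
  have V: "V \<in> carrier_mat ?n ?n"
    using four_block_carrier_mat[OF one_carrier_mat[of 1] U'(1)] by (simp add: V_def)
  have Vadj: "V\<^sup>H = four_block_mat (1\<^sub>m 1) (0\<^sub>m 1 m) (0\<^sub>m m 1) (U'\<^sup>H)"
    unfolding V_def using U' by (subst mat_adjoint_four_block[of _ 1 1 _ m _ m]) auto
  have D: "diag ?n d
      = four_block_mat (diag 1 (\<lambda>_. Re e)) (0\<^sub>m 1 m) (0\<^sub>m m 1) (diag m d')"
    by (rule eq_matI) (auto simp: d_def not_less split: nat.split)
  have VV: "V\<^sup>H * V = 1\<^sub>m ?n"
    unfolding Vadj unfolding V_def using U'
    by (subst mult_four_block_mat[of _ 1 1 _ m _ m _ _ 1 _ m]) auto
  have VDV: "V * diag ?n d * V\<^sup>H = B"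
  proof -
    have "V * diag ?n d = four_block_mat (diag 1 (\<lambda>_. Re e)) (0\<^sub>m 1 m) (0\<^sub>m m 1)
        (U' * diag m d')"
      unfolding D V_def using U'
      by (subst mult_four_block_mat[of _ 1 1 _ m _ m _ _ 1 _ m]) auto
    also have "\<dots> * V\<^sup>H = four_block_mat (diag 1 (\<lambda>_. Re e)) (0\<^sub>m 1 m) (0\<^sub>m m 1) A'"
      unfolding Vadj U'(3) using U'
      by (subst mult_four_block_mat[of _ 1 1 _ m _ m _ _ 1 _ m]) auto
    also have "\<dots> = B"
      using B B0 B0' e_real
      by (intro eq_matI) (auto simp: A'_def not_less less_Suc_eq_0_disj)
    finally show ?thesis .
  qed
  have "A = W * B * W\<^sup>H"
  proof -
    have "W * B * W\<^sup>H = (W * W\<^sup>H) * A * (W * W\<^sup>H)"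
      unfolding B_def using A W(1) by (simp add: mat_algebra)
    then show ?thesis
      using A by (simp add: WW)
  qed
  also have "\<dots> = (W * V) * diag ?n d * (W * V)\<^sup>H"
    unfolding VDV[symmetric] using W(1) V by (simp add: mat_algebra)
  finally have "A = (W * V) * diag ?n d * (W * V)\<^sup>H" .
  moreover have "(W * V)\<^sup>H * (W * V) = V\<^sup>H * (W\<^sup>H * W) * V"
    using W(1) V by (simp add: mat_algebra)
  then have "(W * V)\<^sup>H * (W * V) = 1\<^sub>m ?n"
    using W V VV by simp
  ultimately show ?case
    using W(1) V by (intro exI[of _ "W * V"] exI[of _ d]) auto
qed

subsection \<open>Positive semidefinite matrices\<close>

lemma isometry_col_nonzero:
  fixes U :: "complex mat"
  assumes "U \<in> carrier_mat n k" "U\<^sup>H * U = 1\<^sub>m k" "i < k"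
  shows "col U i \<noteq> 0\<^sub>v n"
proof
  assume "col U i = 0\<^sub>v n"
  then have "(U\<^sup>H * 1\<^sub>m n * U) $$ (i, i) = 0"
    using adjoint_sandwich_index[OF assms(1) one_carrier_mat assms(3,3)] by simp
  then show False
    using assms by simp
qed

lemma psd_matD:
  assumes "psd_mat n A"
  shows "A \<in> carrier_mat n n" "hermitian_mat A" "\<And>v. v \<in> carrier_vec n \<Longrightarrow> 0 \<le> (A *\<^sub>v v) \<bullet>c v"
  using assms by (auto simp: psd_mat_def)

lemma pd_matD:
  assumes "pd_mat n A"
  shows "A \<in> carrier_mat n n" "hermitian_mat A"
    "\<And>v. v \<in> carrier_vec n \<Longrightarrow> v \<noteq> 0\<^sub>v n \<Longrightarrow> 0 < (A *\<^sub>v v) \<bullet>c v"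
  using assms by (auto simp: pd_mat_def)

lemma pd_imp_psd: "pd_mat n A \<Longrightarrow> psd_mat n A"
  unfolding pd_mat_def psd_mat_def
proof (intro conjI ballI)
  fix v :: "complex vec" assume *: "A \<in> carrier_mat n n \<and> hermitian_mat A \<and>
    (\<forall>v\<in>carrier_vec n. v \<noteq> 0\<^sub>v n \<longrightarrow> 0 < (A *\<^sub>v v) \<bullet>c v)" "v \<in> carrier_vec n"
  then show "0 \<le> (A *\<^sub>v v) \<bullet>c v"
    by (cases "v = 0\<^sub>v n") (auto intro: less_imp_le)
qed auto

lemma psd_sandwich_diag:
  assumes "psd_mat n A" "U \<in> carrier_mat n k" "i < k"
  shows "0 \<le> (U\<^sup>H * A * U) $$ (i, i)"
  unfolding adjoint_sandwich_index[OF assms(2) psd_matD(1)[OF assms(1)] assms(3,3)]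
  using assms by (intro psd_matD(3)[OF assms(1)]) auto

lemma cscalar_prod_sandwich:
  fixes A :: "complex mat"
  assumes "A \<in> carrier_mat n n" "B \<in> carrier_mat n m" "v \<in> carrier_vec m"
  shows "((B\<^sup>H * A * B) *\<^sub>v v) \<bullet>c v = (A *\<^sub>v (B *\<^sub>v v)) \<bullet>c (B *\<^sub>v v)"
proof -
  have "(B\<^sup>H * A * B) *\<^sub>v v = B\<^sup>H *\<^sub>v (A *\<^sub>v (B *\<^sub>v v))"
    using assms by (simp add: assoc_mult_mat_vec[of _ m n _ m] assoc_mult_mat_vec[of _ m n _ n])
  then show ?thesis
    using assms by (simp add: cscalar_prod_mult_mat_vec[of "B\<^sup>H" m n])
qed

lemma psd_sandwich:
  assumes "psd_mat n A" "B \<in> carrier_mat n m"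
  shows "psd_mat m (B\<^sup>H * A * B)"
  unfolding psd_mat_def
  using hermitian_sandwich[OF psd_matD(1,2)[OF assms(1)] assms(2)] psd_matD[OF assms(1)] assms(2)
  by (auto simp: cscalar_prod_sandwich[OF psd_matD(1)[OF assms(1)] assms(2)] simp del: assoc_mult_mat)

lemma hermitian_add:
  assumes "A \<in> carrier_mat n n" "B \<in> carrier_mat n n" "hermitian_mat A" "hermitian_mat B"
  shows "hermitian_mat (A + B)"
  using assms by (simp add: hermitian_mat_def mat_adjoint_add)

lemma cscalar_prod_add:
  fixes A :: "complex mat"
  assumes "A \<in> carrier_mat n n" "B \<in> carrier_mat n n" "v \<in> carrier_vec n"
  shows "((A + B) *\<^sub>v v) \<bullet>c v = (A *\<^sub>v v) \<bullet>c v + (B *\<^sub>v v) \<bullet>c v"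
  using assms by (simp add: add_mult_distrib_mat_vec add_scalar_prod_distrib[of _ n])

lemma psd_add:
  assumes "psd_mat n A" "psd_mat n B"
  shows "psd_mat n (A + B)"
  unfolding psd_mat_def
  using hermitian_add[OF psd_matD(1)[OF assms(1)] psd_matD(1)[OF assms(2)]] psd_matD[OF assms(1)]
    psd_matD[OF assms(2)]
  by (auto simp: cscalar_prod_add[of A n B])

lemma pd_add_psd:
  assumes "pd_mat n A" "psd_mat n B"
  shows "pd_mat n (A + B)"
  unfolding pd_mat_def
  using hermitian_add[OF pd_matD(1)[OF assms(1)] psd_matD(1)[OF assms(2)]] pd_matD[OF assms(1)]
    psd_matD[OF assms(2)]
  by (auto simp: cscalar_prod_add[of A n B] add_pos_nonneg)

lemma minus_mat_zero:
  fixes A :: "complex mat"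
  shows "A \<in> carrier_mat n m \<Longrightarrow> A - 0\<^sub>m n m = A"
  by (intro eq_matI) auto

lemma psd_zero: "psd_mat n (0\<^sub>m n n)"
  by (auto simp: psd_mat_def hermitian_mat_def scalar_prod_def)

lemma cscalar_prod_diag:
  assumes "v \<in> carrier_vec k"
  shows "(diag k d *\<^sub>v v) \<bullet>c v = complex_of_real (\<Sum>i<k. d i * (cmod (v $ i))\<^sup>2)"
proof -
  have "(diag k d *\<^sub>v v) $ i = complex_of_real (d i) * v $ i" if "i < k" for i
  proof -
    have "(diag k d *\<^sub>v v) $ i
        = (\<Sum>j<k. (if i = j then complex_of_real (d i) else 0) * v $ j)"
      using assms that by (auto simp: scalar_prod_def atLeast0LessThan)
    also have "\<dots> = (\<Sum>j<k. if i = j then complex_of_real (d i) * v $ j else 0)"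
      by (intro sum.cong) auto
    also have "\<dots> = complex_of_real (d i) * v $ i"
      using that by (subst sum.delta') auto
    finally show ?thesis .
  qed
  then show ?thesis
    using assms by (auto simp: scalar_prod_def atLeast0LessThan complex_norm_square mult.assoc
        simp del: of_real_power index_mult_mat_vec intro!: sum.cong)
qed

lemma pd_diag:
  assumes "\<And>i. i < k \<Longrightarrow> 0 < d i"
  shows "pd_mat k (diag k d)"
  unfolding pd_mat_def
proof (intro conjI ballI impI)
  fix v :: "complex vec" assume v: "v \<in> carrier_vec k" "v \<noteq> 0\<^sub>v k"
  then obtain i where i: "i < k" "v $ i \<noteq> 0"
    by (metis carrier_vecD eq_vecI index_zero_vec)
  then have "0 < (\<Sum>i<k. d i * (cmod (v $ i))\<^sup>2)"
    using assms by (intro sum_pos2[of _ i]) (auto intro!: mult_pos_pos mult_nonneg_nonneg less_imp_le[OF assms])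
  then show "0 < (diag k d *\<^sub>v v) \<bullet>c v"
    unfolding cscalar_prod_diag[OF v(1)] by (simp add: less_complex_def)
qed (auto simp: hermitian_mat_def)

lemma psd_diag:
  assumes "\<And>i. i < k \<Longrightarrow> 0 \<le> d i"
  shows "psd_mat k (diag k d)"
  unfolding psd_mat_def
  using assms
  by (auto simp: hermitian_mat_def cscalar_prod_diag less_eq_complex_def simp del: of_real_sum intro!: sum_nonneg)

text \<open>A kernel vector would make the quadratic form vanish, so \<open>mat_inverse\<close>
  succeeds and the \<open>the\<close> in \<open>mat_inv\<close> is harmless. Positivity of the
  inverse \<open>S\<close> follows by writing it as the congruence
  \<open>S\<^sup>H * R * S\<close>.\<close>

lemma pd_inverse:
  assumes "pd_mat n R"
  shows "mat_inv R \<in> carrier_mat n n" "R * mat_inv R = 1\<^sub>m n" "mat_inv R * R = 1\<^sub>m n"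
    "hermitian_mat (mat_inv R)" "psd_mat n (mat_inv R)"
proof -
  note R = pd_matD[OF assms]
  have "det R \<noteq> 0"
  proof
    assume "det R = 0"
    then obtain v where "v \<in> carrier_vec n" "v \<noteq> 0\<^sub>v n" "R *\<^sub>v v = 0\<^sub>v n"
      using det_0_iff_vec_prod_zero_field[OF R(1)] by blast
    then show False
      using R(3)[of v] by simp
  qed
  then have "R \<in> Units (ring_mat TYPE(complex) n undefined)"
    by (rule det_non_zero_imp_unit[OF R(1)])
  then obtain B where "mat_inverse R = Some B"
    using mat_inverse(1)[OF R(1), of undefined] by (cases "mat_inverse R") auto
  from mat_inverse(2)[OF R(1) this] this
  show inv: "mat_inv R \<in> carrier_mat n n" "R * mat_inv R = 1\<^sub>m n" "mat_inv R * R = 1\<^sub>m n"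
    by (auto simp: mat_inv_def)
  let ?S = "mat_inv R"
  have SR: "(?S)\<^sup>H * R = 1\<^sub>m n"
    using arg_cong[OF inv(2), of mat_adjoint] inv(1) R(1,2)
    by (simp add: mat_algebra hermitian_mat_def)
  have "(?S)\<^sup>H = (?S)\<^sup>H * R * ?S"
    using inv R(1) by (simp add: mat_mult_assoc)
  also have "\<dots> = ?S"
    using SR inv by simp
  finally have adj: "(?S)\<^sup>H = ?S" .
  then show "hermitian_mat ?S"
    by (simp add: hermitian_mat_def)
  have "(?S)\<^sup>H * R * ?S = ?S"
    using adj inv by simp
  then show "psd_mat n ?S"
    using psd_sandwich[OF pd_imp_psd[OF assms] inv(1)] by simp
qed

lemma psd_eigenvalues_nonneg:
  assumes "psd_mat n A" "U \<in> carrier_mat n n" "U\<^sup>H * U = 1\<^sub>m n" "A = U * diag n d * U\<^sup>H" "i < n"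
  shows "0 \<le> d i"
proof -
  have "U\<^sup>H * A * U = (U\<^sup>H * U) * diag n d * (U\<^sup>H * U)"
    unfolding assms(4) using assms(2) by (simp add: mat_algebra)
  then have "U\<^sup>H * A * U = diag n d"
    using assms(3) by simp
  then show ?thesis
    using psd_sandwich_diag[OF assms(1,2,5)] assms(5) by (simp add: less_eq_complex_def)
qed

text \<open>The factor is the square root of the eigenvalue matrix times the adjoint of the
  eigenvector matrix. It turns traces and quadratic forms into squared norms.\<close>

lemma psd_factor:
  assumes "psd_mat n A"
  obtains F where "F \<in> carrier_mat n n" "A = F\<^sup>H * F"
proof -
  obtain U d where U: "U \<in> carrier_mat n n" "U\<^sup>H * U = 1\<^sub>m n" "A = U * diag n d * U\<^sup>H"
    using hermitian_spectral[OF psd_matD(1,2)[OF assms]] by blast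
  have d: "0 \<le> d i" if "i < n" for i
    using psd_eigenvalues_nonneg[OF assms U that] .
  let ?S = "diag n (\<lambda>i. sqrt (d i))"
  have "?S * ?S = diag n d"
    using d by (simp only: diag_of_real_mult, intro diag_of_real_cong) simp
  then have "A = U * (?S * ?S) * U\<^sup>H"
    using U(3) by simp
  then have "A = (?S * U\<^sup>H)\<^sup>H * (?S * U\<^sup>H)"
    using U(1) by (simp add: mat_algebra del: diag_of_real_mult)
  then show ?thesis
    using U(1) by (intro that[of "?S * U\<^sup>H"]) auto
qed

text \<open>For \<open>A = F\<^sup>H * F\<close> the trace is the squared Frobenius norm of
  \<open>F * B\<close>, so already \<open>F * B\<close> vanishes.\<close>

lemma psd_sandwich_trace_0:
  assumes "psd_mat n A" "B \<in> carrier_mat n m" "mat_trace (B\<^sup>H * A * B) = 0"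
  shows "A * B = 0\<^sub>m n m"
proof -
  obtain F where F: "F \<in> carrier_mat n n" "A = F\<^sup>H * F"
    using psd_factor[OF assms(1)] .
  have "B\<^sup>H * A * B = (F * B)\<^sup>H * (F * B)"
    using F assms(2) by (simp add: mat_algebra)
  then have "frob_norm (F * B) = 0"
    using assms(3) trace_adjoint_mult_self[of "F * B" n m] F assms(2) by simp
  then have "F * B = 0\<^sub>m n m"
    using F assms(2) by (intro frob_norm_diff_eq_0[of _ n m]) (auto simp: minus_mat_zero)
  then show ?thesis
    using F assms(2) by (simp add: mat_algebra)
qed

section \<open>The spectral radius of a Gram matrix as a squared operator norm\<close>

lemma vec_norm2_mult_square:
  fixes B :: "complex mat"
  assumes "B \<in> carrier_mat n m" "v \<in> carrier_vec m"
  shows "((B\<^sup>H * B) *\<^sub>v v) \<bullet>c v = complex_of_real ((vec_norm2 (B *\<^sub>v v))\<^sup>2)"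
proof -
  have "((B\<^sup>H * B) *\<^sub>v v) \<bullet>c v = ((B\<^sup>H * 1\<^sub>m n * B) *\<^sub>v v) \<bullet>c v"
    using assms by simp
  also have "\<dots> = (B *\<^sub>v v) \<bullet>c (B *\<^sub>v v)"
    using assms by (subst cscalar_prod_sandwich[of _ n _ m]) auto
  finally show ?thesis
    by (simp add: cscalar_prod_self)
qed

text \<open>An eigenvalue of the Gram matrix with unit eigenvector \<open>v\<close> equals the
  quadratic form at \<open>v\<close>, that is the squared norm of \<open>B *\<^sub>v v\<close>; in
  particular it is its own modulus. Positive dimension guarantees that there is an
  eigenvalue.\<close>

lemma spectral_radius_gram_attained:
  fixes B :: "complex mat"
  assumes "B \<in> carrier_mat n m" "0 < m"
  obtains v where "v \<in> carrier_vec m" "vec_norm2 v = 1"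
    "spectral_radius (B\<^sup>H * B) = (vec_norm2 (B *\<^sub>v v))\<^sup>2"
proof -
  have c: "B\<^sup>H * B \<in> carrier_mat m m"
    using assms by auto
  obtain e where e: "eigenvalue (B\<^sup>H * B) e" "spectral_radius (B\<^sup>H * B) = cmod e"
    using spectral_radius_mem_max(1)[OF c assms(2)] by (auto simp: spectrum_def)
  obtain v where v: "v \<in> carrier_vec m" "vec_norm2 v = 1" "(B\<^sup>H * B) *\<^sub>v v = e \<cdot>\<^sub>v v"
    using unit_eigenvector_exists[OF c e(1)] .
  have "e = complex_of_real ((vec_norm2 (B *\<^sub>v v))\<^sup>2)"
    using vec_norm2_mult_square[OF assms(1) v(1)] v by (simp add: cscalar_prod_self)
  then have "cmod e = (vec_norm2 (B *\<^sub>v v))\<^sup>2"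
    by (simp only: norm_of_real) simp
  then show ?thesis
    using e v that by simp
qed

lemma spectral_radius_gram_nonneg:
  assumes "B \<in> carrier_mat n m" "0 < m"
  shows "0 \<le> spectral_radius (B\<^sup>H * B)"
  using spectral_radius_gram_attained[OF assms] by (metis zero_le_power2)

text \<open>In coordinates of an eigenbasis of the Gram matrix, the squared norm of
  \<open>B *\<^sub>v v\<close> is a combination of squared coordinates of \<open>v\<close>, with the
  eigenvalues as coefficients.\<close>

lemma vec_norm2_le_spectral_radius:
  fixes B :: "complex mat"
  assumes B: "B \<in> carrier_mat n m" and m: "0 < m" and v: "v \<in> carrier_vec m"
  shows "vec_norm2 (B *\<^sub>v v) \<le> sqrt (spectral_radius (B\<^sup>H * B)) * vec_norm2 v"
proof -
  let ?A = "B\<^sup>H * B" let ?\<rho> = "spectral_radius (B\<^sup>H * B)"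
  have A: "?A \<in> carrier_mat m m" "hermitian_mat ?A"
    using B by (auto simp: hermitian_mat_def mat_algebra)
  obtain U d where U: "U \<in> carrier_mat m m" "U\<^sup>H * U = 1\<^sub>m m" "?A = U * diag m d * U\<^sup>H"
    using hermitian_spectral[OF A] by blast
  have d: "d i \<le> ?\<rho>" if i: "i < m" for i
  proof -
    have "?A * U = U * diag m d * (U\<^sup>H * U)"
      unfolding U(3) using U(1) by (simp add: mat_algebra)
    then have AU: "?A * U = U * diag m d"
      using U by simp
    have "?A *\<^sub>v col U i = col (U * diag m d) i"
      using AU A(1) U(1) i by (metis col_mult2)
    also have "\<dots> = complex_of_real (d i) \<cdot>\<^sub>v col U i"
      using U(1) i unfolding diag_of_real_def mat_diag_mult_right[OF U(1)]
      by (intro eq_vecI) (auto simp: mult.commute)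
    finally have "?A *\<^sub>v col U i = complex_of_real (d i) \<cdot>\<^sub>v col U i" .
    moreover have "col U i \<noteq> 0\<^sub>v m"
      by (rule isometry_col_nonzero[OF U(1,2) i])
    ultimately have "eigenvector ?A (col U i) (complex_of_real (d i))"
      using A(1) U(1) i by (auto simp: eigenvector_def)
    then have "complex_of_real (d i) \<in> spectrum ?A"
      by (auto simp: spectrum_def eigenvalue_def)
    then have "cmod (complex_of_real (d i)) \<le> ?\<rho>"
      by (intro spectral_radius_mem_max(2)[OF A(1) m] imageI)
    then show ?thesis by simp
  qed
  define w where "w = U\<^sup>H *\<^sub>v v"
  have w: "w \<in> carrier_vec m"
    using U(1) v by (auto simp: w_def)
  have "complex_of_real ((vec_norm2 (B *\<^sub>v v))\<^sup>2) = (?A *\<^sub>v v) \<bullet>c v"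
    by (rule vec_norm2_mult_square[OF B v, symmetric])
  also have "\<dots> = (((U\<^sup>H)\<^sup>H * diag m d * U\<^sup>H) *\<^sub>v v) \<bullet>c v"
    unfolding U(3) by simp
  also have "\<dots> = complex_of_real (\<Sum>i<m. d i * (cmod (w $ i))\<^sup>2)"
    unfolding w_def using U(1) v w[unfolded w_def]
    by (subst cscalar_prod_sandwich[of _ m _ m]) (auto simp: cscalar_prod_diag simp del: index_mult_mat_vec)
  finally have "(vec_norm2 (B *\<^sub>v v))\<^sup>2 = (\<Sum>i<m. d i * (cmod (w $ i))\<^sup>2)"
    using of_real_eq_iff by blast
  also have "\<dots> \<le> (\<Sum>i<m. ?\<rho> * (cmod (w $ i))\<^sup>2)"
    using d by (intro sum_mono mult_right_mono) auto
  also have "\<dots> = ?\<rho> * (vec_norm2 w)\<^sup>2"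
    using w by (simp add: vec_norm2_square sum_distrib_left)
  also have "(vec_norm2 w)\<^sup>2 = (vec_norm2 v)\<^sup>2"
  proof -
    have "complex_of_real ((vec_norm2 w)\<^sup>2) = (((U\<^sup>H)\<^sup>H * U\<^sup>H) *\<^sub>v v) \<bullet>c v"
      unfolding w_def using U(1) v by (subst vec_norm2_mult_square[of _ m m]) auto
    also have "\<dots> = complex_of_real ((vec_norm2 v)\<^sup>2)"
      using unitary_right[OF U(1,2)] v by (simp add: cscalar_prod_self)
    finally show ?thesis
      using of_real_eq_iff by blast
  qed
  finally have "(vec_norm2 (B *\<^sub>v v))\<^sup>2 \<le> (sqrt ?\<rho> * vec_norm2 v)\<^sup>2"
    using spectral_radius_gram_nonneg[OF B m] by (simp add: power_mult_distrib)
  then show ?thesis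
    by (rule power2_le_imp_le) (use spectral_radius_gram_nonneg[OF B m] in simp)
qed

text \<open>Each outer factor has operator norm at most \<open>sqrt s\<close>; the right one is
  moved to the left by taking adjoints. Allowing \<open>A\<close> and \<open>B\<close> to differ
  matters, because they will come from two different strategy profiles.\<close>

lemma frob_norm_two_sided:
  assumes A: "A \<in> carrier_mat n m" and B: "B \<in> carrier_mat n m" and X: "X \<in> carrier_mat m m"
    and m: "0 < m" and "spectral_radius (A\<^sup>H * A) \<le> s" "spectral_radius (B\<^sup>H * B) \<le> s"
  shows "frob_norm (A * X * B\<^sup>H) \<le> s * frob_norm X"
proof -
  have s: "0 \<le> s"
    using assms(5) spectral_radius_gram_nonneg[OF A m] by simp
  have op: "vec_norm2 (C *\<^sub>v v) \<le> sqrt s * vec_norm2 v"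
    if "C \<in> carrier_mat n m" "spectral_radius (C\<^sup>H * C) \<le> s" "v \<in> carrier_vec m" for C v
    using vec_norm2_le_spectral_radius[OF that(1) m that(3)] that(2)
    by (meson mult_right_mono order.trans real_sqrt_le_mono vec_norm2_nonneg)
  have "frob_norm (A * X * B\<^sup>H) = frob_norm (A * (X * B\<^sup>H))"
    using A B X by (simp add: mat_algebra)
  also have "\<dots> \<le> sqrt s * frob_norm (X * B\<^sup>H)"
    using A B X s op[OF A assms(5)] by (intro frob_norm_mult_le_op_bound[of _ n m _ n]) auto
  also have "frob_norm (X * B\<^sup>H) = frob_norm (B * X\<^sup>H)"
    using B X by (subst frob_norm_adjoint[symmetric]) (simp add: mat_algebra)
  also have "frob_norm (B * X\<^sup>H) \<le> sqrt s * frob_norm (X\<^sup>H)"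
    using B X s op[OF B assms(6)] by (intro frob_norm_mult_le_op_bound[of _ n m _ m]) auto
  finally have "frob_norm (A * X * B\<^sup>H) \<le> sqrt s * (sqrt s * frob_norm X)"
    using s by (simp add: mult_left_mono)
  then show ?thesis
    using s by (simp add: mult.assoc[symmetric])
qed

text \<open>Lipschitz continuity of the operator norm, tested at a vector where \<open>A\<close>
  attains its norm. The square roots are what makes the estimate linear in the difference.\<close>

lemma sqrt_spectral_radius_gram_le:
  assumes A: "A \<in> carrier_mat n m" and B: "B \<in> carrier_mat n m" and m: "0 < m"
  shows "sqrt (spectral_radius (A\<^sup>H * A)) \<le> sqrt (spectral_radius (B\<^sup>H * B)) + frob_norm (A - B)"
proof -
  obtain v where v: "v \<in> carrier_vec m" "vec_norm2 v = 1"
    "spectral_radius (A\<^sup>H * A) = (vec_norm2 (A *\<^sub>v v))\<^sup>2"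
    using spectral_radius_gram_attained[OF A m] .
  have "A *\<^sub>v v = B *\<^sub>v v + (A - B) *\<^sub>v v"
    using A B v by (subst add_mult_distrib_mat_vec[symmetric, of _ n m]) (auto intro!: arg_cong[of _ _ "\<lambda>M. M *\<^sub>v v"])
  then have "vec_norm2 (A *\<^sub>v v) \<le> vec_norm2 (B *\<^sub>v v) + vec_norm2 ((A - B) *\<^sub>v v)"
    using A B v by (metis vec_norm2_triangle mult_mat_vec_carrier minus_carrier_mat)
  also have "\<dots> \<le> sqrt (spectral_radius (B\<^sup>H * B)) + frob_norm (A - B)"
    using vec_norm2_le_spectral_radius[OF B m v(1)] vec_norm2_mult_le[OF minus_carrier_mat[OF B, of A] v(1)] v(2) by simp
  finally show ?thesis
    by (simp add: v(3))
qed

subsection \<open>Determinants and rank\<close>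

text \<open>Sylvester's identity: the block matrix \<open>?M\<close> has two block triangular
  factorizations, and their determinants are the two sides.\<close>

lemma det_one_plus_mult_commute:
  fixes X :: "complex mat"
  assumes X: "X \<in> carrier_mat n k" and Y: "Y \<in> carrier_mat k n"
  shows "det (1\<^sub>m n + X * Y) = det (1\<^sub>m k + Y * X)"
proof -
  let ?M = "four_block_mat (1\<^sub>m n) (- X) Y (1\<^sub>m k)"
  have "?M = four_block_mat (1\<^sub>m n) (0\<^sub>m n k) Y (1\<^sub>m k) * four_block_mat (1\<^sub>m n) (- X) (0\<^sub>m k n) (1\<^sub>m k + Y * X)"
  proof -
    have "- (Y * X) + (1\<^sub>m k + Y * X) = 1\<^sub>m k"
      using X Y by (intro eq_matI) auto
    then show ?thesis
      using X Y by (subst mult_four_block_mat[of _ n n _ k _ k _ _ n _ k]) auto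
  qed
  moreover have "det \<dots> = det (1\<^sub>m k + Y * X)"
    using X Y by (subst det_mult[of _ "n + k"])
      (auto simp: det_four_block_mat_upper_right_zero[of _ n _ k] det_four_block_mat_lower_left_zero[of _ n _ k])
  ultimately have 1: "det ?M = det (1\<^sub>m k + Y * X)" by simp
  have "?M = four_block_mat (1\<^sub>m n + X * Y) (- X) (0\<^sub>m k n) (1\<^sub>m k) * four_block_mat (1\<^sub>m n) (0\<^sub>m n k) Y (1\<^sub>m k)"
  proof -
    have "1\<^sub>m n + X * Y + - (X * Y) = 1\<^sub>m n"
      using X Y by (intro eq_matI) auto
    then show ?thesis
      using X Y by (subst mult_four_block_mat[of _ n n _ k _ k _ _ n _ k]) auto
  qed
  moreover have "det \<dots> = det (1\<^sub>m n + X * Y)"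
    using X Y by (subst det_mult[of _ "n + k"])
      (auto simp: det_four_block_mat_upper_right_zero[of _ n _ k] det_four_block_mat_lower_left_zero[of _ n _ k])
  ultimately show ?thesis
    using 1 by simp
qed

lemma det_diag_of_real: "det (diag k d) = complex_of_real (\<Prod>i<k. d i)"
proof -
  have "det (diag k d) = prod_list (diag_mat (diag k d))"
    by (rule det_upper_triangular[of _ k]) (auto intro!: upper_triangularI)
  also have "diag_mat (diag k d) = map (\<lambda>i. complex_of_real (d i)) [0..<k]"
    by (auto simp: diag_mat_def)
  also have "prod_list \<dots> = (\<Prod>i<k. complex_of_real (d i))"
    by (simp add: prod.distinct_set_conv_list[symmetric] atLeast0LessThan)
  finally show ?thesis by simp
qed

lemma det_unitary_conj:
  fixes U :: "complex mat"
  assumes "U \<in> carrier_mat n n" "U\<^sup>H * U = 1\<^sub>m n" "D \<in> carrier_mat n n"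
  shows "det (U * D * U\<^sup>H) = det D"
proof -
  have "det (U\<^sup>H) * det U = 1"
    using assms det_mult[of "U\<^sup>H" n U] by simp
  then have "det U * det (U\<^sup>H) = 1"
    by (simp add: mult.commute)
  then show ?thesis
    using assms by (simp add: det_mult[of _ n] mult.assoc mult.left_commute[of "det D"])
qed

text \<open>Sums \<open>ln x \<le> x - 1\<close> over the eigenvalues; equality forces every
  eigenvalue to be 1. The equality case later yields uniqueness of the best response. The real
  witness \<open>p\<close> avoids logarithms of complex determinants.\<close>

lemma log_det_le_trace:
  assumes "pd_mat k B"
  obtains p where "det B = complex_of_real p" "0 < p" "ln p \<le> Re (mat_trace B) - real k"
    "ln p = Re (mat_trace B) - real k \<Longrightarrow> B = 1\<^sub>m k"
proof -
  note B = pd_matD[OF assms]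
  obtain U d where U: "U \<in> carrier_mat k k" "U\<^sup>H * U = 1\<^sub>m k" "B = U * diag k d * U\<^sup>H"
    using hermitian_spectral[OF B(1,2)] by blast
  have UBU: "U\<^sup>H * B * U = diag k d"
  proof -
    have "U\<^sup>H * B * U = (U\<^sup>H * U) * diag k d * (U\<^sup>H * U)"
      unfolding U(3) using U(1) by (simp add: mat_algebra)
    then show ?thesis using U(2) by simp
  qed
  have d: "0 < d i" if i: "i < k" for i
  proof -
    have "col U i \<noteq> 0\<^sub>v k"
      by (rule isometry_col_nonzero[OF U(1,2) i])
    then have "0 < (U\<^sup>H * B * U) $$ (i, i)"
      unfolding adjoint_sandwich_index[OF U(1) B(1) i i] using U(1) i by (intro B(3)) auto
    then show ?thesis
      using i by (simp add: UBU less_complex_def)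
  qed
  have tr: "mat_trace B = complex_of_real (\<Sum>i<k. d i)"
  proof -
    have "mat_trace B = mat_trace (U * (diag k d * U\<^sup>H))"
      unfolding U(3) using U(1) by (simp add: mat_algebra)
    also have "\<dots> = mat_trace (diag k d * U\<^sup>H * U)"
      using U(1) by (subst mat_trace_comm[of _ k k]) auto
    also have "\<dots> = mat_trace (diag k d)"
      using U(1,2) by (simp add: mat_mult_assoc)
    finally show ?thesis
      by (simp add: mat_trace_def)
  qed
  let ?p = "\<Prod>i<k. d i"
  have det: "det B = complex_of_real ?p"
    unfolding U(3) by (simp add: det_unitary_conj[OF U(1,2)] det_diag_of_real del: of_real_prod)
  have ln: "ln ?p = (\<Sum>i<k. ln (d i))"
    using d by (intro ln_prod) force+
  have le: "ln (d i) \<le> d i - 1" if "i < k" for i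
    using d[OF that] by (rule ln_le_minus_one)
  have sum: "(\<Sum>i<k. d i - 1) = Re (mat_trace B) - real k"
    by (simp add: tr sum_subtractf)
  show ?thesis
  proof (rule that[OF det])
    show "0 < ?p" using d by (intro prod_pos) auto
    show "ln ?p \<le> Re (mat_trace B) - real k"
      unfolding ln sum[symmetric] using le by (intro sum_mono) auto
    assume "ln ?p = Re (mat_trace B) - real k"
    then have "(\<Sum>i<k. d i - 1 - ln (d i)) = 0"
      unfolding ln sum[symmetric] by (simp add: sum_subtractf)
    then have "d i - 1 - ln (d i) = 0" if "i < k" for i
      using le that by (subst (asm) sum_nonneg_eq_0_iff) auto
    then have "d i = 1" if "i < k" for i
      using d[OF that] that ln_eq_minus_one[of "d i"] by force
    then have "diag k d = 1\<^sub>m k"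
      by (rule diag_of_real_one)
    then show "B = 1\<^sub>m k"
      unfolding U(3) using U unitary_right[OF U(1,2)] by simp
  qed
qed

section \<open>Reduced eigendecompositions and rank\<close>

lemma reduced_eigendecompositionD:
  assumes "reduced_eigendecomposition n k A U d"
  shows "U \<in> carrier_mat n k" "U\<^sup>H * U = 1\<^sub>m k" "\<And>i. i < k \<Longrightarrow> 0 < d i"
    "A = U * diag k d * U\<^sup>H" "A \<in> carrier_mat n n"
  using assms by (auto simp: reduced_eigendecomposition_def)

text \<open>Keeps the eigenvectors with positive eigenvalue, enumerated by \<open>f\<close>; the
  others contribute nothing to the product. The size \<open>k\<close> is identified with the rank of
  the channel only later.\<close>

lemma reduced_eigendecomposition_exists:
  assumes "psd_mat n A"
  shows "\<exists>k U d. reduced_eigendecomposition n k A U d"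
proof -
  obtain V e where V: "V \<in> carrier_mat n n" "V\<^sup>H * V = 1\<^sub>m n" "A = V * diag n e * V\<^sup>H"
    using hermitian_spectral[OF psd_matD(1,2)[OF assms]] by blast
  have e: "0 \<le> e i" if "i < n" for i
    using psd_eigenvalues_nonneg[OF assms V that] .
  define I where "I = {i. i < n \<and> 0 < e i}"
  obtain f where f: "bij_betw f {..<card I} I"
    using ex_bij_betw_nat_finite[of I] by (auto simp: I_def atLeast0LessThan)
  define k where "k = card I"
  have fI: "f j \<in> I" "f j < n" "0 < e (f j)" if "j < k" for j
    using bij_betwE[OF f] that by (auto simp: k_def I_def)
  have f_inj: "f i = f j \<longleftrightarrow> i = j" if "i < k" "j < k" for i j
    using bij_betw_imp_inj_on[OF f] that by (auto simp: k_def inj_on_def)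
  define U where "U = mat n k (\<lambda>(i, j). V $$ (i, f j))"
  have U: "U \<in> carrier_mat n k"
    by (simp add: U_def)
  have "U\<^sup>H * U = 1\<^sub>m k"
  proof (rule eq_matI)
    fix i j assume "i < dim_row (1\<^sub>m k :: complex mat)" "j < dim_col (1\<^sub>m k :: complex mat)"
    then have ij: "i < k" "j < k" by auto
    have "(U\<^sup>H * U) $$ (i, j) = (\<Sum>l<n. cnj (V $$ (l, f i)) * V $$ (l, f j))"
      using ij by (simp add: U_def scalar_prod_def atLeast0LessThan)
    also have "\<dots> = (V\<^sup>H * V) $$ (f i, f j)"
      using ij V(1) fI by (simp add: scalar_prod_def atLeast0LessThan)
    finally show "(U\<^sup>H * U) $$ (i, j) = 1\<^sub>m k $$ (i, j)"
      using ij fI f_inj by (simp add: V(2))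
  qed (auto simp: U_def)
  moreover have "A = U * diag k (e \<circ> f) * U\<^sup>H"
  proof (rule eq_matI)
    fix i j assume "i < dim_row (U * diag k (e \<circ> f) * U\<^sup>H)" "j < dim_col (U * diag k (e \<circ> f) * U\<^sup>H)"
    then have ij: "i < n" "j < n"
      using U by auto
    have entry: "(M * diag m g * M\<^sup>H) $$ (i, j) = (\<Sum>l<m. M $$ (i, l) * complex_of_real (g l) * cnj (M $$ (j, l)))"
      if "M \<in> carrier_mat n m" for M m g
      using that ij unfolding diag_of_real_def mat_diag_mult_right[OF that]
      by (simp add: scalar_prod_def atLeast0LessThan)
    have "A $$ (i, j) = (\<Sum>l<n. V $$ (i, l) * complex_of_real (e l) * cnj (V $$ (j, l)))"
      unfolding V(3) by (rule entry[OF V(1)])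
    also have "\<dots> = (\<Sum>l\<in>I. V $$ (i, l) * complex_of_real (e l) * cnj (V $$ (j, l)))"
      using e by (intro sum.mono_neutral_right) (auto simp: I_def order.order_iff_strict)
    also have "\<dots> = (\<Sum>l<k. V $$ (i, f l) * complex_of_real (e (f l)) * cnj (V $$ (j, f l)))"
      unfolding k_def by (rule sum.reindex_bij_betw[OF f, symmetric])
    also have "\<dots> = (U * diag k (e \<circ> f) * U\<^sup>H) $$ (i, j)"
      unfolding entry[OF U] using ij by (simp add: U_def)
    finally show "A $$ (i, j) = (U * diag k (e \<circ> f) * U\<^sup>H) $$ (i, j)" .
  qed (use V U in auto)
  ultimately have "reduced_eigendecomposition n k A U (e \<circ> f)"
    using U fI by (simp add: reduced_eigendecomposition_def)
  then show ?thesis by blast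
qed

text \<open>\<open>H * U\<close> has a left inverse, hence independent columns, and the same column
  space as \<open>H\<close>, since each matrix is a right multiple of the other.\<close>

lemma mat_rank_eqI:
  assumes H: "H \<in> carrier_mat m n" and U: "U \<in> carrier_mat n k" and L: "L \<in> carrier_mat k m"
    and LHU: "L * (H * U) = 1\<^sub>m k" and HUU: "H * U * U\<^sup>H = H"
  shows "mat_rank H = k"
proof -
  interpret vec_space "TYPE(complex)" m .
  let ?F = "H * U"
  have F: "?F \<in> carrier_mat m k"
    using H U by auto
  \<comment> \<open>Independence is expressed for the set of columns, so repeated columns have to be
    excluded separately.\<close>
  have "distinct (cols ?F)"
    unfolding distinct_conv_nth
  proof (intro allI impI)
    fix i j assume ij: "i < length (cols ?F)" "j < length (cols ?F)" "i \<noteq> j"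
    then have k: "i < k" "j < k"
      using U by auto
    show "cols ?F ! i \<noteq> cols ?F ! j"
    proof
      assume "cols ?F ! i = cols ?F ! j"
      then have "col ?F i = col ?F j"
        using ij by simp
      then have "col (L * ?F) i = col (L * ?F) j"
        by (simp only: col_mult2[OF L F k(1)] col_mult2[OF L F k(2)])
      then have "col (1\<^sub>m k :: complex mat) i $ i = col (1\<^sub>m k) j $ i"
        by (simp only: LHU)
      then show False
        using k ij(3) by simp
    qed
  qed
  moreover have "lin_indpt (set (cols ?F))"
  proof
    assume "lin_dep (set (cols ?F))"
    then obtain v where v: "v \<in> carrier_vec k" "v \<noteq> 0\<^sub>v k" "?F *\<^sub>v v = 0\<^sub>v m"
      using lin_depE[OF F _ calculation] by blast
    have "v = (L * ?F) *\<^sub>v v"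
      using v by (simp add: LHU)
    also have "\<dots> = L *\<^sub>v (?F *\<^sub>v v)"
      using L F v by (intro assoc_mult_mat_vec)
    also have "\<dots> = 0\<^sub>v k"
      using L v(3) by (intro eq_vecI) (auto simp: scalar_prod_def)
    finally show False
      using v by simp
  qed
  ultimately have "rank ?F = k"
    by (rule lin_indpt_full_rank[OF F])
  moreover have "col_space ?F = col_space H"
    unfolding col_space_eq[OF F] col_space_eq[OF H]
  proof safe
    fix x :: "complex vec" assume x: "x \<in> carrier_vec (dim_col ?F)"
    then show "\<exists>y\<in>carrier_vec (dim_col H). H *\<^sub>v y = ?F *\<^sub>v x"
      using H U by (intro bexI[of _ "U *\<^sub>v x"]) (auto simp: assoc_mult_mat_vec[of _ m n _ k])
  next
    fix x :: "complex vec" assume x: "x \<in> carrier_vec (dim_col H)"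
    have "?F *\<^sub>v (U\<^sup>H *\<^sub>v x) = ?F * U\<^sup>H *\<^sub>v x"
      using F U H x by (intro assoc_mult_mat_vec[symmetric, of _ m k _ n]) auto
    then show "\<exists>y\<in>carrier_vec (dim_col ?F). ?F *\<^sub>v y = H *\<^sub>v x"
      using HUU H U x by (intro bexI[of _ "U\<^sup>H *\<^sub>v x"]) auto
  qed (use H U in auto)
  then have "span (set (cols ?F)) = span (set (cols H))"
    by (simp add: col_space_def)
  ultimately show ?thesis
    using H by (simp add: mat_rank_def rank_def)
qed

subsection \<open>Weighted pseudo-inverses\<close>

lemma isometry_mult_cancel:
  fixes U :: "complex mat"
  assumes "U \<in> carrier_mat n k" "U\<^sup>H * U = 1\<^sub>m k" "dim_row Y = k"
  shows "U\<^sup>H * (U * Y) = Y"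
  using mat_mult_assoc[of "U\<^sup>H" U Y] assms
  by (metis carrier_matI carrier_matD left_mult_one_mat mat_adjoint_dim)

text \<open>The minimum-norm weighted least-squares inverse: for invertible Hermitian
  \<open>R\<close>, the last condition says that \<open>A * X\<close> is an orthogonal projector for
  the inner product given by the inverse of \<open>R\<close>. Writing it with \<open>R\<close> keeps
  the condition linear in the weight. The identity weight gives the Moore-Penrose inverse.\<close>

definition weighted_pinv :: "complex mat \<Rightarrow> complex mat \<Rightarrow> complex mat \<Rightarrow> bool" where
  "weighted_pinv R A X \<longleftrightarrow> X \<in> carrier_mat (dim_col A) (dim_row A) \<and>
     A * X * A = A \<and> X * A * X = X \<and> hermitian_mat (X * A) \<and> hermitian_mat (A * X * R)"

lemma weighted_pinvD:
  assumes "weighted_pinv R A X" "A \<in> carrier_mat m n" "R \<in> carrier_mat m m" "hermitian_mat R"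
  shows "X \<in> carrier_mat n m" "A * X * A = A" "X * A * X = X" "(X * A)\<^sup>H = X * A"
    "R * X\<^sup>H * A\<^sup>H = A * X * R"
  using assms by (auto simp: weighted_pinv_def hermitian_mat_def mat_algebra)

lemma is_pseudo_inverse_iff_weighted:
  "is_pseudo_inverse A X \<longleftrightarrow> weighted_pinv (1\<^sub>m (dim_row A)) A X"
  by (auto simp: is_pseudo_inverse_def weighted_pinv_def)

text \<open>Both products are orthogonal projectors with the kernel of \<open>A\<close>, whatever
  the weights. Algebraically, \<open>A = A * X * A\<close> gives
  \<open>Y * A = (Y * A) * (X * A)\<close>, and taking adjoints reverses the order, after which
  \<open>A * Y * A = A\<close> collapses the product.\<close>

lemma weighted_pinv_row_projector:
  assumes A: "A \<in> carrier_mat m n"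
    and R: "R \<in> carrier_mat m m" "hermitian_mat R" "weighted_pinv R A X"
    and S: "S \<in> carrier_mat m m" "hermitian_mat S" "weighted_pinv S A Y"
  shows "X * A = Y * A"
proof -
  note X = weighted_pinvD[OF R(3) A R(1,2)]
  note Y = weighted_pinvD[OF S(3) A S(1,2)]
  have "(Y * A) * (X * A) = Y * (A * X * A)"
    using A X(1) Y(1) by (simp add: mat_mult_assoc)
  then have "Y * A = (Y * A) * (X * A)"
    using X(2) by simp
  then have "(Y * A)\<^sup>H = ((Y * A) * (X * A))\<^sup>H"
    by simp
  also have "\<dots> = (X * A)\<^sup>H * (Y * A)\<^sup>H"
    using A X(1) Y(1) by (intro mat_adjoint_mult_dim) simp
  finally have "Y * A = (X * A) * (Y * A)"
    unfolding X(4) Y(4) .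
  also have "\<dots> = X * (A * Y * A)"
    using A X(1) Y(1) by (simp add: mat_mult_assoc)
  finally show ?thesis
    using Y(2) by simp
qed

text \<open>With \<open>R = S\<close> the next lemma gives uniqueness, and with \<open>R\<close> tending to \<open>S\<close> continuity.\<close>

lemma weighted_pinv_diff:
  assumes A: "A \<in> carrier_mat m n"
    and R: "R \<in> carrier_mat m m" "hermitian_mat R" "weighted_pinv R A X"
    and S: "S \<in> carrier_mat m m" "hermitian_mat S" "weighted_pinv S A Y"
  shows "(X - Y) * S = X * (S - R) * (1\<^sub>m m - A * Y)\<^sup>H"
proof -
  note X = weighted_pinvD[OF R(3) A R(1,2)]
  note Y = weighted_pinvD[OF S(3) A S(1,2)]
  note E = weighted_pinv_row_projector[OF A R S]
  \<comment> \<open>The adjoint of the projector complementary to \<open>A * Y\<close>. It is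
    annihilated by \<open>A\<^sup>H\<close> from the left; since \<open>X * R\<close> ends in
    \<open>A\<^sup>H\<close>, the \<open>R\<close> part of the right-hand side vanishes.\<close>
  let ?Q = "(1\<^sub>m m - A * Y)\<^sup>H"
  have Q: "?Q \<in> carrier_mat m m" "?Q = 1\<^sub>m m - Y\<^sup>H * A\<^sup>H"
    using A Y(1) by (auto simp: mat_adjoint_minus[of _ m m] mat_algebra)
  have XR: "X * R = X * R * X\<^sup>H * A\<^sup>H"
  proof -
    have "X * R = (X * A * X) * R"
      using X(3) by simp
    also have "\<dots> = X * (A * X * R)"
      using A X(1) R(1) by (simp add: mat_mult_assoc)
    also have "\<dots> = X * R * X\<^sup>H * A\<^sup>H"
      unfolding X(5)[symmetric] using A X(1) R(1) by (simp add: mat_mult_assoc)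
    finally show ?thesis .
  qed
  have "A\<^sup>H * ?Q = (A - A * Y * A)\<^sup>H"
    unfolding Q(2) using A Y(1)
    by (simp add: mat_adjoint_minus[of _ m n] mat_algebra mult_minus_distrib_mat[of _ n m _ m])
  also have "\<dots> = 0\<^sub>m n m"
    using A Y(2) by simp
  finally have AQ: "A\<^sup>H * ?Q = 0\<^sub>m n m" .
  have XRQ: "X * R * ?Q = 0\<^sub>m n m"
  proof -
    have "X * R * ?Q = X * R * X\<^sup>H * A\<^sup>H * ?Q"
      by (subst XR) simp
    also have "\<dots> = X * R * X\<^sup>H * (A\<^sup>H * ?Q)"
      using A X(1) R(1) Q(1) Y(1) by (simp add: mat_mult_assoc)
    finally show ?thesis
      using X(1) R(1) by (simp add: AQ)
  qed
  \<comment> \<open>The \<open>S\<close> part alone produces the left-hand side: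
    \<open>S * Y\<^sup>H * A\<^sup>H\<close> is \<open>A * Y * S\<close>, and \<open>X * A\<close>
    may be replaced by \<open>Y * A\<close>.\<close>
  have XSQ: "X * S * ?Q = (X - Y) * S"
  proof -
    have "X * S * ?Q = X * S - X * (S * Y\<^sup>H * A\<^sup>H)"
      unfolding Q(2) using A X(1) Y(1) S(1)
      by (simp add: mult_minus_distrib_mat[of _ n m _ m] mat_mult_assoc)
    also have "X * (S * Y\<^sup>H * A\<^sup>H) = (X * A) * Y * S"
      unfolding Y(5) using A X(1) Y(1) S(1) by (simp add: mat_mult_assoc)
    also have "\<dots> = Y * S"
      unfolding E Y(3) ..
    finally show ?thesis
      using X(1) Y(1) S(1) by (simp add: minus_mult_distrib_mat[of _ n m])
  qed
  have "X * (S - R) * ?Q = X * S * ?Q - X * R * ?Q"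
    using X(1) R(1) S(1) Q(1)
    by (simp add: mult_minus_distrib_mat[of _ n m _ m] minus_mult_distrib_mat[of _ n m _ _ m])
  then show ?thesis
    using X(1) Y(1) S(1) minus_mat_zero[OF mult_carrier_mat[OF minus_carrier_mat[OF Y(1), of X] S(1)]] by (simp add: XRQ XSQ)
qed

lemma weighted_pinv_unique:
  assumes A: "A \<in> carrier_mat m n" and R: "pd_mat m R"
    and "weighted_pinv R A X" "weighted_pinv R A Y"
  shows "X = Y"
proof -
  note Rc = pd_matD(1,2)[OF R] and Ri = pd_inverse[OF R]
  note X = weighted_pinvD(1)[OF assms(3) A Rc] and Y = weighted_pinvD(1)[OF assms(4) A Rc]
  have "(X - Y) * R = X * (R - R) * (1\<^sub>m m - A * Y)\<^sup>H"
    by (rule weighted_pinv_diff[OF A Rc assms(3) Rc assms(4)])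
  also have "\<dots> = 0\<^sub>m n m"
    using X Y A Rc by (auto simp: mat_adjoint_carrier)
  finally have "(X - Y) * R * mat_inv R = 0\<^sub>m n m"
    using Ri by simp
  then have "X - Y = 0\<^sub>m n m"
    using X Y Rc Ri by (simp add: mat_mult_assoc)
  then show ?thesis
    using X Y by (intro frob_norm_diff_eq_0[of _ n m]) auto
qed

text \<open>The identity that makes the waterfilling map contract: both cross terms collapse, so the
  difference of the two nonlinear expressions is linear in \<open>R - S\<close>.\<close>

lemma weighted_pinv_quadratic_diff:
  assumes A: "A \<in> carrier_mat m n"
    and R: "R \<in> carrier_mat m m" "hermitian_mat R" "weighted_pinv R A X"
    and S: "S \<in> carrier_mat m m" "hermitian_mat S" "weighted_pinv S A Y"
  shows "X * R * X\<^sup>H - Y * S * Y\<^sup>H = X * (R - S) * Y\<^sup>H"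
proof -
  note X = weighted_pinvD[OF R(3) A R(1,2)]
  note Y = weighted_pinvD[OF S(3) A S(1,2)]
  \<comment> \<open>Inserting \<open>X = X * A * X\<close> and moving \<open>A\<close> across
    \<open>R\<close> makes \<open>Y\<close> occur only as \<open>Y * A\<close>, which is the common
    row projector \<open>X * A\<close>.\<close>
  have cross: "X * R * Y\<^sup>H = X * R * X\<^sup>H"
    if R: "R \<in> carrier_mat m m" "hermitian_mat R" "weighted_pinv R A X"
      and S: "S \<in> carrier_mat m m" "hermitian_mat S" "weighted_pinv S A Y" for R S X Y
  proof -
    note X = weighted_pinvD[OF R(3) A R(1,2)]
    note Y = weighted_pinvD[OF S(3) A S(1,2)]
    have "X * R * Y\<^sup>H = (X * A * X) * R * Y\<^sup>H"
      using X(3) by simp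
    also have "\<dots> = X * (A * X * R) * Y\<^sup>H"
      using A X(1) Y(1) R(1) by (simp add: mat_mult_assoc)
    also have "\<dots> = X * R * X\<^sup>H * (Y * A)\<^sup>H"
      unfolding X(5)[symmetric] using A X(1) Y(1) R(1) by (simp add: mat_algebra)
    also have "(Y * A)\<^sup>H = (X * A)\<^sup>H"
      by (simp add: weighted_pinv_row_projector[OF A R S])
    also have "X * R * X\<^sup>H * (X * A)\<^sup>H = X * R * (X * A * X)\<^sup>H"
      unfolding X(4) using A X(1) R(1) X(4) by (simp add: mat_algebra)
    finally show ?thesis
      unfolding X(3) .
  qed
  \<comment> \<open>The second mixed term is the first one with the roles of the two weights
    exchanged, up to an adjoint.\<close>
  have "(X * S * Y\<^sup>H)\<^sup>H = (Y * S * Y\<^sup>H)\<^sup>H"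
    using cross[OF S R] X(1) Y(1) S(1,2) by (simp add: mat_algebra hermitian_mat_def)
  then have "((X * S * Y\<^sup>H)\<^sup>H)\<^sup>H = ((Y * S * Y\<^sup>H)\<^sup>H)\<^sup>H"
    by (rule arg_cong)
  then have "X * S * Y\<^sup>H = Y * S * Y\<^sup>H"
    by (simp only: mat_adjoint_adjoint)
  then show ?thesis
    using cross[OF R S] X(1) Y(1) R(1) S(1)
    by (simp add: mult_minus_distrib_mat[of _ n m _ m] minus_mult_distrib_mat[of _ n m _ _ n])
qed

text \<open>\<open>Z\<close> is the pseudo-inverse of the weighted Gram matrix times
  \<open>H\<^sup>H * mat_inv R\<close>, the generalized least-squares estimator. The lemma also
  identifies the number of positive eigenvalues with the rank of \<open>H\<close>.\<close>

lemma gram_reduced_eigendecomposition: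
  assumes H: "H \<in> carrier_mat m n" and R: "pd_mat m R"
    and red: "reduced_eigendecomposition n k (H\<^sup>H * mat_inv R * H) U d"
  defines "Z \<equiv> U * diag k (\<lambda>i. inverse (d i)) * U\<^sup>H * H\<^sup>H * mat_inv R"
  shows "weighted_pinv R H Z" "Z * H = U * U\<^sup>H"
    "Z * R * Z\<^sup>H = U * diag k (\<lambda>i. inverse (d i)) * U\<^sup>H"
    "mat_rank H = k" "k = m \<Longrightarrow> H * Z = 1\<^sub>m m"
proof -
  note Rc = pd_matD(1,2)[OF R] and Ri = pd_inverse[OF R]
  note U = reduced_eigendecompositionD[OF red]
  let ?D = "diag k d" and ?Di = "diag k (\<lambda>i. inverse (d i))"
  let ?Ri = "mat_inv R"
  have dd: "?Di * ?D = 1\<^sub>m k"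
    using U(3) by (simp only: diag_of_real_mult, intro diag_of_real_one) (use U(3) in force)
  note UU = isometry_mult_cancel[OF U(1,2)]
  have DD: "?Di * (?D * Y) = Y" if "dim_row Y = k" for Y
    using mat_mult_assoc[of ?Di ?D Y] dd that by (metis carrier_matI diag_of_real_dim left_mult_one_mat)
  \<comment> \<open>The projector onto the orthogonal complement of the range of \<open>U\<close>,
    on which the Gram matrix vanishes. Positivity of the inverse of \<open>R\<close> upgrades this
    to \<open>H * ?B = 0\<close>, so \<open>H\<close> is unchanged by \<open>U * U\<^sup>H\<close>
    on its right.\<close>
  let ?B = "1\<^sub>m n - U * U\<^sup>H"
  have B: "?B \<in> carrier_mat n n"
    using U(1) by auto
  have "U\<^sup>H * ?B = 0\<^sub>m k n"
    using U(1,2) by (simp add: mult_minus_distrib_mat[of _ k n _ n] mat_mult_assoc[symmetric] del: assoc_mult_mat)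
  then have "(H * ?B)\<^sup>H * ?Ri * (H * ?B) = 0\<^sub>m n n"
  proof -
    have "(H * ?B)\<^sup>H * ?Ri * (H * ?B) = ?B\<^sup>H * (H\<^sup>H * ?Ri * H) * ?B"
      using H Ri(1) B U(1) by (simp add: mat_algebra)
    also have "\<dots> = ?B\<^sup>H * (U * ?D) * (U\<^sup>H * ?B)"
      unfolding U(4) using B U(1) by (simp add: mat_algebra)
    finally show ?thesis
      using B U(1) \<open>U\<^sup>H * ?B = 0\<^sub>m k n\<close> by simp
  qed
  then have "?Ri * (H * ?B) = 0\<^sub>m m n"
    using H B by (intro psd_sandwich_trace_0[OF Ri(5)]) (auto simp: mat_trace_def)
  moreover have "H * ?B = R * (?Ri * (H * ?B))"
    using H Ri Rc U(1) mat_mult_assoc[of R ?Ri "H * ?B"] by simp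
  ultimately have "H * ?B = 0\<^sub>m m n"
    using Rc by simp
  then have "H - H * (U * U\<^sup>H) = 0\<^sub>m m n"
    using H U(1) by (simp add: mult_minus_distrib_mat[of _ m n _ n])
  then have "H = H * U * U\<^sup>H"
    using H U(1) by (intro frob_norm_diff_eq_0[of _ m n]) (auto simp: mat_mult_assoc)
  then have HE: "H * U * U\<^sup>H = H" ..
  have Zc: "Z \<in> carrier_mat n m"
    unfolding Z_def using U(1) H Ri(1) by auto
  show ZH: "Z * H = U * U\<^sup>H"
  proof -
    have "Z * H = U * ?Di * U\<^sup>H * (H\<^sup>H * ?Ri * H)"
      unfolding Z_def using U(1) H Ri(1) by (simp add: mat_mult_assoc)
    also have "\<dots> = U * (?Di * (U\<^sup>H * (U * (?D * U\<^sup>H))))"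
      unfolding U(4) using U(1) by (simp add: mat_mult_assoc)
    finally show ?thesis
      using U(1) by (simp add: UU DD)
  qed
  have UUZ: "U * U\<^sup>H * Z = Z"
    unfolding Z_def using U(1) H Ri(1) by (simp add: mat_mult_assoc UU DD)
  have ZR: "Z * R = U * ?Di * U\<^sup>H * H\<^sup>H"
    unfolding Z_def using U(1) H Ri Rc by (simp add: mat_mult_assoc)
  show "Z * R * Z\<^sup>H = U * ?Di * U\<^sup>H"
  proof -
    have "Z * R * Z\<^sup>H = U * ?Di * U\<^sup>H * (Z * H)\<^sup>H"
      unfolding ZR using U(1) H Zc by (simp add: mat_algebra)
    also have "\<dots> = U * ?Di * U\<^sup>H"
      unfolding ZH using U(1) by (simp add: mat_algebra UU DD)
    finally show ?thesis .
  qed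
  show "weighted_pinv R H Z"
    unfolding weighted_pinv_def
  proof (intro conjI)
    show "Z \<in> carrier_mat (dim_col H) (dim_row H)"
      using Zc H by simp
    show "H * Z * H = H"
      using H Zc HE U(1) by (simp add: mat_mult_assoc ZH)
    show "Z * H * Z = Z"
      by (simp add: ZH UUZ)
    show "hermitian_mat (Z * H)"
      unfolding ZH hermitian_mat_def using U(1) by (simp add: mat_algebra)
    have "H * Z * R = H * (U * ?Di * U\<^sup>H * H\<^sup>H)"
      using H Zc Rc by (simp add: mat_mult_assoc ZR)
    then show "hermitian_mat (H * Z * R)"
      using H U(1) by (simp add: hermitian_mat_def mat_algebra)
  qed
  \<comment> \<open>This is \<open>Z\<close> without its leading factor \<open>U\<close>. As a left
    inverse of \<open>H * U\<close> it certifies the rank.\<close>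
  let ?L = "?Di * U\<^sup>H * H\<^sup>H * ?Ri"
  have L: "?L \<in> carrier_mat k m"
    using H U(1) Ri(1) by auto
  have LHU: "?L * (H * U) = 1\<^sub>m k"
  proof -
    have "?L * (H * U) = ?Di * U\<^sup>H * (H\<^sup>H * ?Ri * H) * U"
      using U(1) H Ri(1) by (simp add: mat_mult_assoc)
    also have "\<dots> = ?Di * (U\<^sup>H * (U * (?D * U\<^sup>H))) * U"
      unfolding U(4) using U(1) by (simp add: mat_mult_assoc)
    finally show ?thesis
      using U(1,2) by (simp add: UU DD)
  qed
  show "mat_rank H = k"
    by (rule mat_rank_eqI[OF H U(1) L LHU HE])
  \<comment> \<open>For \<open>k = m\<close> both \<open>?L\<close> and \<open>H * U\<close> are
    square, so the left inverse is also a right inverse; their product in that order is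
    \<open>H * Z\<close>.\<close>
  show "H * Z = 1\<^sub>m m" if "k = m"
  proof -
    have "?L \<in> carrier_mat m m" "H * U \<in> carrier_mat m m" "?L * (H * U) = 1\<^sub>m m"
      using L LHU H U(1) by (simp_all only: that) auto
    then have "(H * U) * ?L = 1\<^sub>m m"
      by (rule mat_mult_left_right_inverse)
    then show ?thesis
      unfolding Z_def using H U(1) Ri(1) by (simp add: mat_mult_assoc)
  qed
qed

text \<open>Existence comes from the construction with identity weight, uniqueness from
  \<open>weighted_pinv_unique\<close>; together they justify the \<open>THE\<close> in the
  definition.\<close>

lemma pseudo_inverse_weighted:
  assumes H: "H \<in> carrier_mat m n"
  shows "weighted_pinv (1\<^sub>m m) H (pseudo_inverse H)"
proof -
  have "pd_mat m (diag m (\<lambda>_. 1))"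
    by (rule pd_diag) simp
  then have R: "pd_mat m (1\<^sub>m m)"
    by (simp add: diag_of_real_one)
  obtain k U d where "reduced_eigendecomposition n k (H\<^sup>H * mat_inv (1\<^sub>m m) * H) U d"
    using reduced_eigendecomposition_exists[OF psd_sandwich[OF pd_inverse(5)[OF R] H]] by blast
  from gram_reduced_eigendecomposition(1)[OF H R this]
  obtain X where X: "weighted_pinv (1\<^sub>m m) H X" by blast
  have iff: "is_pseudo_inverse H Y \<longleftrightarrow> weighted_pinv (1\<^sub>m m) H Y" for Y
    using H is_pseudo_inverse_iff_weighted[of H Y] by simp
  have "is_pseudo_inverse H (pseudo_inverse H)"
    unfolding pseudo_inverse_def
  proof (rule theI)
    show "is_pseudo_inverse H X" using X iff by simp
    show "Y = X" if "is_pseudo_inverse H Y" for Y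
      using weighted_pinv_unique[OF H R, of Y X] that X iff by simp
  qed
  then show ?thesis using iff by simp
qed

subsection \<open>Waterfilling\<close>

text \<open>Intermediate value theorem: at level 0 no channel is filled, and at
  \<open>inverse (d 0) + p\<close> channel 0 alone absorbs \<open>p\<close>.\<close>

lemma waterfilling_level_exists:
  fixes d :: "nat \<Rightarrow> real"
  assumes "0 < k" "\<And>i. i < k \<Longrightarrow> 0 < d i" "0 < p"
  shows "\<exists>\<mu>. (\<Sum>i<k. max 0 (\<mu> - inverse (d i))) = p"
proof -
  let ?f = "\<lambda>\<mu>. \<Sum>i<k. max 0 (\<mu> - inverse (d i))"
  let ?b = "inverse (d 0) + p"
  have "max 0 (0 - inverse (d i)) = 0" if "i < k" for i
    using assms(2)[OF that] by simp
  then have "?f 0 = 0"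
    by (intro sum.neutral) simp
  moreover have "p \<le> ?f ?b"
  proof -
    have "p \<le> max 0 (?b - inverse (d 0))" by simp
    also have "\<dots> \<le> ?f ?b"
      using assms(1) by (intro member_le_sum) auto
    finally show ?thesis .
  qed
  moreover have "continuous_on {0..?b} ?f"
    by (intro continuous_intros)
  ultimately show ?thesis
    using IVT'[of ?f 0 p ?b] assms(2)[of 0] assms(1,3) by force
qed

lemma psd_sandwich_trace:
  assumes "psd_mat n Y" "U \<in> carrier_mat n k"
  obtains z where "\<And>i. i < k \<Longrightarrow> (U\<^sup>H * Y * U) $$ (i, i) = complex_of_real (z i)"
    "\<And>i. i < k \<Longrightarrow> 0 \<le> z i" "mat_trace (U\<^sup>H * Y * U) = complex_of_real (\<Sum>i<k. z i)"
proof -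
  let ?z = "\<lambda>i. Re ((U\<^sup>H * Y * U) $$ (i, i))"
  have z: "(U\<^sup>H * Y * U) $$ (i, i) = complex_of_real (?z i)" "0 \<le> ?z i" if "i < k" for i
    using psd_sandwich_diag[OF assms that] by (auto simp: less_eq_complex_def complex_eq_iff)
  moreover have "mat_trace (U\<^sup>H * Y * U) = complex_of_real (\<Sum>i<k. ?z i)"
    using assms psd_matD(1)[OF assms(1)] z(1) by (auto simp: mat_trace_def simp del: complex_of_real_def intro!: sum.cong)
  ultimately show ?thesis
    using that[of ?z] by blast
qed

lemma sandwich_diag:
  fixes U :: "complex mat"
  assumes "U \<in> carrier_mat n k" "U\<^sup>H * U = 1\<^sub>m k" "D \<in> carrier_mat k k"
  shows "U\<^sup>H * (U * D * U\<^sup>H) * U = D"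
  using assms by (simp add: mat_mult_assoc isometry_mult_cancel[OF assms(1,2)])

lemma sandwich_diag_trace:
  fixes U :: "complex mat"
  assumes "U \<in> carrier_mat n k" "U\<^sup>H * U = 1\<^sub>m k"
  shows "mat_trace (U * diag k w * U\<^sup>H) = complex_of_real (\<Sum>i<k. w i)"
proof -
  have "mat_trace (U * diag k w * U\<^sup>H) = mat_trace (U * (diag k w * U\<^sup>H))"
    using assms by (simp add: mat_mult_assoc)
  also have "\<dots> = mat_trace (diag k w * U\<^sup>H * U)"
    using assms by (intro mat_trace_comm[of _ n k]) auto
  also have "\<dots> = mat_trace (diag k w)"
    using assms by (simp add: mat_mult_assoc)
  finally show ?thesis
    by (simp add: mat_trace_def)
qed

lemma psd_sandwich_diag_of_real:
  assumes "U \<in> carrier_mat n k" "\<And>i. i < k \<Longrightarrow> 0 \<le> w i"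
  shows "psd_mat n (U * diag k w * U\<^sup>H)"
  using psd_sandwich[OF psd_diag[of k w], of "U\<^sup>H" n] assms by simp

text \<open>The waterfilling matrix \<open>W\<close> is the Frobenius projection of
  \<open>- M = - U D\<^sup>-\<^sup>1 U\<^sup>H\<close>; this is the variational inequality of that projection.\<close>

lemma waterfilling_variational:
  fixes d :: "nat \<Rightarrow> real"
  assumes U: "U \<in> carrier_mat n k" "U\<^sup>H * U = 1\<^sub>m k"
    and w: "\<And>i. i < k \<Longrightarrow> w i = max 0 (\<mu> - inverse (d i))"
    and Y: "psd_mat n Y" "mat_trace (U\<^sup>H * Y * U) = complex_of_real (\<Sum>i<k. w i)"
  defines "W \<equiv> U * diag k w * U\<^sup>H" and "M \<equiv> U * diag k (\<lambda>i. inverse (d i)) * U\<^sup>H"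
  shows "0 \<le> Re (mat_trace ((W + M) * (Y - W)))"
proof -
  obtain z where z: "\<And>i. i < k \<Longrightarrow> (U\<^sup>H * Y * U) $$ (i, i) = complex_of_real (z i)"
    "\<And>i. i < k \<Longrightarrow> 0 \<le> z i" "mat_trace (U\<^sup>H * Y * U) = complex_of_real (\<Sum>i<k. z i)"
    using psd_sandwich_trace[OF Y(1) U(1)] by blast
  have sums: "(\<Sum>i<k. z i) = (\<Sum>i<k. w i)"
    using z(3) Y(2) of_real_eq_iff by metis
  note Yc = psd_matD(1)[OF Y(1)]
  have Wc: "W \<in> carrier_mat n n"
    unfolding W_def using U by auto
  let ?c = "\<lambda>i. w i + inverse (d i)"
  have "W + M = U * (diag k w + diag k (\<lambda>i. inverse (d i))) * U\<^sup>H"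
    unfolding W_def M_def using U(1)
    by (simp add: mult_add_distrib_mat[of _ n k _ k] add_mult_distrib_mat[of _ n k _ _ n])
  also have "diag k w + diag k (\<lambda>i. inverse (d i)) = diag k ?c"
    by (rule eq_matI) auto
  finally have WM: "W + M = U * diag k ?c * U\<^sup>H" .
  have UWU: "U\<^sup>H * W * U = diag k w"
    unfolding W_def by (rule sandwich_diag[OF U]) simp
  have "mat_trace ((W + M) * (Y - W)) = mat_trace (U * (diag k ?c * (U\<^sup>H * (Y - W))))"
    unfolding WM using U(1) Yc Wc by (simp add: mat_mult_assoc)
  also have "\<dots> = mat_trace (diag k ?c * (U\<^sup>H * (Y - W)) * U)"
    using U(1) Yc Wc by (intro mat_trace_comm[of _ n k]) auto
  also have "\<dots> = mat_trace (diag k ?c * (U\<^sup>H * Y * U - U\<^sup>H * W * U))"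
    using U(1) Yc Wc
    by (simp add: mat_mult_assoc mult_minus_distrib_mat[of _ k n _ k] minus_mult_distrib_mat[of _ n n _ _ k])
  also have "\<dots> = (\<Sum>i<k. complex_of_real (?c i) * (complex_of_real (z i) - complex_of_real (w i)))"
    unfolding UWU using U(1) z(1)
    by (subst mat_trace_diag_mult) auto
  also have "\<dots> = complex_of_real (\<Sum>i<k. ?c i * (z i - w i))"
    by (simp only: of_real_sum of_real_mult of_real_diff)
  finally have "Re (mat_trace ((W + M) * (Y - W))) = (\<Sum>i<k. ?c i * (z i - w i))"
    by (simp only: Re_complex_of_real)
  \<comment> \<open>The total powers agree, so the constant \<open>\<mu>\<close> may be subtracted
    from every coefficient.\<close>
  also have "\<dots> = (\<Sum>i<k. (?c i - \<mu>) * (z i - w i)) + \<mu> * (\<Sum>i<k. z i - w i)"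
    by (simp add: sum.distrib[symmetric] sum_distrib_left algebra_simps)
  also have "(\<Sum>i<k. z i - w i) = 0"
    by (simp add: sum_subtractf sums)
  also have "0 \<le> (\<Sum>i<k. (?c i - \<mu>) * (z i - w i)) + \<mu> * 0"
  proof -
    \<comment> \<open>A filled channel has \<open>?c i = \<mu>\<close>. An empty one has
      \<open>w i = 0\<close> and \<open>?c i\<close> above \<open>\<mu>\<close>, and
      \<open>z i\<close> is nonnegative.\<close>
    have "0 \<le> (?c i - \<mu>) * (z i - w i)" if "i < k" for i
      using w[OF that] z(2)[OF that] by (cases "inverse (d i) \<le> \<mu>") (auto simp: max_def)
    then show ?thesis
      by (auto intro: sum_nonneg)
  qed
  finally show ?thesis .
qed

text \<open>The usual argument for projections onto convex sets: adding the two inequalities bounds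
  the squared norm of \<open>W - W'\<close> by its pairing with \<open>M' - M\<close>, and
  Cauchy-Schwarz removes one factor.\<close>

lemma variational_nonexpansive:
  assumes c: "W \<in> carrier_mat n n" "W' \<in> carrier_mat n n" "M \<in> carrier_mat n n" "M' \<in> carrier_mat n n"
    and h: "hermitian_mat W" "hermitian_mat W'"
    and 1: "0 \<le> Re (mat_trace ((W + M) * (W' - W)))"
    and 2: "0 \<le> Re (mat_trace ((W' + M') * (W - W')))"
  shows "frob_norm (W - W') \<le> frob_norm (M - M')"
proof -
  let ?E = "W - W'"
  have Ec: "?E \<in> carrier_mat n n"
    by (rule minus_carrier_mat[OF c(2)])
  have neg: "W' - W = - ?E"
    using c(1,2) by (intro eq_matI) auto
  have tneg: "mat_trace (A * - ?E) = - mat_trace (A * ?E)" if "A \<in> carrier_mat n n" for A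
    unfolding mat_trace_mult[OF that Ec] mat_trace_mult[OF that uminus_carrier_mat[OF Ec]]
    using c that by (simp add: sum_negf[symmetric] algebra_simps)
  have tadd: "mat_trace ((A + B) * ?E) = mat_trace (A * ?E) + mat_trace (B * ?E)"
    if "A \<in> carrier_mat n n" "B \<in> carrier_mat n n" for A B
    using that Ec by (simp add: add_mult_distrib_mat[of _ n n _ _ n] mat_trace_add[of _ n])
  have tsub: "mat_trace ((A - B) * ?E) = mat_trace (A * ?E) - mat_trace (B * ?E)"
    if "A \<in> carrier_mat n n" "B \<in> carrier_mat n n" for A B
    using that Ec by (simp add: minus_mult_distrib_mat[of _ n n _ _ n] mat_trace_minus[of _ n])
  have "(frob_norm ?E)\<^sup>2 = Re (mat_trace (?E\<^sup>H * ?E))"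
    unfolding trace_adjoint_mult_self[OF Ec] by simp
  also have "?E\<^sup>H = ?E"
    using h by (simp add: mat_adjoint_minus[OF c(1,2)] hermitian_mat_def)
  also have "Re (mat_trace (?E * ?E)) \<le> - Re (mat_trace ((M - M') * ?E))"
    using 1 2 unfolding neg tneg[OF add_carrier_mat[OF c(3), of W]] tadd[OF c(1,3)] tadd[OF c(2,4)]
      tsub[OF c(1,2)] tsub[OF c(3,4)]
    by simp
  also have "\<dots> \<le> cmod (mat_trace ((M - M') * ?E))"
    using abs_Re_le_cmod[of "mat_trace ((M - M') * ?E)"] by linarith
  also have "\<dots> \<le> frob_norm (M - M') * frob_norm ?E"
    using c by (intro norm_trace_mult_le[of _ n n]) auto
  finally have *: "(frob_norm ?E)\<^sup>2 \<le> frob_norm (M - M') * frob_norm ?E" .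
  show ?thesis
  proof (cases "frob_norm ?E = 0")
    case False
    then have "0 < frob_norm ?E"
      by (simp add: order.not_eq_order_implies_strict)
    then show ?thesis
      using * by (simp add: power2_eq_square)
  qed simp
qed

text \<open>The eigenvectors in \<open>U\<close> and \<open>V\<close> may be entirely different;
  only the projectors onto their ranges agree. This is enough for each solution to be an admissible
  competitor in the variational inequality of the other.\<close>

lemma waterfilling_nonexpansive:
  fixes d d' :: "nat \<Rightarrow> real"
  assumes U: "U \<in> carrier_mat n k" "U\<^sup>H * U = 1\<^sub>m k"
    and V: "V \<in> carrier_mat n l" "V\<^sup>H * V = 1\<^sub>m l" and UV: "U * U\<^sup>H = V * V\<^sup>H"
    and w: "\<And>i. i < k \<Longrightarrow> w i = max 0 (\<mu> - inverse (d i))"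
    and w': "\<And>i. i < l \<Longrightarrow> w' i = max 0 (\<mu>' - inverse (d' i))"
    and sums: "(\<Sum>i<k. w i) = (\<Sum>i<l. w' i)"
  shows "frob_norm (U * diag k w * U\<^sup>H - V * diag l w' * V\<^sup>H)
    \<le> frob_norm (U * diag k (\<lambda>i. inverse (d i)) * U\<^sup>H
        - V * diag l (\<lambda>i. inverse (d' i)) * V\<^sup>H)"
    (is "frob_norm (?W - ?W') \<le> frob_norm (?M - ?M')")
proof -
  have c: "?W \<in> carrier_mat n n" "?W' \<in> carrier_mat n n" "?M \<in> carrier_mat n n" "?M' \<in> carrier_mat n n"
    using U V by auto
  have h: "?W\<^sup>H = ?W" "?W'\<^sup>H = ?W'"
    using U V by (auto simp: mat_algebra)
  \<comment> \<open>Compression by \<open>U\<close> keeps the trace of a matrix supported on the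
    range of \<open>V\<close>, because both ranges coincide.\<close>
  have tr: "mat_trace (U\<^sup>H * (V * D * V\<^sup>H) * U) = mat_trace (V * D * V\<^sup>H)"
    if U: "U \<in> carrier_mat n k" and V: "V \<in> carrier_mat n l" "V\<^sup>H * V = 1\<^sub>m l" and UV: "U * U\<^sup>H = V * V\<^sup>H"
      and D: "D \<in> carrier_mat l l" for U V D k l
  proof -
    have "mat_trace (U\<^sup>H * (V * D * V\<^sup>H) * U) = mat_trace (U\<^sup>H * (V * D * V\<^sup>H * U))"
      using U V D by (simp add: mat_mult_assoc)
    also have "\<dots> = mat_trace ((V * D * V\<^sup>H * U) * U\<^sup>H)"
      using U V D by (intro mat_trace_comm[of _ k n]) auto
    also have "(V * D * V\<^sup>H * U) * U\<^sup>H = V * D * V\<^sup>H * (U * U\<^sup>H)"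
      using U V D by (simp add: mat_mult_assoc)
    also have "\<dots> = V * D * V\<^sup>H"
      unfolding UV using U V D by (simp add: mat_mult_assoc isometry_mult_cancel[OF V])
    finally show ?thesis .
  qed
  have w0: "0 \<le> w i" if "i < k" for i using w[OF that] by simp
  have w0': "0 \<le> w' i" if "i < l" for i using w'[OF that] by simp
  have 1: "0 \<le> Re (mat_trace ((?W + ?M) * (?W' - ?W)))"
    using tr[OF U(1) V UV, of "diag l w'"]
    by (intro waterfilling_variational[OF U w] psd_sandwich_diag_of_real[OF V(1) w0'])
      (auto simp: sandwich_diag_trace[OF V] sums)
  have 2: "0 \<le> Re (mat_trace ((?W' + ?M') * (?W - ?W')))"
    using tr[OF V(1) U UV[symmetric], of "diag k w"]
    by (intro waterfilling_variational[OF V w'] psd_sandwich_diag_of_real[OF U(1) w0])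
      (auto simp: sandwich_diag_trace[OF U] sums)
  show ?thesis
    using c h 1 2 by (intro variational_nonexpansive[of _ n]) (auto simp: hermitian_mat_def)
qed

section \<open>Waterfilling as the unique best response\<close>

lemma isometry_compression:
  assumes Y: "psd_mat n Y" and U: "U \<in> carrier_mat n k" "U\<^sup>H * U = 1\<^sub>m k"
  shows "0 \<le> mat_trace Y - mat_trace (U\<^sup>H * Y * U)"
    and "mat_trace Y = mat_trace (U\<^sup>H * Y * U) \<Longrightarrow> Y = U * (U\<^sup>H * Y * U) * U\<^sup>H"
proof -
  note Yc = psd_matD(1)[OF Y]
  \<comment> \<open>The projector onto the complement of the range of \<open>U\<close>. The trace
    lost in the compression is the trace of \<open>F\<^sup>H * Y * F\<close>, the power spent
    outside that range.\<close>
  define F where "F = 1\<^sub>m n - U * U\<^sup>H"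
  have F: "F \<in> carrier_mat n n"
    unfolding F_def using U(1) by (intro minus_carrier_mat) auto
  have FH: "F\<^sup>H = F"
    unfolding F_def using U(1) by (simp add: mat_adjoint_minus[of _ n n] mat_adjoint_mult[of _ n k _ n])
  have YF: "Y * F = Y - Y * U * U\<^sup>H"
    unfolding F_def using Yc U(1) by (simp add: mult_minus_distrib_mat[of _ n n _ n] mat_mult_assoc)
  have YFF: "Y * F * F = Y * F"
  proof -
    have "U\<^sup>H * F = U\<^sup>H * 1\<^sub>m n - U\<^sup>H * (U * U\<^sup>H)"
      unfolding F_def using U(1) by (intro mult_minus_distrib_mat[of _ k n _ n]) auto
    also have "\<dots> = 0\<^sub>m k n"
      using U by (simp add: isometry_mult_cancel[OF U])
    finally have UF: "U\<^sup>H * F = 0\<^sub>m k n" .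
    have "Y * F * F = (Y - Y * U * U\<^sup>H) * F"
      by (simp only: YF)
    also have "\<dots> = Y * F - Y * U * U\<^sup>H * F"
      using Yc U(1) F by (intro minus_mult_distrib_mat[of _ n n _ _ n]) auto
    also have "Y * U * U\<^sup>H * F = Y * U * (U\<^sup>H * F)"
      using Yc U(1) F by (intro mat_mult_assoc) auto
    also have "\<dots> = 0\<^sub>m n n"
      unfolding UF using Yc U(1) by simp
    also have "Y * F - 0\<^sub>m n n = Y * F"
      using Yc F by (intro minus_mat_zero) auto
    finally show ?thesis .
  qed
  have tr: "mat_trace (F\<^sup>H * Y * F) = mat_trace Y - mat_trace (U\<^sup>H * Y * U)"
  proof -
    have "mat_trace (F\<^sup>H * Y * F) = mat_trace (F * (Y * F))"
      unfolding FH using F Yc by (simp add: mat_mult_assoc)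
    also have "\<dots> = mat_trace (Y * F * F)"
      using F Yc by (intro mat_trace_comm[of _ n n]) auto
    also have "\<dots> = mat_trace Y - mat_trace (Y * U * U\<^sup>H)"
      unfolding YFF unfolding YF using Yc U(1) by (intro mat_trace_minus[of _ n]) auto
    also have "mat_trace (Y * U * U\<^sup>H) = mat_trace (U\<^sup>H * (Y * U))"
      using Yc U(1) by (intro mat_trace_comm[of _ n k]) auto
    also have "U\<^sup>H * (Y * U) = U\<^sup>H * Y * U"
      using Yc U(1) by (simp add: mat_mult_assoc)
    finally show ?thesis .
  qed
  have "0 \<le> mat_trace (F\<^sup>H * Y * F)"
    unfolding mat_trace_def
    using psd_sandwich_diag[OF Y F] F by (intro sum_nonneg) (auto simp del: assoc_mult_mat index_mult_mat(1))
  then show "0 \<le> mat_trace Y - mat_trace (U\<^sup>H * Y * U)"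
    unfolding tr .
  assume "mat_trace Y = mat_trace (U\<^sup>H * Y * U)"
  then have "Y * F = 0\<^sub>m n n"
    using tr by (intro psd_sandwich_trace_0[OF Y F]) simp
  \<comment> \<open>A positive semidefinite matrix without power outside the range satisfies
    \<open>Y * F = 0\<close>; taking adjoints gives the support condition on the other side
    too.\<close>
  then have YE: "Y = Y * U * U\<^sup>H"
    unfolding YF using Yc U(1) by (intro frob_norm_diff_eq_0[of _ n n]) auto
  have "Y = Y\<^sup>H"
    using psd_matD(2)[OF Y] by (simp add: hermitian_mat_def)
  also have "\<dots> = (Y * U * U\<^sup>H)\<^sup>H"
    using YE by simp
  also have "\<dots> = U * (U\<^sup>H * Y)"
    using Yc U(1) psd_matD(2)[OF Y] by (simp add: mat_algebra hermitian_mat_def)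
  finally have YE': "Y = U * (U\<^sup>H * Y)" .
  have "Y = U * (U\<^sup>H * Y) * U * U\<^sup>H"
    using YE by (simp only: YE'[symmetric])
  also have "\<dots> = U * (U\<^sup>H * Y * U) * U\<^sup>H"
    using Yc U(1) by (simp add: mat_mult_assoc)
  finally show "Y = U * (U\<^sup>H * Y * U) * U\<^sup>H" .
qed

lemma diag_sandwich_index:
  assumes "M \<in> carrier_mat k k" "i < k" "j < k"
  shows "(diag k e * M * diag k e) $$ (i, j)
    = complex_of_real (e i) * M $$ (i, j) * complex_of_real (e j)"
  using assms unfolding diag_of_real_def
  by (subst mat_diag_mult_left[OF assms(1)], subst mat_diag_mult_right[of _ k]) auto

text \<open>The tangent bound of the concave function \<open>ln det\<close> at
  \<open>diag k w\<close>, with its equality case. The denominators \<open>1 + d i * w i\<close> are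
  the diagonal entries of \<open>1\<^sub>m k + S * Z * S\<close> at the point of tangency.\<close>

lemma log_det_diag_bound:
  fixes d w z :: "nat \<Rightarrow> real"
  assumes Z: "psd_mat k Z" and d: "\<And>i. i < k \<Longrightarrow> 0 < d i" and w: "\<And>i. i < k \<Longrightarrow> 0 \<le> w i"
    and z: "\<And>i. i < k \<Longrightarrow> Z $$ (i, i) = complex_of_real (z i)"
  defines "S \<equiv> diag k (\<lambda>i. sqrt (d i))"
  obtains p where "det (1\<^sub>m k + S * Z * S) = complex_of_real p" "0 < p"
    "ln p \<le> ln (\<Prod>i<k. 1 + d i * w i) + (\<Sum>i<k. d i * (z i - w i) / (1 + d i * w i))"
    "ln p = ln (\<Prod>i<k. 1 + d i * w i) + (\<Sum>i<k. d i * (z i - w i) / (1 + d i * w i))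
      \<Longrightarrow> Z = diag k w"
proof -
  note Zc = psd_matD(1)[OF Z]
  define c where "c i = 1 + d i * w i" for i
  have c: "0 < c i" if "i < k" for i
    using w[OF that] d[OF that] by (simp add: c_def add_pos_nonneg)
  have Sc: "S \<in> carrier_mat k k" and SH: "S\<^sup>H = S"
    by (simp_all add: S_def)
  define B where "B = 1\<^sub>m k + S * Z * S"
  have Bc: "B \<in> carrier_mat k k"
    unfolding B_def using Zc Sc by auto
  \<comment> \<open>Normalization by \<open>T\<close> on both sides turns the point of tangency into
    the identity matrix, where \<open>ln det C \<le> tr C - k\<close> is tight.\<close>
  define T where "T = diag k (\<lambda>i. inverse (sqrt (c i)))"
  have Tc: "T \<in> carrier_mat k k" and TH: "T\<^sup>H = T"
    by (simp_all add: T_def)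
  define C where "C = T * B * T"
  have sc: "inverse (sqrt (c i)) * inverse (sqrt (c i)) = inverse (c i)" if "i < k" for i
    using c[OF that] by (simp add: inverse_mult_distrib[symmetric] less_imp_le del: inverse_mult_distrib)
  have TT: "T * T = diag k (\<lambda>i. inverse (c i))"
    unfolding T_def diag_of_real_mult by (rule diag_of_real_cong) (rule sc)
  have C: "pd_mat k C"
  proof -
    have "C = T * T + T * (S * Z * S) * T"
      unfolding C_def B_def using Zc Sc Tc
      by (simp add: mult_add_distrib_mat[of _ k k _ k] add_mult_distrib_mat[of _ k k _ _ k])
    moreover have "pd_mat k (T * T)"
      unfolding TT using c by (intro pd_diag) auto
    moreover have "psd_mat k (T * (S * Z * S) * T)"
      using psd_sandwich[OF psd_sandwich[OF Z Sc] Tc] unfolding TH SH .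
    ultimately show ?thesis
      by (simp only: pd_add_psd)
  qed
  have Bii: "B $$ (i, j) = (if i = j then 1 else 0) + complex_of_real (sqrt (d i)) * Z $$ (i, j) * complex_of_real (sqrt (d j))"
    if "i < k" "j < k" for i j
  proof -
    have "B $$ (i, j) = 1\<^sub>m k $$ (i, j) + (S * Z * S) $$ (i, j)"
      unfolding B_def using Zc Sc that by (intro index_add_mat) auto
    then show ?thesis
      using that unfolding S_def diag_sandwich_index[OF Zc that] by simp
  qed
  have Cii: "C $$ (i, i) = complex_of_real ((1 + d i * z i) / c i)" if i: "i < k" for i
  proof -
    have "C $$ (i, i) = complex_of_real (inverse (sqrt (c i)))
        * (1 + complex_of_real (sqrt (d i)) * complex_of_real (z i) * complex_of_real (sqrt (d i)))
        * complex_of_real (inverse (sqrt (c i)))"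
      unfolding C_def T_def diag_sandwich_index[OF Bc i i] Bii[OF i i] z[OF i] by simp
    also have "\<dots> = complex_of_real ((inverse (sqrt (c i)) * inverse (sqrt (c i))) * (1 + (sqrt (d i) * sqrt (d i)) * z i))"
      by (simp only: of_real_mult of_real_add of_real_1 mult_ac)
    also have "\<dots> = complex_of_real (inverse (c i) * (1 + d i * z i))"
      using d[OF i] by (simp only: sc[OF i]) simp
    finally show ?thesis
      by (simp only: divide_inverse mult.commute)
  qed
  have trC: "Re (mat_trace C) - real k = (\<Sum>i<k. d i * (z i - w i) / c i)"
  proof -
    have "mat_trace C = (\<Sum>i<k. complex_of_real ((1 + d i * z i) / c i))"
      using pd_matD(1)[OF C] Cii by (simp add: mat_trace_def)
    then have "mat_trace C = complex_of_real (\<Sum>i<k. (1 + d i * z i) / c i)"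
      by (simp only: of_real_sum)
    then have "Re (mat_trace C) - real k = (\<Sum>i<k. (1 + d i * z i) / c i - 1)"
      by (simp only: Re_complex_of_real sum_subtractf) simp
    also have "\<dots> = (\<Sum>i<k. d i * (z i - w i) / c i)"
    proof (rule sum.cong[OF refl])
      fix i assume "i \<in> {..<k}"
      then have "c i \<noteq> 0" using c[of i] by auto
      then have "(1 + d i * z i) / c i - 1 = (1 + d i * z i - c i) / c i"
        by (simp add: diff_divide_distrib)
      then show "(1 + d i * z i) / c i - 1 = d i * (z i - w i) / c i"
        by (simp add: c_def algebra_simps)
    qed
    finally show ?thesis .
  qed
  obtain q where q: "det C = complex_of_real q" "0 < q" "ln q \<le> Re (mat_trace C) - real k"
    "ln q = Re (mat_trace C) - real k \<Longrightarrow> C = 1\<^sub>m k"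
    using log_det_le_trace[OF C] by blast
  let ?P = "\<Prod>i<k. c i"
  have P: "0 < ?P" using c by (intro prod_pos) auto
  have "det C = det (T * B) * det T"
    unfolding C_def using Bc Tc by (intro det_mult) auto
  also have "det (T * B) = det T * det B"
    using Bc Tc by (intro det_mult) auto
  also have "det T * det B * det T = det (T * T) * det B"
    unfolding det_mult[OF Tc Tc] by simp
  also have "det (T * T) = complex_of_real (inverse ?P)"
    unfolding TT det_diag_of_real using prod_inversef[of c "{..<k}"] by (simp only: comp_def)
  finally have "complex_of_real q = complex_of_real (inverse ?P) * det B"
    unfolding q(1) .
  then have "complex_of_real ?P * complex_of_real q = complex_of_real (?P * inverse ?P) * det B"
    by (simp only: of_real_mult mult.assoc)
  moreover have "?P * inverse ?P = 1"
    using P by (intro right_inverse) (rule less_imp_neq[symmetric])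
  ultimately have detB: "det B = complex_of_real (?P * q)"
    by (simp only: of_real_mult of_real_1 mult_1_left)
  have lnp: "ln (?P * q) = ln ?P + ln q"
    using P q(2) by (rule ln_mult_pos)
  show ?thesis
  proof (rule that[of "?P * q", unfolded c_def[symmetric] B_def[symmetric]])
    show "det B = complex_of_real (?P * q)" by (rule detB)
    show "0 < ?P * q" using P q(2) by simp
    show "ln (?P * q) \<le> ln ?P + (\<Sum>i<k. d i * (z i - w i) / c i)"
      using q(3) unfolding lnp trC by simp
    assume "ln (?P * q) = ln ?P + (\<Sum>i<k. d i * (z i - w i) / c i)"
    then have C1: "C = 1\<^sub>m k"
      using q(4) unfolding lnp trC by simp
    show "Z = diag k w"
    proof (rule eq_matI)
      fix i j assume "i < dim_row (diag k w)" "j < dim_col (diag k w)"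
      then have ij: "i < k" "j < k" by auto
      show "Z $$ (i, j) = diag k w $$ (i, j)"
      proof (cases "i = j")
        case True
        have "complex_of_real ((1 + d i * z i) / c i) = complex_of_real 1"
          using Cii[OF ij(1)] ij(1) unfolding C1 by simp
        then have "(1 + d i * z i) / c i = 1"
          unfolding of_real_eq_iff .
        then have "1 + d i * z i = 1 + d i * w i"
          using c[OF ij(1)] by (auto simp: c_def field_simps split: if_splits)
        then have "z i = w i" using d[OF ij(1)] by simp
        then show ?thesis using True ij z by simp
      next
        case False
        have "C $$ (i, j) = complex_of_real (inverse (sqrt (c i))) *
          (0 + complex_of_real (sqrt (d i)) * Z $$ (i, j) * complex_of_real (sqrt (d j))) * complex_of_real (inverse (sqrt (c j)))"
          unfolding C_def T_def diag_sandwich_index[OF Bc ij] Bii[OF ij] using False by simp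
        moreover have "C $$ (i, j) = 0"
          unfolding C1 using ij False by simp
        ultimately show ?thesis
          using c[OF ij(1)] c[OF ij(2)] d[OF ij(1)] d[OF ij(2)] ij False by simp
      qed
    qed (use Zc in auto)
  qed
qed

text \<open>The derivative of the rate in channel \<open>i\<close> is
  \<open>d i / (1 + d i * w i)\<close>, which is \<open>1 / \<mu>\<close> on filled channels and at
  most that on empty ones. The tangent bound then leaves only the difference of total powers, which
  cannot be positive. Equality makes every estimate tight and determines \<open>Y\<close>.\<close>

theorem waterfilling_best_response:
  fixes d :: "nat \<Rightarrow> real"
  assumes red: "reduced_eigendecomposition n k A U d"
    and w: "\<And>i. i < k \<Longrightarrow> w i = max 0 (\<mu> - inverse (d i))"
    and p: "(\<Sum>i<k. w i) = p" "0 < p"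
    and Y: "psd_mat n Y" "mat_trace Y = complex_of_real p"
  defines "W \<equiv> U * diag k w * U\<^sup>H"
  shows "ln (Re (det (1\<^sub>m n + A * Y))) \<le> ln (Re (det (1\<^sub>m n + A * W)))" (is ?le)
    and "ln (Re (det (1\<^sub>m n + A * Y))) = ln (Re (det (1\<^sub>m n + A * W))) \<Longrightarrow> Y = W"
proof -
  note U = reduced_eigendecompositionD[OF red]
  note Yc = psd_matD(1)[OF Y(1)]
  have Wc: "W \<in> carrier_mat n n"
    unfolding W_def using U(1) by auto
  define S where "S = diag k (\<lambda>i. sqrt (d i))"
  have Sc: "S \<in> carrier_mat k k" and SH: "S\<^sup>H = S"
    by (simp_all add: S_def)
  \<comment> \<open>\<open>A = X * X\<^sup>H\<close> lets Sylvester's identity reduce the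
    determinant to size \<open>k\<close>, where the compression of \<open>Y\<close> is the only
    unknown.\<close>
  define X where "X = U * S"
  have X: "X \<in> carrier_mat n k" "X\<^sup>H \<in> carrier_mat k n" "X\<^sup>H = S * U\<^sup>H"
    unfolding X_def using U(1) Sc SH by (auto simp: mat_adjoint_mult_dim)
  have "S * S = diag k d"
    unfolding S_def diag_of_real_mult by (rule diag_of_real_cong) (use U(3) in \<open>simp add: less_imp_le\<close>)
  then have "A = U * (S * S) * U\<^sup>H"
    unfolding U(4) by simp
  also have "\<dots> = U * S * (S * U\<^sup>H)"
    using U(1) Sc by (simp add: mat_mult_assoc)
  finally have A: "A = X * X\<^sup>H"
    by (simp only: X(3)[symmetric] X_def[symmetric])
  have det_eq: "det (1\<^sub>m n + A * V) = det (1\<^sub>m k + S * (U\<^sup>H * V * U) * S)"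
    if "V \<in> carrier_mat n n" for V
  proof -
    have "det (1\<^sub>m n + A * V) = det (1\<^sub>m n + X * (X\<^sup>H * V))"
      unfolding A using X that by (simp add: mat_mult_assoc)
    also have "\<dots> = det (1\<^sub>m k + X\<^sup>H * V * X)"
      using X that by (intro det_one_plus_mult_commute) auto
    also have "X\<^sup>H * V * X = S * (U\<^sup>H * V * U) * S"
      unfolding X(3) unfolding X_def using U(1) that Sc by (simp add: mat_mult_assoc)
    finally show ?thesis .
  qed
  have w0: "0 \<le> w i" if "i < k" for i using w[OF that] by simp
  have "1\<^sub>m k + S * (U\<^sup>H * W * U) * S = diag k (\<lambda>i. 1 + d i * w i)"
  proof -
    have "U\<^sup>H * W * U = diag k w"
      unfolding W_def by (rule sandwich_diag[OF U(1,2)]) simp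
    then have "S * (U\<^sup>H * W * U) * S = diag k (\<lambda>i. sqrt (d i) * w i * sqrt (d i))"
      unfolding S_def by simp
    also have "\<dots> = diag k (\<lambda>i. d i * w i)"
      by (rule diag_of_real_cong) (use U(3) in \<open>simp add: less_imp_le\<close>)
    finally show ?thesis
      by (simp only:) (intro eq_matI, auto)
  qed
  then have detW: "Re (det (1\<^sub>m n + A * W)) = (\<Prod>i<k. 1 + d i * w i)"
    using det_eq[OF Wc] det_diag_of_real by (simp only: Re_complex_of_real)
  let ?Z = "U\<^sup>H * Y * U"
  have Z: "psd_mat k ?Z" by (rule psd_sandwich[OF Y(1) U(1)])
  obtain z where z: "\<And>i. i < k \<Longrightarrow> ?Z $$ (i, i) = complex_of_real (z i)"
    "\<And>i. i < k \<Longrightarrow> 0 \<le> z i" "mat_trace ?Z = complex_of_real (\<Sum>i<k. z i)"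
    using psd_sandwich_trace[OF Y(1) U(1)] by blast
  have sumz: "(\<Sum>i<k. z i) \<le> p"
    using isometry_compression(1)[OF Y(1) U(1,2)] unfolding Y(2) z(3)
    by (simp only: of_real_diff[symmetric]) (simp add: less_eq_complex_def)
  \<comment> \<open>With a nonpositive level every channel would be empty, contradicting positive
    total power.\<close>
  have mu: "0 < \<mu>"
  proof (rule ccontr)
    assume "\<not> 0 < \<mu>"
    then have "w i = 0" if "i < k" for i
      using w[OF that] U(3)[OF that] by (smt (verit) inverse_positive_iff_positive)
    then show False using p by simp
  qed
  have le: "d i * (z i - w i) / (1 + d i * w i) \<le> (z i - w i) / \<mu>" if i: "i < k" for i
  proof (cases "inverse (d i) \<le> \<mu>")
    case True
    then have "w i = \<mu> - inverse (d i)" using w[OF i] by simp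
    then have "1 + d i * w i = d i * \<mu>" using U(3)[OF i] by (simp add: right_diff_distrib)
    then show ?thesis using U(3)[OF i] mu by simp
  next
    case False
    then have wi: "w i = 0" using w[OF i] by simp
    have "d i < inverse \<mu>"
      using False mu U(3)[OF i]
      by (metis inverse_inverse_eq inverse_less_iff_less linorder_not_le positive_imp_inverse_positive)
    then have "d i * z i \<le> inverse \<mu> * z i"
      using z(2)[OF i] by (intro mult_right_mono) auto
    then show ?thesis using wi by (simp add: field_simps)
  qed
  let ?s = "\<Sum>i<k. d i * (z i - w i) / (1 + d i * w i)"
  have le0: "?s \<le> ((\<Sum>i<k. z i) - p) / \<mu>"
    unfolding p(1)[symmetric] sum_subtractf[symmetric] sum_divide_distrib
    using le by (intro sum_mono) auto
  have le1: "((\<Sum>i<k. z i) - p) / \<mu> \<le> 0"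
    using sumz mu by (intro divide_nonpos_pos) auto
  obtain q where q: "det (1\<^sub>m k + S * ?Z * S) = complex_of_real q" "0 < q"
    "ln q \<le> ln (\<Prod>i<k. 1 + d i * w i) + ?s"
    "ln q = ln (\<Prod>i<k. 1 + d i * w i) + ?s \<Longrightarrow> ?Z = diag k w"
    by (rule log_det_diag_bound[of k ?Z d w z, folded S_def]) (use Z U(3) w0 z(1) in blast)+
  have detY: "Re (det (1\<^sub>m n + A * Y)) = q"
    unfolding det_eq[OF Yc] q(1) by simp
  show ?le
    unfolding detY detW using q(3) le0 le1 by linarith
  assume "ln (Re (det (1\<^sub>m n + A * Y))) = ln (Re (det (1\<^sub>m n + A * W)))"
  then have eq: "ln q = ln (\<Prod>i<k. 1 + d i * w i)"
    unfolding detY detW .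
  \<comment> \<open>The chain from \<open>ln q\<close> down to the power difference has equal ends,
    so each link is an equality. In particular all power lies in the range of
    \<open>U\<close>.\<close>
  then have s0: "?s = 0" and "((\<Sum>i<k. z i) - p) / \<mu> = 0"
    using q(3) le0 le1 by linarith+
  then have "(\<Sum>i<k. z i) = p"
    using mu by simp
  then have "Y = U * ?Z * U\<^sup>H"
    by (intro isometry_compression(2)[OF Y(1) U(1,2)]) (simp only: Y(2) z(3))
  also have "?Z = diag k w"
    using q(4) eq s0 by simp
  finally show "Y = W"
    unfolding W_def .
qed

subsection \<open>Weighted contractions\<close>

lemma pow_mat_Suc_left:
  assumes "A \<in> carrier_mat n n"
  shows "A ^\<^sub>m Suc k = A * A ^\<^sub>m k"
proof (induction k)
  case (Suc k)
  have "A ^\<^sub>m Suc (Suc k) = (A * A ^\<^sub>m k) * A"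
    using Suc by simp
  also have "\<dots> = A * (A ^\<^sub>m k * A)"
    using assms by (intro assoc_mult_mat[of _ n n _ n _ n]) auto
  finally show ?case by simp
qed (use assms in simp)

lemma pow_smult_mat:
  fixes A :: "complex mat"
  assumes "A \<in> carrier_mat n n"
  shows "(c \<cdot>\<^sub>m A) ^\<^sub>m k = c ^ k \<cdot>\<^sub>m (A ^\<^sub>m k)"
proof (induction k)
  case 0
  then show ?case using assms by (intro eq_matI) auto
next
  case (Suc k)
  have "(c \<cdot>\<^sub>m A) ^\<^sub>m Suc k = (c ^ k \<cdot>\<^sub>m (A ^\<^sub>m k)) * (c \<cdot>\<^sub>m A)"
    using Suc by simp
  also have "\<dots> = c ^ Suc k \<cdot>\<^sub>m (A ^\<^sub>m k * A)"
    using assms by (intro eq_matI) (auto simp: mult_smult_assoc_mat[of _ n n _ n] mult_smult_distrib[of _ n n _ n])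
  finally show ?case by simp
qed

lemma spectral_radius_smult_le:
  assumes A: "A \<in> carrier_mat n n" and n: "0 < n" and c: "c \<noteq> 0"
  shows "spectral_radius (c \<cdot>\<^sub>m A) \<le> cmod c * spectral_radius A"
proof -
  have cA: "c \<cdot>\<^sub>m A \<in> carrier_mat n n" using A by simp
  obtain e where e: "eigenvalue (c \<cdot>\<^sub>m A) e" "spectral_radius (c \<cdot>\<^sub>m A) = cmod e"
    using spectral_radius_mem_max(1)[OF cA n] by (auto simp: spectrum_def)
  then obtain v where v: "v \<in> carrier_vec n" "v \<noteq> 0\<^sub>v n" "(c \<cdot>\<^sub>m A) *\<^sub>v v = e \<cdot>\<^sub>v v"
    using cA by (auto simp: eigenvalue_def eigenvector_def)
  have "A *\<^sub>v v = (e / c) \<cdot>\<^sub>v v"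
  proof (rule eq_vecI)
    fix i assume "i < dim_vec ((e / c) \<cdot>\<^sub>v v)"
    then have i: "i < n" using v by simp
    have "c * (A *\<^sub>v v) $ i = ((c \<cdot>\<^sub>m A) *\<^sub>v v) $ i"
      using A v(1) i by (simp add: scalar_prod_def sum_distrib_left mult.assoc)
    also have "\<dots> = e * v $ i"
      using v(1) i unfolding v(3) by simp
    finally show "(A *\<^sub>v v) $ i = ((e / c) \<cdot>\<^sub>v v) $ i"
      using c v(1) i by (simp add: field_simps)
  qed (use A v in auto)
  then have "e / c \<in> spectrum A"
    using A v by (auto simp: spectrum_def eigenvalue_def eigenvector_def)
  then have "cmod (e / c) \<le> spectral_radius A"
    by (intro spectral_radius_mem_max(2)[OF A n] imageI)
  then show ?thesis
    using c e(2) by (simp add: norm_divide field_simps)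
qed

text \<open>The weight vector is \<open>w = \<Sum>\<^sub>k A\<^sup>k 1\<close>, for which \<open>A w = w - 1\<close>.\<close>

lemma nonneg_spectral_radius_less_1_weights:
  fixes c :: "nat \<Rightarrow> nat \<Rightarrow> real"
  assumes nn: "\<And>i j. i < n \<Longrightarrow> j < n \<Longrightarrow> 0 \<le> c i j" and n: "0 < n"
    and rho: "spectral_radius (mat n n (\<lambda>(i, j). complex_of_real (c i j))) < 1"
  shows "\<exists>w \<beta>. (\<forall>i<n. 0 < w i) \<and> 0 \<le> \<beta> \<and> \<beta> < 1 \<and> (\<forall>i<n. (\<Sum>j<n. c i j * w j) \<le> \<beta> * w i)"
proof -
  define A where "A = mat n n (\<lambda>(i, j). complex_of_real (c i j))"
  have A: "A \<in> carrier_mat n n" by (simp add: A_def)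
  \<comment> \<open>\<open>v k\<close> is the vector of row sums of the \<open>k\<close>-th power,
    kept real so that the weights are real.\<close>
  define v where "v = (\<lambda>k. ((\<lambda>u i. \<Sum>j<n. c i j * u j) ^^ k) (\<lambda>_. 1 :: real))"
  have v0: "v 0 i = 1" and vS: "v (Suc k) i = (\<Sum>j<n. c i j * v k j)" for i k
    by (simp_all add: v_def)
  have vnn: "0 \<le> v k i" if "i < n" for k i
    using that by (induction k arbitrary: i) (auto simp: v0 vS intro!: sum_nonneg mult_nonneg_nonneg nn)
  have vA: "complex_of_real (v k i) = (\<Sum>j<n. (A ^\<^sub>m k) $$ (i, j))" if "i < n" for k i
    using that
  proof (induction k arbitrary: i)
    case 0
    then show ?case using A by (simp add: v0)
  next
    case (Suc k)
    have "(\<Sum>j<n. (A ^\<^sub>m Suc k) $$ (i, j)) = (\<Sum>j<n. \<Sum>l<n. A $$ (i, l) * (A ^\<^sub>m k) $$ (l, j))"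
      using A Suc.prems unfolding pow_mat_Suc_left[OF A]
      by (auto simp: scalar_prod_def atLeast0LessThan pow_carrier_mat[OF A, THEN carrier_matD(1)]
          pow_carrier_mat[OF A, THEN carrier_matD(2)] intro!: sum.cong)
    also have "\<dots> = (\<Sum>l<n. A $$ (i, l) * (\<Sum>j<n. (A ^\<^sub>m k) $$ (l, j)))"
      by (subst sum.swap) (simp add: sum_distrib_left)
    also have "\<dots> = complex_of_real (v (Suc k) i)"
      using Suc.prems Suc.IH by (simp add: vS A_def)
    finally show ?case ..
  qed
  define r where "r = spectral_radius A"
  have r: "0 \<le> r" "r < 1"
    using spectral_radius_mem_max(1)[OF A n] rho by (auto simp: r_def A_def)
  \<comment> \<open>A factor above 1 that leaves the spectral radius of the scaled matrix below 1,
    also when \<open>r = 0\<close>. Its powers stay bounded, so the powers of \<open>A\<close> decay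
    like those of \<open>inverse t\<close>.\<close>
  define t where "t = 2 / (1 + r)"
  have t: "1 < t" "t * r < 1"
    using r by (auto simp: t_def field_simps)
  have "spectral_radius (complex_of_real t \<cdot>\<^sub>m A) < 1"
    using spectral_radius_smult_le[OF A n, of "complex_of_real t"] t by (simp add: r_def)
  then obtain C where C: "\<And>k. norm_bound ((complex_of_real t \<cdot>\<^sub>m A) ^\<^sub>m k) C"
    using spectral_radius_jnf_norm_bound_less_1_upper_triangular[of "complex_of_real t \<cdot>\<^sub>m A" n] A by auto
  have bound: "v k i \<le> real n * C * (inverse t) ^ k" if i: "i < n" for k i
  proof -
    have "cmod ((A ^\<^sub>m k) $$ (i, j)) \<le> C * (inverse t) ^ k" if j: "j < n" for j
    proof -
      have dims: "dim_row (A ^\<^sub>m k) = n" "dim_col (A ^\<^sub>m k) = n"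
        using pow_carrier_mat[OF A, of k] by blast+
      have "t ^ k * cmod ((A ^\<^sub>m k) $$ (i, j)) \<le> C"
        using C[of k] i j dims t unfolding pow_smult_mat[OF A] norm_bound_def
        by (auto simp: norm_mult norm_power)
      then show ?thesis
        using t by (simp add: field_simps power_inverse)
    qed
    then have "cmod (complex_of_real (v k i)) \<le> (\<Sum>j<n. C * (inverse t) ^ k)"
      unfolding vA[OF i] by (intro order.trans[OF norm_sum] sum_mono) auto
    then show ?thesis
      using vnn[OF i, of k] by (simp add: mult.assoc)
  qed
  have summ: "summable (\<lambda>k. v k i)" if "i < n" for i
  proof (rule summable_comparison_test')
    show "summable (\<lambda>k. real n * C * (inverse t) ^ k)"
      using t by (intro summable_mult summable_geometric) (simp add: inverse_less_1_iff)
    show "norm (v k i) \<le> real n * C * (inverse t) ^ k" if "0 \<le> k" for k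
      using vnn[OF \<open>i < n\<close>, of k] bound[OF \<open>i < n\<close>, of k] by simp
  qed
  define w where "w i = (\<Sum>k. v k i)" for i
  have w1: "1 \<le> w i" if "i < n" for i
    using sum_le_suminf[OF summ[OF that], of "{0}"] vnn[OF that] by (simp add: w_def v0)
  have cw: "(\<Sum>j<n. c i j * w j) = w i - 1" if i: "i < n" for i
  proof -
    have "(\<Sum>j<n. c i j * w j) = (\<Sum>j<n. \<Sum>k. c i j * v k j)"
      unfolding w_def using summ by (intro sum.cong) (auto simp: suminf_mult)
    also have "\<dots> = (\<Sum>k. \<Sum>j<n. c i j * v k j)"
      using summ by (intro suminf_sum[symmetric] summable_mult) auto
    also have "\<dots> = (\<Sum>k. v (Suc k) i)"
      by (simp add: vS)
    also have "\<dots> = w i - 1"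
      using suminf_split_head[OF summ[OF i]] by (simp add: w_def v0)
    finally show ?thesis .
  qed
  \<comment> \<open>From \<open>w i \<le> W\<close> follows
    \<open>w i - 1 \<le> (1 - 1 / W) * w i\<close>, so \<open>1 - 1 / W\<close> serves as the
    contraction factor.\<close>
  define W where "W = Max (w ` {..<n})"
  have W: "w i \<le> W" if "i < n" for i
    unfolding W_def using that by (intro Max_ge) auto
  have W1: "1 \<le> W"
    using w1[OF n] W[OF n] by simp
  have w_pos: "0 < w i" if "i < n" for i
    using w1[OF that] by simp
  have "(\<Sum>j<n. c i j * w j) \<le> (1 - 1 / W) * w i" if "i < n" for i
    unfolding cw[OF that] using W[OF that] W1 by (simp add: algebra_simps divide_le_eq)
  then show ?thesis
    using w_pos W1 by (intro exI[of _ w] exI[of _ "1 - 1 / W"]) auto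
qed

section \<open>Compactness and limits of sequences\<close>

lemma sequentially_compact_attains_max:
  fixes f :: "'a \<Rightarrow> real"
  assumes "K \<noteq> {}"
    and "\<And>x :: nat \<Rightarrow> 'a. (\<And>n. x n \<in> K) \<Longrightarrow>
      \<exists>s y. strict_mono s \<and> y \<in> K \<and> (\<lambda>n. f (x (s n))) \<longlonglongrightarrow> f y"
  shows "\<exists>y\<in>K. \<forall>x\<in>K. f x \<le> f y"
proof -
  \<comment> \<open>Compactness is established for the image in the reals only, so the type
    \<open>'a\<close> needs no topology. It will be a type of pairs of a matrix and a strategy
    profile.\<close>
  have "compact (f ` K)"
    unfolding compact_eq_seq_compact_metric seq_compact_def
  proof (intro allI impI)
    fix g :: "nat \<Rightarrow> real" assume "\<forall>n. g n \<in> f ` K"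
    then have "\<forall>n. \<exists>a. a \<in> K \<and> g n = f a"
      by blast
    from choice[OF this] obtain x where x: "\<And>n. x n \<in> K" "\<And>n. g n = f (x n)"
      by blast
    obtain s y where "strict_mono s" "y \<in> K" "(\<lambda>n. f (x (s n))) \<longlonglongrightarrow> f y"
      using assms(2)[of x] x(1) by blast
    then show "\<exists>l\<in>f ` K. \<exists>r. strict_mono r \<and> (g \<circ> r) \<longlonglongrightarrow> l"
      using x(2) by (auto simp: comp_def)
  qed
  then show ?thesis
    using compact_attains_sup[of "f ` K"] assms(1) by auto
qed

lemma bounded_real_convergent_subsequence:
  fixes f :: "nat \<Rightarrow> real"
  assumes "\<And>n. \<bar>f n\<bar> \<le> B"
  shows "\<exists>s l. strict_mono (s :: nat \<Rightarrow> nat) \<and> (\<lambda>n. f (s n)) \<longlonglongrightarrow> l"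
proof -
  obtain s where s: "strict_mono (s :: nat \<Rightarrow> nat)" "monoseq (\<lambda>n. f (s n))"
    using seq_monosub[of f] by blast
  have "Bseq (\<lambda>n. f (s n))"
    by (rule BseqI'[of _ B]) (use assms in simp)
  then have "convergent (\<lambda>n. f (s n))"
    using s(2) by (rule Bseq_monoseq_convergent)
  then show ?thesis
    using s(1) by (auto simp: convergent_def)
qed

lemma bounded_complex_convergent_subsequence:
  fixes f :: "nat \<Rightarrow> complex"
  assumes "\<And>n. cmod (f n) \<le> B"
  shows "\<exists>s l. strict_mono (s :: nat \<Rightarrow> nat) \<and> (\<lambda>n. f (s n)) \<longlonglongrightarrow> l"
proof -
  obtain s a where s: "strict_mono (s :: nat \<Rightarrow> nat)" "(\<lambda>n. Re (f (s n))) \<longlonglongrightarrow> a"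
    using bounded_real_convergent_subsequence[of "\<lambda>n. Re (f n)" B] assms abs_Re_le_cmod order.trans by blast
  obtain r b where r: "strict_mono (r :: nat \<Rightarrow> nat)" "(\<lambda>n. Im (f (s (r n)))) \<longlonglongrightarrow> b"
    using bounded_real_convergent_subsequence[of "\<lambda>n. Im (f (s n))" B] assms abs_Im_le_cmod order.trans by blast
  have "(\<lambda>n. Re (f (s (r n)))) \<longlonglongrightarrow> a"
    using LIMSEQ_subseq_LIMSEQ[OF s(2) r(1)] by (simp add: comp_def)
  then have "(\<lambda>n. f (s (r n))) \<longlonglongrightarrow> Complex a b"
    using r(2) by (simp add: tendsto_complex_iff)
  then show ?thesis
    using strict_mono_o[OF s(1) r(1)] by (intro exI[of _ "s \<circ> r"]) auto
qed

lemma simultaneous_convergent_subsequence: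
  fixes f :: "nat \<Rightarrow> 'i \<Rightarrow> complex"
  assumes "finite I" "\<And>i n. i \<in> I \<Longrightarrow> cmod (f n i) \<le> B i"
  shows "\<exists>s l. strict_mono (s :: nat \<Rightarrow> nat) \<and> (\<forall>i\<in>I. (\<lambda>n. f (s n) i) \<longlonglongrightarrow> l i)"
  using assms
proof (induction I rule: finite_induct)
  case empty
  show ?case by (intro exI[of _ id]) (auto simp: strict_mono_def)
next
  case (insert j I)
  obtain s l where s: "strict_mono (s :: nat \<Rightarrow> nat)" "\<And>i. i \<in> I \<Longrightarrow> (\<lambda>n. f (s n) i) \<longlonglongrightarrow> l i"
    using insert.IH insert.prems by (metis insertCI)
  obtain r a where r: "strict_mono (r :: nat \<Rightarrow> nat)" "(\<lambda>n. f (s (r n)) j) \<longlonglongrightarrow> a"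
    using bounded_complex_convergent_subsequence[of "\<lambda>n. f (s n) j" "B j"] insert.prems by auto
  have "(\<lambda>n. f (s (r n)) i) \<longlonglongrightarrow> (l(j := a)) i" if "i \<in> insert j I" for i
    using LIMSEQ_subseq_LIMSEQ[OF s(2) r(1), of i] r(2) that insert.hyps by (auto simp: comp_def)
  then show ?case
    using strict_mono_o[OF s(1) r(1)] by (intro exI[of _ "s \<circ> r"] exI[of _ "l(j := a)"]) (auto simp: comp_def)
qed

text \<open>The quantity to be bounded also occurs on the right, as happens when a perturbation
  estimate contains the unknown size of the perturbed object. Once \<open>a n\<close> is below
  \<open>1 / 2\<close> that occurrence is absorbed on the left, at the price of a factor 2.\<close>

lemma tendsto_0_of_relative_bound:
  fixes x a :: "nat \<Rightarrow> real"
  assumes "\<And>n. 0 \<le> x n" "\<And>n. 0 \<le> a n" "\<And>n. x n \<le> (z + x n) * a n" "a \<longlonglongrightarrow> 0" "0 \<le> z"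
  shows "x \<longlonglongrightarrow> 0"
proof -
  have "\<forall>\<^sub>F n in sequentially. a n < 1 / 2"
    using assms(4) by (intro order_tendstoD(2)) auto
  then have ev: "\<forall>\<^sub>F n in sequentially. x n \<le> 2 * z * a n"
  proof eventually_elim
    case (elim n)
    have "x n * a n \<le> x n * (1 / 2)"
      using elim assms(1) by (intro mult_left_mono) auto
    then show ?case
      using assms(3)[of n] by (simp add: algebra_simps)
  qed
  have "(\<lambda>n. 2 * z * a n) \<longlonglongrightarrow> 2 * z * 0"
    by (intro tendsto_intros assms(4))
  then show ?thesis
    using ev assms(1) by (intro tendsto_sandwich[OF _ ev tendsto_const]) auto
qed

lemma convergent_of_geometric_increments:
  fixes a :: "nat \<Rightarrow> complex"
  assumes "\<And>n. cmod (a (Suc n) - a n) \<le> C * \<beta> ^ n" "0 \<le> \<beta>" "\<beta> < 1"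
  shows "\<exists>l. a \<longlonglongrightarrow> l"
proof -
  have "summable (\<lambda>n. a (Suc n) - a n)"
    by (rule summable_comparison_test'[of "\<lambda>n. C * \<beta> ^ n" 0])
      (use assms in \<open>auto intro!: summable_mult summable_geometric\<close>)
  then have "convergent (\<lambda>n. \<Sum>i<n. a (Suc i) - a i)"
    by (simp add: summable_iff_convergent)
  then obtain l where "(\<lambda>n. \<Sum>i<n. a (Suc i) - a i) \<longlonglongrightarrow> l"
    by (auto simp: convergent_def)
  then have "(\<lambda>n. (a n - a 0) + a 0) \<longlonglongrightarrow> l + a 0"
    unfolding sum_lessThan_telescope by (intro tendsto_intros)
  then show ?thesis by auto
qed

section \<open>Totally asynchronous iterations\<close>

lemma sequence_condition_uniform:
  fixes T :: "nat set" and \<tau> :: "nat \<Rightarrow> nat"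
  assumes "\<And>s :: nat \<Rightarrow> nat. (\<forall>k. s k \<in> T) \<Longrightarrow> filterlim s at_top sequentially \<Longrightarrow>
    filterlim (\<lambda>k. \<tau> (s k)) at_top sequentially"
  shows "\<exists>n0. \<forall>n\<ge>n0. n \<in> T \<longrightarrow> N \<le> \<tau> n"
proof (rule ccontr)
  assume "\<not> ?thesis"
  then have "\<forall>n0. \<exists>n\<ge>n0. n \<in> T \<and> \<tau> n < N"
    by (meson not_le)
  \<comment> \<open>A violation beyond every index assembles into one update sequence that tends to
    infinity while the perceived times stay below \<open>N\<close>.\<close>
  from choice[OF this] obtain s where s: "\<And>k. k \<le> s k" "\<And>k. s k \<in> T" "\<And>k. \<tau> (s k) < N"
    by blast
  have "filterlim s at_top sequentially"
    using s(1) by (intro filterlim_at_top_mono[OF filterlim_ident]) auto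
  then have "filterlim (\<lambda>k. \<tau> (s k)) at_top sequentially"
    using assms s(2) by blast
  then have "\<forall>\<^sub>F k in sequentially. N \<le> \<tau> (s k)"
    by (simp add: filterlim_at_top)
  then show False
    using s(3) by (auto simp: eventually_sequentially not_le[symmetric])
qed

text \<open>Total asynchronism: once all weighted errors stay below \<open>b\<close>, after each player has updated
  on the basis of that information they stay below \<open>\<beta> b\<close>.\<close>

lemma asynchronous_contraction_tendsto_0:
  fixes e :: "nat \<Rightarrow> nat \<Rightarrow> real" and w :: "nat \<Rightarrow> real"
  assumes fin: "finite P" and w: "\<And>q. q \<in> P \<Longrightarrow> 0 < w q" and e: "\<And>q n. 0 \<le> e q n"
    and \<beta>: "0 \<le> \<beta>" "\<beta> < 1"
    and inf: "\<And>q. q \<in> P \<Longrightarrow> infinite (T q)"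
    and past: "\<And>q r n. q \<in> P \<Longrightarrow> r \<in> P - {q} \<Longrightarrow> \<tau> q r n \<le> n"
    and lim: "\<And>q r N. q \<in> P \<Longrightarrow> r \<in> P - {q} \<Longrightarrow> \<exists>n0. \<forall>n\<ge>n0. n \<in> T q \<longrightarrow> N \<le> \<tau> q r n"
    and idle: "\<And>q n. q \<in> P \<Longrightarrow> n \<notin> T q \<Longrightarrow> e q (Suc n) = e q n"
    and upd: "\<And>q n b. q \<in> P \<Longrightarrow> n \<in> T q \<Longrightarrow> 0 \<le> b \<Longrightarrow>
      (\<And>r. r \<in> P - {q} \<Longrightarrow> e r (\<tau> q r n) \<le> w r * b) \<Longrightarrow> e q (Suc n) \<le> w q * (\<beta> * b)"
    and q: "q \<in> P"
  shows "e q \<longlonglongrightarrow> 0"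
proof -
  \<comment> \<open>A sum as a convenient upper bound for the maximum of the weighted initial
    errors.\<close>
  define b0 where "b0 = (\<Sum>q\<in>P. e q 0 / w q)"
  have b0: "0 \<le> b0"
    unfolding b0_def using e w by (intro sum_nonneg divide_nonneg_pos) auto
  \<comment> \<open>The initial box is never left. Strong induction is needed because an update may
    use any earlier time.\<close>
  have "e q n \<le> w q * b0" if "q \<in> P" for q n
    using that
  proof (induction n arbitrary: q rule: less_induct)
    case (less n)
    show ?case
    proof (cases n)
      case 0
      have "e q 0 / w q \<le> b0"
        unfolding b0_def using e w less.prems fin
        by (intro member_le_sum[of q P "\<lambda>q. e q 0 / w q"]) (auto intro: divide_nonneg_pos)
      then show ?thesis
        using w[OF less.prems] 0 by (simp add: field_simps)
    next
      case (Suc m)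
      show ?thesis
      proof (cases "m \<in> T q")
        case True
        have "e q (Suc m) \<le> w q * (\<beta> * b0)"
          using less past[OF less.prems] Suc by (intro upd[OF less.prems True b0]) (auto intro!: less.IH simp: less_Suc_eq_le)
        also have "\<dots> \<le> w q * b0"
          using w[OF less.prems] b0 \<beta> by (intro mult_left_mono mult_left_le_one_le) auto
        finally show ?thesis using Suc by simp
      next
        case False
        then show ?thesis
          using Suc less idle[OF less.prems False] by simp
      qed
    qed
  qed
  then have boxes: "\<exists>N. \<forall>n\<ge>N. \<forall>q\<in>P. e q n \<le> w q * (\<beta> ^ k * b0)" for k
  proof (induction k)
    case (Suc k)
    then obtain N where N: "\<And>n q. N \<le> n \<Longrightarrow> q \<in> P \<Longrightarrow> e q n \<le> w q * (\<beta> ^ k * b0)"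
      by blast
    let ?b = "\<beta> ^ k * b0"
    have b: "0 \<le> ?b" using \<beta> b0 by simp
    have "\<exists>M. \<forall>n\<ge>M. e q n \<le> w q * (\<beta> * ?b)" if q: "q \<in> P" for q
    proof -
      have "\<forall>r\<in>P - {q}. \<exists>n0. \<forall>n\<ge>n0. n \<in> T q \<longrightarrow> N \<le> \<tau> q r n"
        using lim[OF q] by blast
      from bchoice[OF this]
      obtain h where h: "\<And>r n. r \<in> P - {q} \<Longrightarrow> h r \<le> n \<Longrightarrow> n \<in> T q \<Longrightarrow> N \<le> \<tau> q r n"
        by blast
      \<comment> \<open>The sum dominates every individual threshold; from time \<open>L\<close> on,
        updates of \<open>q\<close> use only information from inside the old box.\<close>
      define L where "L = (\<Sum>r\<in>P - {q}. h r)"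
      have L: "h r \<le> L" if "r \<in> P - {q}" for r
        unfolding L_def using that fin by (intro member_le_sum) auto
      have good: "e q (Suc n) \<le> w q * (\<beta> * ?b)" if n: "L \<le> n" "n \<in> T q" for n
      proof (rule upd[OF q n(2) b])
        fix r assume r: "r \<in> P - {q}"
        then show "e r (\<tau> q r n) \<le> w r * ?b"
          using h[OF r order.trans[OF L[OF r] n(1)] n(2)] by (intro N) auto
      qed
      \<comment> \<open>The first such update moves player \<open>q\<close> into the smaller box;
        afterwards an update lands in it again and an idle step changes nothing.\<close>
      obtain m where m: "m \<in> T q" "L \<le> m"
        using inf[OF q] infinite_nat_iff_unbounded_le by blast
      have "e q n \<le> w q * (\<beta> * ?b)" if "Suc m \<le> n" for n
        using that
      proof (induction n rule: dec_induct)
        case base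
        show ?case using good m by simp
      next
        case (step n)
        then show ?case
          using good[of n] idle[OF q, of n] m by (cases "n \<in> T q") auto
      qed
      then show ?thesis by blast
    qed
    then have "\<forall>q\<in>P. \<exists>M. \<forall>n\<ge>M. e q n \<le> w q * (\<beta> * ?b)"
      by blast
    from bchoice[OF this]
    obtain M where M: "\<And>q n. q \<in> P \<Longrightarrow> M q \<le> n \<Longrightarrow> e q n \<le> w q * (\<beta> * ?b)"
      by blast
    have "e q n \<le> w q * (\<beta> ^ Suc k * b0)" if "(\<Sum>q\<in>P. M q) \<le> n" "q \<in> P" for n q
      using M[OF that(2), of n] member_le_sum[OF that(2), of M] fin that by (simp add: mult.assoc)
    then show ?case by blast
  qed auto
  show ?thesis
  proof (rule LIMSEQ_I)
    fix \<epsilon> :: real assume "0 < \<epsilon>"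
    have "(\<lambda>k. w q * (\<beta> ^ k * b0)) \<longlonglongrightarrow> w q * (0 * b0)"
      using \<beta> by (intro tendsto_intros LIMSEQ_realpow_zero) auto
    then have "\<forall>\<^sub>F k in sequentially. w q * (\<beta> ^ k * b0) < \<epsilon>"
      using \<open>0 < \<epsilon>\<close> by (intro order_tendstoD(2)) auto
    then obtain k where k: "w q * (\<beta> ^ k * b0) < \<epsilon>"
      by (auto simp: eventually_sequentially)
    obtain N where "\<And>n. N \<le> n \<Longrightarrow> e q n \<le> w q * (\<beta> ^ k * b0)"
      using boxes[of k] q by blast
    then show "\<exists>N. \<forall>n\<ge>N. norm (e q n - 0) < \<epsilon>"
      using k e by (intro exI[of _ N]) (auto intro: le_less_trans)
  qed
qed

subsection \<open>Limits and sums of matrices\<close>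

text \<open>With \<open>A = F\<^sup>H * F\<close>, the Frobenius norm of \<open>A\<close> is at most
  the squared norm of \<open>F\<close>, which is the trace. A fixed power budget therefore bounds
  all entries.\<close>

lemma psd_norm_entry_le_trace:
  assumes "psd_mat n A" "i < n" "j < n"
  shows "cmod (A $$ (i, j)) \<le> Re (mat_trace A)"
proof -
  obtain F where F: "F \<in> carrier_mat n n" "A = F\<^sup>H * F"
    using psd_factor[OF assms(1)] .
  have "cmod (A $$ (i, j)) \<le> frob_norm A"
    using psd_matD(1)[OF assms(1)] assms(2,3) by (intro norm_entry_le_frobenius) auto
  also have "\<dots> \<le> frob_norm (F\<^sup>H) * frob_norm F"
    unfolding F(2) using F(1) by (intro frob_norm_mult) auto
  also have "\<dots> = Re (mat_trace A)"
    unfolding F(2) trace_adjoint_mult_self[OF F(1)] by (simp add: power2_eq_square)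
  finally show ?thesis .
qed

lemma psd_limit:
  assumes A: "\<And>m. psd_mat n (A m)" and B: "B \<in> carrier_mat n n"
    and lim: "\<And>i j. i < n \<Longrightarrow> j < n \<Longrightarrow> (\<lambda>m. A m $$ (i, j)) \<longlonglongrightarrow> B $$ (i, j)"
  shows "psd_mat n B"
  unfolding psd_mat_def
proof (intro conjI ballI)
  show "hermitian_mat B"
    unfolding hermitian_mat_def
  proof (rule eq_matI)
    fix i j assume "i < dim_row B" "j < dim_col B"
    then have ij: "i < n" "j < n" using B by auto
    have "(\<lambda>m. cnj (A m $$ (j, i))) \<longlonglongrightarrow> cnj (B $$ (j, i))"
      by (intro tendsto_intros lim ij)
    moreover have "cnj (A m $$ (j, i)) = A m $$ (i, j)" for m
      using hermitian_matD[OF psd_matD(2)[OF A[of m]], of i j] psd_matD(1)[OF A[of m]] ij by auto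
    ultimately have "(\<lambda>m. A m $$ (i, j)) \<longlonglongrightarrow> cnj (B $$ (j, i))" by simp
    then have "cnj (B $$ (j, i)) = B $$ (i, j)"
      using lim[OF ij] by (rule LIMSEQ_unique)
    then show "B\<^sup>H $$ (i, j) = B $$ (i, j)"
      using B ij by simp
  qed (use B in auto)
next
  fix v :: "complex vec" assume v: "v \<in> carrier_vec n"
  have quad: "(M *\<^sub>v v) \<bullet>c v = (\<Sum>i<n. (\<Sum>j<n. M $$ (i, j) * v $ j) * cnj (v $ i))"
    if "M \<in> carrier_mat n n" for M
    using that v by (simp add: scalar_prod_def atLeast0LessThan)
  have "(\<lambda>m. (A m *\<^sub>v v) \<bullet>c v) \<longlonglongrightarrow> (B *\<^sub>v v) \<bullet>c v"
    unfolding quad[OF B] quad[OF psd_matD(1)[OF A]]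
    by (intro tendsto_intros lim) auto
  \<comment> \<open>The order on complex numbers includes being real, so the limit is taken
    separately in the real and the imaginary part.\<close>
  then have lim: "(\<lambda>m. Re ((A m *\<^sub>v v) \<bullet>c v)) \<longlonglongrightarrow> Re ((B *\<^sub>v v) \<bullet>c v)"
    "(\<lambda>m. Im ((A m *\<^sub>v v) \<bullet>c v)) \<longlonglongrightarrow> Im ((B *\<^sub>v v) \<bullet>c v)"
    by (auto intro: tendsto_Re tendsto_Im)
  have "0 \<le> (A m *\<^sub>v v) \<bullet>c v" for m
    by (rule psd_matD(3)[OF A v])
  then have nn: "0 \<le> Re ((A m *\<^sub>v v) \<bullet>c v)" and im: "Im ((A m *\<^sub>v v) \<bullet>c v) = 0" for m
    by (auto simp: less_eq_complex_def)
  have "0 \<le> Re ((B *\<^sub>v v) \<bullet>c v)"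
    by (rule LIMSEQ_le_const[OF lim(1)]) (use nn in blast)
  moreover have "Im ((B *\<^sub>v v) \<bullet>c v) = 0"
    using lim(2) unfolding im by (rule LIMSEQ_unique[OF _ tendsto_const])
  ultimately show "0 \<le> (B *\<^sub>v v) \<bullet>c v"
    by (simp add: less_eq_complex_def)
qed (rule B)

lemma frob_norm_tendsto_0:
  assumes A: "\<And>k. A k \<in> carrier_mat n m"
    and lim: "\<And>i j. i < n \<Longrightarrow> j < m \<Longrightarrow> (\<lambda>k. A k $$ (i, j)) \<longlonglongrightarrow> 0"
  shows "(\<lambda>k. frob_norm (A k)) \<longlonglongrightarrow> 0"
proof -
  have "(\<lambda>k. \<Sum>i<n. \<Sum>j<m. (cmod (A k $$ (i, j)))\<^sup>2) \<longlonglongrightarrow> (\<Sum>i<n. \<Sum>j<m. (cmod 0)\<^sup>2)"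
    by (intro tendsto_intros lim) auto
  then have "(\<lambda>k. sqrt ((frob_norm (A k))\<^sup>2)) \<longlonglongrightarrow> sqrt 0"
    unfolding frob_norm_square[OF A] by (intro tendsto_real_sqrt) simp
  then show ?thesis by simp
qed

lemma frob_norm_diff_tendsto_0:
  assumes "\<And>k. A k \<in> carrier_mat n m" "B \<in> carrier_mat n m"
    and "\<And>i j. i < n \<Longrightarrow> j < m \<Longrightarrow> (\<lambda>k. A k $$ (i, j)) \<longlonglongrightarrow> B $$ (i, j)"
  shows "(\<lambda>k. frob_norm (A k - B)) \<longlonglongrightarrow> 0"
proof (rule frob_norm_tendsto_0[of _ n m])
  fix i j assume ij: "i < n" "j < m"
  then have "(A k - B) $$ (i, j) = A k $$ (i, j) - B $$ (i, j)" for k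
    using assms(1)[of k] assms(2) by simp
  then show "(\<lambda>k. (A k - B) $$ (i, j)) \<longlonglongrightarrow> 0"
    using assms(3)[OF ij] by (simp add: LIM_zero_iff)
qed (use assms in auto)

lemma frob_norm_tendsto_0_entry:
  assumes "\<And>k. A k \<in> carrier_mat n m" "B \<in> carrier_mat n m"
    and "(\<lambda>k. frob_norm (A k - B)) \<longlonglongrightarrow> 0" and ij: "i < n" "j < m"
  shows "(\<lambda>k. A k $$ (i, j)) \<longlonglongrightarrow> B $$ (i, j)"
proof -
  have "norm (A k $$ (i, j) - B $$ (i, j)) \<le> frob_norm (A k - B)" for k
    using norm_entry_le_frobenius[of i "A k - B" j] assms(1)[of k] assms(2) ij by simp
  then have "(\<lambda>k. A k $$ (i, j) - B $$ (i, j)) \<longlonglongrightarrow> 0"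
    by (intro tendsto_0_le[OF assms(3), of _ 1] always_eventually allI) simp
  then show ?thesis
    by (simp add: LIM_zero_iff)
qed

text \<open>Has the shape of the entrywise sum in \<open>noise_plus_interference\<close>, so the
  covariance unfolds to it directly.\<close>

definition mat_sum :: "nat \<Rightarrow> 'i set \<Rightarrow> ('i \<Rightarrow> complex mat) \<Rightarrow> complex mat" where
  "mat_sum n I A = mat n n (\<lambda>ij. \<Sum>r\<in>I. A r $$ ij)"

lemma mat_sum_carrier [simp]: "mat_sum n I A \<in> carrier_mat n n"
  by (simp add: mat_sum_def)

lemma mat_sum_empty: "mat_sum n {} A = 0\<^sub>m n n"
  by (rule eq_matI) (auto simp: mat_sum_def)

lemma mat_sum_insert:
  assumes "finite I" "r \<notin> I" "A r \<in> carrier_mat n n"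
  shows "mat_sum n (insert r I) A = A r + mat_sum n I A"
  using assms by (intro eq_matI) (auto simp: mat_sum_def)

lemma mat_sum_minus:
  assumes "\<And>r. r \<in> I \<Longrightarrow> A r \<in> carrier_mat n n" "\<And>r. r \<in> I \<Longrightarrow> B r \<in> carrier_mat n n"
  shows "mat_sum n I A - mat_sum n I B = mat_sum n I (\<lambda>r. A r - B r)"
proof (rule eq_matI)
  fix i j assume "i < dim_row (mat_sum n I (\<lambda>r. A r - B r))" "j < dim_col (mat_sum n I (\<lambda>r. A r - B r))"
  then have ij: "i < n" "j < n" by (auto simp: mat_sum_def)
  have "(A r - B r) $$ (i, j) = A r $$ (i, j) - B r $$ (i, j)" if "r \<in> I" for r
    using assms(1)[OF that] assms(2)[OF that] ij by simp
  then show "(mat_sum n I A - mat_sum n I B) $$ (i, j) = mat_sum n I (\<lambda>r. A r - B r) $$ (i, j)"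
    using ij by (simp add: mat_sum_def sum_subtractf)
qed (auto simp: mat_sum_def)

lemma psd_mat_sum:
  assumes "finite I" "\<And>r. r \<in> I \<Longrightarrow> psd_mat n (A r)"
  shows "psd_mat n (mat_sum n I A)"
  using assms
proof (induction I rule: finite_induct)
  case empty
  show ?case by (simp add: mat_sum_empty psd_zero)
next
  case (insert r I)
  then show ?case
    by (simp add: mat_sum_insert psd_matD(1) psd_add)
qed

text \<open>The outer factors stay inside each summand: later they combine with the channel of the
  respective player before norms are taken.\<close>

lemma frob_norm_mat_sum_sandwich:
  assumes "finite I" "\<And>r. r \<in> I \<Longrightarrow> A r \<in> carrier_mat n n"
    and X: "X \<in> carrier_mat m n" and Y: "Y \<in> carrier_mat n k"
  shows "frob_norm (X * mat_sum n I A * Y) \<le> (\<Sum>r\<in>I. frob_norm (X * A r * Y))"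
  using assms(1,2)
proof (induction I rule: finite_induct)
  case empty
  have "X * 0\<^sub>m n n * Y = 0\<^sub>m m k"
    using X Y by simp
  then show ?case
    by (simp add: mat_sum_empty)
next
  case (insert r I)
  have Ar: "A r \<in> carrier_mat n n" using insert.prems by simp
  have "X * mat_sum n (insert r I) A * Y = X * A r * Y + X * mat_sum n I A * Y"
    unfolding mat_sum_insert[where A = A, OF insert.hyps Ar] using X Y Ar
    by (simp add: mult_add_distrib_mat[of _ m n _ n] add_mult_distrib_mat[of _ m n _ _ k])
  then have "frob_norm (X * mat_sum n (insert r I) A * Y)
      \<le> frob_norm (X * A r * Y) + frob_norm (X * mat_sum n I A * Y)"
    using X Y Ar by (simp only:) (intro frob_norm_triangle[of _ m k], auto)
  also have "\<dots> \<le> frob_norm (X * A r * Y) + (\<Sum>r\<in>I. frob_norm (X * A r * Y))"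
    using insert by simp
  finally show ?case
    using insert.hyps by simp
qed

lemma eq_mat_on_vecI:
  fixes A :: "complex mat"
  assumes A: "A \<in> carrier_mat n m" and B: "B \<in> carrier_mat n m"
    and eq: "\<And>v. v \<in> carrier_vec m \<Longrightarrow> A *\<^sub>v v = B *\<^sub>v v"
  shows "A = B"
proof (rule eq_matI)
  fix i j assume ij: "i < dim_row B" "j < dim_col B"
  have "row A i \<bullet> unit_vec m j = row B i \<bullet> unit_vec m j"
    using arg_cong[OF eq[of "unit_vec m j"], of "\<lambda>u. u $ i"] A B ij by simp
  then show "A $$ (i, j) = B $$ (i, j)"
    using A B ij by simp
qed (use A B in auto)

subsection \<open>The interference game\<close>

locale mimo_setting =
  fixes G :: mimo_system
  assumes game: "mimo_game G"
begin

abbreviation nT where "nT \<equiv> tx_dim G"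
abbreviation nR where "nR \<equiv> rx_dim G"
abbreviation H where "H \<equiv> channel G"
abbreviation rk where "rk q \<equiv> mat_rank (H q q)"
abbreviation cov where "cov \<equiv> noise_plus_interference G"
abbreviation coeff where "coeff \<equiv> interference_coeff G"
abbreviation others where "others q \<equiv> players G - {q}"
abbreviation eig where "eig q X \<equiv> reduced_eigendecomposition (nT q) (rk q) (effective_channel G q X)"

lemma finite_players [simp]: "finite (players G)"
  by (simp add: players_def)

lemma channel_carrier:
  "r \<in> players G \<Longrightarrow> q \<in> players G \<Longrightarrow> H r q \<in> carrier_mat (nR q) (nT r)"
  using game by (simp add: mimo_game_def)

lemma noise_pd: "q \<in> players G \<Longrightarrow> pd_mat (nR q) (noise_cov G q)"
  using game by (simp add: mimo_game_def)

lemma power_pos: "q \<in> players G \<Longrightarrow> 0 < power G q"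
  using game by (simp add: mimo_game_def)

lemma direct_channel_nonzero:
  "q \<in> players G \<Longrightarrow> H q q \<noteq> 0\<^sub>m (nR q) (nT q)"
  using game by (simp add: mimo_game_def)

text \<open>Supplies the positive dimension that the spectral radius estimates ask for; a matrix
  without columns would be zero.\<close>

lemma tx_dim_pos:
  assumes "q \<in> players G"
  shows "0 < nT q"
proof (rule ccontr)
  assume "\<not> 0 < nT q"
  then have "H q q = 0\<^sub>m (nR q) (nT q)"
    using channel_carrier[OF assms assms] by (intro eq_matI) auto
  then show False
    using direct_channel_nonzero[OF assms] by simp
qed

text \<open>Positivity without the power constraint already makes the covariance positive definite.
  It also admits zero matrices, from which a first strategy is built.\<close>

definition psd_others :: "nat \<Rightarrow> (nat \<Rightarrow> complex mat) \<Rightarrow> bool" where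
  "psd_others q X \<longleftrightarrow> (\<forall>r\<in>others q. psd_mat (nT r) (X r))"

lemma strategiesD:
  assumes "X \<in> strategies G q"
  shows "psd_mat (nT q) X" "mat_trace X = complex_of_real (power G q)"
    "X \<in> carrier_mat (nT q) (nT q)"
  using assms by (auto simp: strategies_def psd_mat_def)

lemma strategies_psd_others:
  "(\<And>r. r \<in> others q \<Longrightarrow> X r \<in> strategies G r) \<Longrightarrow> psd_others q X"
  by (simp add: psd_others_def strategiesD)

definition interference :: "nat \<Rightarrow> nat \<Rightarrow> complex mat \<Rightarrow> complex mat" where
  "interference q r Y = H r q * Y * (H r q)\<^sup>H"

lemma interference_carrier:
  "q \<in> players G \<Longrightarrow> r \<in> players G \<Longrightarrow> Y \<in> carrier_mat (nT r) (nT r) \<Longrightarrow>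
    interference q r Y \<in> carrier_mat (nR q) (nR q)"
  using channel_carrier[of r q] by (auto simp: interference_def)

lemma noise_plus_interference_eq:
  "cov q X
    = noise_cov G q + mat_sum (nR q) (others q) (\<lambda>r. interference q r (X r))"
  by (simp add: noise_plus_interference_def mat_sum_def interference_def)

lemma noise_plus_interference_pd:
  assumes q: "q \<in> players G" and X: "psd_others q X"
  shows "pd_mat (nR q) (cov q X)"
  unfolding noise_plus_interference_eq
proof (rule pd_add_psd[OF noise_pd[OF q] psd_mat_sum])
  fix r assume r: "r \<in> others q"
  have "(H r q)\<^sup>H \<in> carrier_mat (nT r) (nR q)"
    using channel_carrier[of r q] r q by simp
  from psd_sandwich[OF _ this, of "X r"] show "psd_mat (nR q) (interference q r (X r))"
    using X r by (simp add: psd_others_def interference_def)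
qed simp

lemma noise_plus_interference_diff:
  assumes q: "q \<in> players G" and X: "psd_others q X" and Y: "psd_others q Y"
  shows "cov q X - cov q Y
    = mat_sum (nR q) (others q) (\<lambda>r. interference q r (X r - Y r))"
proof -
  let ?n = "nR q"
  have c: "X r \<in> carrier_mat (nT r) (nT r)" "Y r \<in> carrier_mat (nT r) (nT r)"
    if "r \<in> others q" for r
    using X Y that by (auto simp: psd_others_def psd_mat_def)
  have "cov q X - cov q Y
    = mat_sum ?n (others q) (\<lambda>r. interference q r (X r)) - mat_sum ?n (others q) (\<lambda>r. interference q r (Y r))"
    unfolding noise_plus_interference_eq using pd_matD(1)[OF noise_pd[OF q]]
    by (intro eq_matI) (auto simp: mat_sum_def)
  also have "\<dots> = mat_sum ?n (others q) (\<lambda>r. interference q r (X r) - interference q r (Y r))"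
    using c q by (intro mat_sum_minus interference_carrier) auto
  also have "\<dots> = mat_sum ?n (others q) (\<lambda>r. interference q r (X r - Y r))"
  proof -
    have "interference q r (X r) - interference q r (Y r) = interference q r (X r - Y r)"
      if r: "r \<in> others q" for r
      using channel_carrier[of r q] c[OF r] r q unfolding interference_def
      by (simp add: mult_minus_distrib_mat[of _ "nR q" "nT r" _ "nT r"]
          minus_mult_distrib_mat[of _ "nR q" "nT r" _ _ "nR q"])
    then show ?thesis
      unfolding mat_sum_def by (intro cong_mat) (auto intro!: sum.cong)
  qed
  finally show ?thesis .
qed

section \<open>Generalized least-squares inverses of the direct channels\<close>

definition gls_inverse :: "nat \<Rightarrow> (nat \<Rightarrow> complex mat) \<Rightarrow> complex mat \<Rightarrow> bool" where
  "gls_inverse q X Z \<longleftrightarrow> weighted_pinv (cov q X) (H q q) Z"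

text \<open>The decomposition has the size \<open>is_waterfilling\<close> demands, the rank of the
  direct channel, because weighting by a positive definite covariance does not change the
  rank.\<close>

lemma effective_channel_decomposition:
  assumes q: "q \<in> players G" and X: "psd_others q X"
  obtains U d where "eig q X U d"
proof -
  note H = channel_carrier[OF q q] and R = noise_plus_interference_pd[OF q X]
  have "psd_mat (nT q) (effective_channel G q X)"
    unfolding effective_channel_def by (rule psd_sandwich[OF pd_inverse(5)[OF R] H])
  then obtain k U d where red: "reduced_eigendecomposition (nT q) k (effective_channel G q X) U d"
    using reduced_eigendecomposition_exists by blast
  then show ?thesis
    using that gram_reduced_eigendecomposition(4)[OF H R red[unfolded effective_channel_def]] by simp
qed

lemma gls_inverse_decomposition:
  assumes q: "q \<in> players G" and X: "psd_others q X"
    and red: "reduced_eigendecomposition (nT q) k (effective_channel G q X) U d"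
  obtains Z where "gls_inverse q X Z" "Z * H q q = U * U\<^sup>H"
    "Z * cov q X * Z\<^sup>H = U * diag k (\<lambda>i. inverse (d i)) * U\<^sup>H"
    "k = nR q \<Longrightarrow> H q q * Z = 1\<^sub>m (nR q)"
  using gram_reduced_eigendecomposition[OF channel_carrier[OF q q] noise_plus_interference_pd[OF q X]
      red[unfolded effective_channel_def]] that
  unfolding gls_inverse_def by blast

lemma gls_inverse_exists:
  assumes "q \<in> players G" "psd_others q X"
  obtains Z where "gls_inverse q X Z"
    "rk q = nR q \<Longrightarrow> H q q * Z = 1\<^sub>m (nR q)"
  using effective_channel_decomposition[OF assms] gls_inverse_decomposition[OF assms] by metis

lemma gls_inverse_unique:
  assumes "q \<in> players G" "psd_others q X" "gls_inverse q X Z" "gls_inverse q X Z'"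
  shows "Z = Z'"
  using weighted_pinv_unique[OF channel_carrier[OF assms(1,1)] noise_plus_interference_pd[OF assms(1,2)]]
    assms(3,4) unfolding gls_inverse_def by blast

lemma gls_inverseD:
  assumes "q \<in> players G" "psd_others q X" "gls_inverse q X Z"
  shows "Z \<in> carrier_mat (nT q) (nR q)"
    "H q q * Z * H q q = H q q" "Z * H q q * Z = Z"
    "cov q X * Z\<^sup>H * (H q q)\<^sup>H = H q q * Z * cov q X"
  using weighted_pinvD[OF assms(3)[unfolded gls_inverse_def] channel_carrier[OF assms(1,1)]
      pd_matD(1,2)[OF noise_plus_interference_pd[OF assms(1,2)]]] by blast+

text \<open>With rank 0 the projector \<open>Z * H q q\<close> would vanish, and
  \<open>H q q * Z * H q q = H q q\<close> would make the channel zero. A positive rank is what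
  allows a water level to exist.\<close>

lemma mat_rank_channel_pos:
  assumes q: "q \<in> players G" and X: "psd_others q X"
  shows "0 < rk q"
proof (rule ccontr)
  assume "\<not> 0 < rk q"
  then obtain U d where red: "reduced_eigendecomposition (nT q) 0 (effective_channel G q X) U d"
    using effective_channel_decomposition[OF q X] by auto
  obtain Z where Z: "gls_inverse q X Z" "Z * H q q = U * U\<^sup>H"
    using gls_inverse_decomposition[OF q X red] by blast
  note H = channel_carrier[OF q q]
  have "H q q = H q q * (Z * H q q)"
    using gls_inverseD[OF q X Z(1)] H by (simp add: mat_mult_assoc)
  also have "Z * H q q = 0\<^sub>m (nT q) (nT q)"
    unfolding Z(2) using reduced_eigendecompositionD(1)[OF red]
    by (intro eq_matI) (auto simp: scalar_prod_def)
  finally show False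
    using H direct_channel_nonzero[OF q] by simp
qed

section \<open>Waterfilling strategies and Nash equilibria\<close>

lemma is_waterfilling_exists:
  assumes q: "q \<in> players G" and X: "psd_others q X"
  shows "\<exists>W. is_waterfilling G q X W"
proof -
  obtain U d where red: "eig q X U d"
    using effective_channel_decomposition[OF q X] .
  have "\<exists>\<mu>. (\<Sum>i<rk q. max 0 (\<mu> - inverse (d i))) = power G q"
    using mat_rank_channel_pos[OF q X] reduced_eigendecompositionD(3)[OF red] power_pos[OF q]
    by (intro waterfilling_level_exists)
  then show ?thesis
    using red unfolding is_waterfilling_def Let_def by blast
qed

lemma waterfilling_is_waterfilling:
  assumes "q \<in> players G" "psd_others q X"
  shows "is_waterfilling G q X (waterfilling G q X)"
  unfolding waterfilling_def by (rule someI_ex[OF is_waterfilling_exists[OF assms]])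

lemma is_waterfillingE:
  assumes "is_waterfilling G q X W"
  obtains U d w \<mu> where "eig q X U d"
    "\<And>i. w i = max 0 (\<mu> - inverse (d i))" "(\<Sum>i<rk q. w i) = power G q"
    "W = U * diag (rk q) w * U\<^sup>H"
proof -
  obtain U d \<mu> where *: "eig q X U d"
    "(\<Sum>i<rk q. max 0 (\<mu> - inverse (d i))) = power G q"
    "W = U * diag (rk q) (\<lambda>i. max 0 (\<mu> - inverse (d i))) * U\<^sup>H"
    using assms unfolding is_waterfilling_def Let_def by blast
  show ?thesis
    by (rule that[OF *(1) refl *(2,3)])
qed

lemma is_waterfilling_strategy:
  assumes "is_waterfilling G q X W"
  shows "W \<in> strategies G q"
  using assms
proof (rule is_waterfillingE)
  fix U d and w :: "nat \<Rightarrow> real" and \<mu> assume *: "eig q X U d"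
    "\<And>i. w i = max 0 (\<mu> - inverse (d i))" "(\<Sum>i<rk q. w i) = power G q"
    "W = U * diag (rk q) w * U\<^sup>H"
  note U = reduced_eigendecompositionD[OF *(1)]
  have "psd_mat (nT q) W"
    unfolding *(4) using *(2) by (intro psd_sandwich_diag_of_real[OF U(1)]) simp
  moreover have "mat_trace W = complex_of_real (power G q)"
    unfolding *(4) sandwich_diag_trace[OF U(1,2)] *(3) ..
  ultimately show ?thesis
    by (simp add: strategies_def)
qed

text \<open>Combines nonexpansiveness in \<open>U D\<^sup>-\<^sup>1 U\<^sup>H\<close> with the exact
  difference identity. Uniqueness of the weighted inverse links the given \<open>Z\<close> and
  \<open>Z'\<close> to whatever eigendecompositions produced \<open>W\<close> and
  \<open>V\<close>.\<close>

lemma waterfilling_diff_le: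
  assumes q: "q \<in> players G" and X: "psd_others q X" and Y: "psd_others q Y"
    and W: "is_waterfilling G q X W" and V: "is_waterfilling G q Y V"
    and Z: "gls_inverse q X Z" and Z': "gls_inverse q Y Z'"
  shows "frob_norm (W - V) \<le> frob_norm
    (Z * (cov q X - cov q Y) * Z'\<^sup>H)"
proof -
  note H = channel_carrier[OF q q]
  note RX = pd_matD(1,2)[OF noise_plus_interference_pd[OF q X]]
    and RY = pd_matD(1,2)[OF noise_plus_interference_pd[OF q Y]]
  obtain U d w \<mu> where W: "eig q X U d"
    "\<And>i. w i = max 0 (\<mu> - inverse (d i))" "(\<Sum>i<rk q. w i) = power G q"
    "W = U * diag (rk q) w * U\<^sup>H"
    by (rule is_waterfillingE[OF W]) blast
  obtain U' d' w' \<mu>' where V: "eig q Y U' d'"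
    "\<And>i. w' i = max 0 (\<mu>' - inverse (d' i))" "(\<Sum>i<rk q. w' i) = power G q"
    "V = U' * diag (rk q) w' * U'\<^sup>H"
    by (rule is_waterfillingE[OF V]) blast
  note U = reduced_eigendecompositionD[OF W(1)] and U' = reduced_eigendecompositionD[OF V(1)]
  have ZU: "Z * H q q = U * U\<^sup>H" "Z * cov q X * Z\<^sup>H
      = U * diag (rk q) (\<lambda>i. inverse (d i)) * U\<^sup>H"
    using gls_inverse_decomposition[OF q X W(1)] gls_inverse_unique[OF q X Z] by metis+
  have ZU': "Z' * H q q = U' * U'\<^sup>H" "Z' * cov q Y * Z'\<^sup>H
      = U' * diag (rk q) (\<lambda>i. inverse (d' i)) * U'\<^sup>H"
    using gls_inverse_decomposition[OF q Y V(1)] gls_inverse_unique[OF q Y Z'] by metis+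
  have UU: "U * U\<^sup>H = U' * U'\<^sup>H"
    unfolding ZU(1)[symmetric] ZU'(1)[symmetric]
    by (rule weighted_pinv_row_projector[OF H RX Z[unfolded gls_inverse_def] RY Z'[unfolded gls_inverse_def]])
  have "frob_norm (W - V) \<le> frob_norm
    (U * diag (rk q) (\<lambda>i. inverse (d i)) * U\<^sup>H
      - U' * diag (rk q) (\<lambda>i. inverse (d' i)) * U'\<^sup>H)"
    unfolding W(4) V(4)
    by (rule waterfilling_nonexpansive[OF U(1,2) U'(1,2) UU]) (rule W(2), rule V(2), simp add: W(3) V(3))
  then show ?thesis
    unfolding ZU(2)[symmetric] ZU'(2)[symmetric]
      weighted_pinv_quadratic_diff[OF H RX Z[unfolded gls_inverse_def] RY Z'[unfolded gls_inverse_def]] .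
qed

lemma waterfilling_rate:
  assumes q: "q \<in> players G" and W: "is_waterfilling G q X W" and Y: "Y \<in> strategies G q"
  shows "rate G q Y X \<le> rate G q W X" "rate G q Y X = rate G q W X \<Longrightarrow> Y = W"
proof -
  obtain U d w \<mu> where W: "eig q X U d"
    "\<And>i. w i = max 0 (\<mu> - inverse (d i))" "(\<Sum>i<rk q. w i) = power G q"
    "W = U * diag (rk q) w * U\<^sup>H"
    by (rule is_waterfillingE[OF W]) blast
  note b = waterfilling_best_response[where w = w and d = d and \<mu> = \<mu>, OF W(1) W(2) W(3) power_pos[OF q] strategiesD(1,2)[OF Y], folded W(4)]
  show "rate G q Y X \<le> rate G q W X" "rate G q Y X = rate G q W X \<Longrightarrow> Y = W"
    unfolding rate_def by (fact b)+
qed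

text \<open>An equilibrium strategy has the same rate as the waterfilling matrix, and uniqueness of
  the best response makes them equal. The relation \<open>is_waterfilling\<close> is used, so
  nothing depends on the choice in \<open>waterfilling\<close>.\<close>

lemma nash_equilibrium_iff_waterfilling:
  assumes X: "X \<in> profiles G"
  shows "nash_equilibrium G X \<longleftrightarrow> (\<forall>q\<in>players G. is_waterfilling G q X (X q))"
proof
  have Xs: "X q \<in> strategies G q" if "q \<in> players G" for q
    using X that by (auto simp: profiles_def PiE_def)
  have Xp: "psd_others q X" for q
    using Xs by (intro strategies_psd_others) auto
  {
    assume ne: "nash_equilibrium G X"
    show "\<forall>q\<in>players G. is_waterfilling G q X (X q)"
    proof
      fix q assume q: "q \<in> players G"
      obtain W where W: "is_waterfilling G q X W"
        using is_waterfilling_exists[OF q Xp] by blast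
      have "rate G q W X \<le> rate G q (X q) X"
        using ne q is_waterfilling_strategy[OF W] by (simp add: nash_equilibrium_def)
      then have "rate G q (X q) X = rate G q W X"
        using waterfilling_rate(1)[OF q W Xs[OF q]] by simp
      then have "X q = W"
        by (rule waterfilling_rate(2)[OF q W Xs[OF q]])
      then show "is_waterfilling G q X (X q)"
        using W by simp
    qed
  next
    assume "\<forall>q\<in>players G. is_waterfilling G q X (X q)"
    then show "nash_equilibrium G X"
      using X waterfilling_rate(1) by (simp add: nash_equilibrium_def)
  }
qed

lemma others_profilesD:
  assumes "X \<in> others_profiles G q"
  shows "r \<in> others q \<Longrightarrow> X r \<in> strategies G r" "psd_others q X"
  using assms strategies_psd_others[of q X] by (auto simp: others_profiles_def PiE_def)

text \<open>Waterfilling against silent opponents is feasible.\<close>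

lemma strategies_nonempty:
  assumes "q \<in> players G"
  shows "\<exists>W. W \<in> strategies G q"
proof -
  have "psd_others q (\<lambda>r. 0\<^sub>m (nT r) (nT r))"
    by (simp add: psd_others_def psd_zero)
  then show ?thesis
    using is_waterfilling_exists[OF assms] is_waterfilling_strategy by blast
qed

lemma others_profiles_nonempty: "\<exists>X. X \<in> others_profiles G q"
proof -
  have "\<forall>r\<in>others q. \<exists>W. W \<in> strategies G r"
    using strategies_nonempty by blast
  from bchoice[OF this] obtain f where "\<forall>r\<in>others q. f r \<in> strategies G r" by blast
  then have "restrict f (others q) \<in> others_profiles G q"
    by (auto simp: others_profiles_def)
  then show ?thesis by blast
qed

section \<open>Feasible projections and their gains\<close>

definition gls_gain :: "nat \<Rightarrow> nat \<Rightarrow> complex mat \<Rightarrow> real" where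
  "gls_gain q r Z = spectral_radius ((Z * H r q)\<^sup>H * (Z * H r q))"

text \<open>The unweighted and the weighted inverse share the row projector, so the product is
  \<open>Z * H q q * Z\<close>. This recovers \<open>Z\<close> from the projection
  \<open>H q q * Z\<close>.\<close>

lemma pseudo_inverse_gls:
  assumes q: "q \<in> players G" and X: "psd_others q X" and Z: "gls_inverse q X Z"
  shows "pseudo_inverse (H q q) * (H q q * Z) = Z"
    "pseudo_inverse (H q q) \<in> carrier_mat (nT q) (nR q)"
proof -
  note H = channel_carrier[OF q q]
  note P = pseudo_inverse_weighted[OF H]
  have one: "1\<^sub>m (nR q) \<in> carrier_mat (nR q) (nR q)" "hermitian_mat (1\<^sub>m (nR q))"
    by (auto simp: hermitian_mat_def)
  note R = pd_matD(1,2)[OF noise_plus_interference_pd[OF q X]]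
  note Zc = gls_inverseD[OF q X Z]
  show Pc: "pseudo_inverse (H q q) \<in> carrier_mat (nT q) (nR q)"
    by (rule weighted_pinvD(1)[OF P H one])
  have "pseudo_inverse (H q q) * (H q q * Z) = (pseudo_inverse (H q q) * H q q) * Z"
    using H Zc(1) Pc by (simp add: mat_mult_assoc)
  also have "pseudo_inverse (H q q) * H q q = Z * H q q"
    by (rule weighted_pinv_row_projector[OF H one P R Z[unfolded gls_inverse_def]])
  finally show "pseudo_inverse (H q q) * (H q q * Z) = Z"
    using Zc(3) by simp
qed

lemma projected_gain_gls:
  assumes q: "q \<in> players G" and r: "r \<in> players G" and X: "psd_others q X" and Z: "gls_inverse q X Z"
  shows "projected_gain G r q (H q q * Z) = gls_gain q r Z"
proof -
  note H = channel_carrier[OF q q] and C = channel_carrier[OF r q]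
  note Zc = gls_inverseD(1)[OF q X Z] and P = pseudo_inverse_gls[OF q X Z]
  let ?P = "pseudo_inverse (H q q)" and ?Q = "H q q * Z" and ?C = "H r q"
  have Q: "?Q \<in> carrier_mat (nR q) (nR q)" using H Zc by simp
  have "?C\<^sup>H * ?Q\<^sup>H * ?P\<^sup>H * ?P * ?Q * ?C = ?C\<^sup>H * (?P * ?Q)\<^sup>H * (?P * ?Q) * ?C"
    unfolding mat_adjoint_mult[OF P(2) Q]
    using C P(2) H Zc by (simp add: mat_mult_assoc)
  also have "\<dots> = (Z * ?C)\<^sup>H * (Z * ?C)"
    unfolding P(1) using Zc C by (simp add: mat_algebra)
  finally show ?thesis
    unfolding projected_gain_def gls_gain_def by simp
qed

text \<open>Each of \<open>H q q * Z\<close> and \<open>(H q q)\<^sup>H * Ri\<close> is a left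
  multiple of the other, so their kernels coincide; this yields the null space condition on feasible
  projections.\<close>

lemma gls_inverse_factor:
  assumes q: "q \<in> players G" and X: "psd_others q X" and Z: "gls_inverse q X Z"
  defines "Ri \<equiv> mat_inv (cov q X)"
  shows "Z = Z * cov q X * Z\<^sup>H * ((H q q)\<^sup>H * Ri)" "(H q q)\<^sup>H * Ri * (H q q * Z) = (H q q)\<^sup>H * Ri"
proof -
  let ?R = "cov q X"
  have Hc: "H q q \<in> carrier_mat (nR q) (nT q)"
    by (rule channel_carrier[OF q q])
  note pd = noise_plus_interference_pd[OF q X]
  note R = pd_matD(1,2)[OF pd] and Ri = pd_inverse[OF pd, folded Ri_def]
  note Zc = gls_inverseD[OF q X Z]
  have "Z * ?R * Z\<^sup>H * ((H q q)\<^sup>H * Ri) = Z * (?R * Z\<^sup>H * (H q q)\<^sup>H) * Ri"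
    using Hc R(1) Ri(1) Zc(1) by (simp add: mat_mult_assoc)
  also have "\<dots> = (Z * H q q * Z) * (?R * Ri)"
    unfolding Zc(4) using Hc R(1) Ri(1) Zc(1) by (simp add: mat_mult_assoc)
  finally show "Z = Z * ?R * Z\<^sup>H * ((H q q)\<^sup>H * Ri)"
    using Ri(2) Zc(1,3) by simp
  have "H q q * Z = H q q * Z * (?R * Ri)"
    using Hc Zc(1) Ri(2) by simp
  also have "\<dots> = (H q q * Z * ?R) * Ri"
    using Hc R(1) Ri(1) Zc(1) by (simp add: mat_mult_assoc)
  also have "\<dots> = ?R * (Z\<^sup>H * (H q q)\<^sup>H * Ri)"
    unfolding Zc(4)[symmetric] using Hc R(1) Ri(1) Zc(1) by (simp add: mat_mult_assoc)
  finally have "(H q q)\<^sup>H * Ri * (H q q * Z) = (H q q)\<^sup>H * Ri * (?R * (Z\<^sup>H * (H q q)\<^sup>H * Ri))"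
    by simp
  also have "\<dots> = (H q q)\<^sup>H * (Ri * ?R) * (Z\<^sup>H * (H q q)\<^sup>H * Ri)"
    using Hc R(1) Ri(1) Zc(1) by (simp add: mat_mult_assoc)
  also have "\<dots> = (H q q * Z * H q q)\<^sup>H * Ri"
    unfolding Ri(3) using Hc Ri(1) Zc(1) by (simp add: mat_algebra)
  finally show "(H q q)\<^sup>H * Ri * (H q q * Z) = (H q q)\<^sup>H * Ri"
    unfolding Zc(2) .
qed

text \<open>A projector is determined by its range and its kernel, and \<open>H q q * Z\<close> has
  the prescribed ones. The feasible set is thereby parametrized by the profiles alone.\<close>

lemma projection_feasible_iff:
  assumes q: "q \<in> players G"
  shows "projection_feasible G q (P, X) \<longleftrightarrow>
    X \<in> others_profiles G q \<and> (\<exists>Z. gls_inverse q X Z \<and> P = H q q * Z)"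
    (is "?feas \<longleftrightarrow> ?gls")
proof
  let ?H = "H q q" and ?Ri = "mat_inv (cov q X)"
  let ?m = "nR q" and ?n = "nT q"
  note H = channel_carrier[OF q q]
  {
    assume feas: ?feas
    then have P: "P \<in> carrier_mat ?m ?m" "P = P * P" "mat_range P = mat_range ?H"
      "mat_kernel P = mat_kernel (?H\<^sup>H * ?Ri)" and Xo: "X \<in> others_profiles G q"
      by (auto simp: projection_feasible_def)
    note X = others_profilesD(2)[OF Xo]
    obtain Z where Z: "gls_inverse q X Z"
      using gls_inverse_exists[OF q X] by blast
    note Zc = gls_inverseD[OF q X Z] and Zf = gls_inverse_factor[OF q X Z]
    have Ri: "?Ri \<in> carrier_mat ?m ?m"
      by (rule pd_inverse(1)[OF noise_plus_interference_pd[OF q X]])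
    have R: "cov q X \<in> carrier_mat ?m ?m"
      by (rule pd_matD(1)[OF noise_plus_interference_pd[OF q X]])
    have "P = ?H * Z"
    proof (rule eq_mat_on_vecI[OF P(1)])
      show "?H * Z \<in> carrier_mat ?m ?m" using H Zc(1) by simp
      fix v :: "complex vec" assume v: "v \<in> carrier_vec ?m"
      have Pv: "P *\<^sub>v v \<in> carrier_vec ?m" using P(1) v by simp
      have "P *\<^sub>v v \<in> mat_range P"
        unfolding mat_range_def using P(1) v by auto
      then have "P *\<^sub>v v \<in> mat_range ?H"
        unfolding P(3) .
      then obtain x where x: "x \<in> carrier_vec ?n" "P *\<^sub>v v = ?H *\<^sub>v x"
        using H by (auto simp: mat_range_def)
      \<comment> \<open>\<open>H q q * Z\<close> fixes the range of \<open>H q q\<close>, and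
        \<open>P *\<^sub>v v\<close> lies in it.\<close>
      have HZPv: "(?H * Z) *\<^sub>v (P *\<^sub>v v) = P *\<^sub>v v"
      proof -
        have "(?H * Z) *\<^sub>v (?H *\<^sub>v x) = (?H * Z * ?H) *\<^sub>v x"
          using H Zc(1) x(1) by (intro assoc_mult_mat_vec[symmetric, of _ ?m ?m _ ?n]) auto
        then show ?thesis
          unfolding x(2) Zc(2) .
      qed
      have "P *\<^sub>v (v - P *\<^sub>v v) = P *\<^sub>v v - P *\<^sub>v (P *\<^sub>v v)"
        using P(1) v Pv by (intro mult_minus_distrib_mat_vec)
      also have "P *\<^sub>v (P *\<^sub>v v) = (P * P) *\<^sub>v v"
        using P(1) v by (intro assoc_mult_mat_vec[symmetric])
      also have "P *\<^sub>v v - (P * P) *\<^sub>v v = 0\<^sub>v ?m"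
        using Pv by (simp add: P(2)[symmetric])
      \<comment> \<open>The remaining part of \<open>v\<close> lies in the kernel of
        \<open>P\<close>, hence in that of \<open>?H\<^sup>H * ?Ri\<close>, and \<open>Z\<close>
        kills it because \<open>Z\<close> is a left multiple of that matrix.\<close>
      finally have "v - P *\<^sub>v v \<in> mat_kernel P"
        using P(1) v Pv by (intro mat_kernelI) auto
      then have "(?H\<^sup>H * ?Ri) *\<^sub>v (v - P *\<^sub>v v) = 0\<^sub>v ?n"
        unfolding P(4) using H Ri mat_kernelD(2)[of "?H\<^sup>H * ?Ri" ?n ?m] by auto
      then have "(Z * cov q X * Z\<^sup>H) *\<^sub>v ((?H\<^sup>H * ?Ri) *\<^sub>v (v - P *\<^sub>v v)) = 0\<^sub>v ?n"
        using Zc(1) R by (auto simp: scalar_prod_def intro!: eq_vecI)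
      moreover have "(Z * cov q X * Z\<^sup>H) *\<^sub>v ((?H\<^sup>H * ?Ri) *\<^sub>v (v - P *\<^sub>v v))
          = (Z * cov q X * Z\<^sup>H * (?H\<^sup>H * ?Ri)) *\<^sub>v (v - P *\<^sub>v v)"
        using Zc(1) H R Ri v Pv by (intro assoc_mult_mat_vec[symmetric, of _ ?n ?n _ ?m]) auto
      ultimately have Z0: "Z *\<^sub>v (v - P *\<^sub>v v) = 0\<^sub>v ?n"
        by (simp only: Zf(1)[symmetric])
      have "(?H * Z) *\<^sub>v v - (?H * Z) *\<^sub>v (P *\<^sub>v v) = (?H * Z) *\<^sub>v (v - P *\<^sub>v v)"
        using H Zc(1) v Pv by (intro mult_minus_distrib_mat_vec[symmetric, of _ ?m ?m]) auto
      also have "\<dots> = ?H *\<^sub>v (Z *\<^sub>v (v - P *\<^sub>v v))"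
        using H Zc(1) v Pv by (intro assoc_mult_mat_vec) auto
      also have "\<dots> = 0\<^sub>v ?m"
        unfolding Z0 using H by (auto simp: scalar_prod_def intro!: eq_vecI)
      finally have diff: "(?H * Z) *\<^sub>v v - P *\<^sub>v v = 0\<^sub>v ?m"
        unfolding HZPv .
      show "P *\<^sub>v v = (?H * Z) *\<^sub>v v"
      proof (rule eq_vecI)
        fix i assume "i < dim_vec ((?H * Z) *\<^sub>v v)"
        then have i: "i < ?m" using H by simp
        have "((?H * Z) *\<^sub>v v - P *\<^sub>v v) $ i = 0" using i by (simp add: diff)
        then show "(P *\<^sub>v v) $ i = ((?H * Z) *\<^sub>v v) $ i"
          using P(1) i by (simp del: index_mult_mat_vec)
      qed (use P(1) H in auto)
    qed
    then show ?gls using Xo Z by blast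
  next
    assume ?gls
    then obtain Z where Xo: "X \<in> others_profiles G q" and Z: "gls_inverse q X Z" and P: "P = ?H * Z"
      by blast
    note X = others_profilesD(2)[OF Xo]
    note Zc = gls_inverseD[OF q X Z] and Zf = gls_inverse_factor[OF q X Z]
    have Ri: "?Ri \<in> carrier_mat ?m ?m"
      by (rule pd_inverse(1)[OF noise_plus_interference_pd[OF q X]])
    have R: "cov q X \<in> carrier_mat ?m ?m"
      by (rule pd_matD(1)[OF noise_plus_interference_pd[OF q X]])
    have HZ: "?H * Z \<in> carrier_mat ?m ?m" using H Zc(1) by simp
    have idem: "?H * Z = (?H * Z) * (?H * Z)"
    proof -
      have "(?H * Z) * (?H * Z) = (?H * Z * ?H) * Z"
        using H Zc(1) by (simp add: mat_mult_assoc)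
      then show ?thesis unfolding Zc(2) by simp
    qed
    have range: "mat_range (?H * Z) = mat_range ?H"
    proof
      show "mat_range (?H * Z) \<subseteq> mat_range ?H"
      proof
        fix y assume "y \<in> mat_range (?H * Z)"
        then obtain v where v: "v \<in> carrier_vec ?m" "y = (?H * Z) *\<^sub>v v"
          using HZ by (auto simp: mat_range_def)
        then have "y = ?H *\<^sub>v (Z *\<^sub>v v)"
          using H Zc(1) by simp
        then show "y \<in> mat_range ?H"
          unfolding mat_range_def using H Zc(1) v(1) by auto
      qed
      show "mat_range ?H \<subseteq> mat_range (?H * Z)"
      proof
        fix y assume "y \<in> mat_range ?H"
        then obtain x where x: "x \<in> carrier_vec ?n" "y = ?H *\<^sub>v x"
          using H by (auto simp: mat_range_def)
        have "y = (?H * Z * ?H) *\<^sub>v x"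
          unfolding Zc(2) by (rule x(2))
        also have "\<dots> = (?H * Z) *\<^sub>v (?H *\<^sub>v x)"
          using H HZ x by (intro assoc_mult_mat_vec) auto
        finally show "y \<in> mat_range (?H * Z)"
          unfolding mat_range_def using H HZ x(1) by auto
      qed
    qed
    have K: "?H\<^sup>H * ?Ri \<in> carrier_mat ?n ?m" using H Ri by simp
    have kernel: "mat_kernel (?H * Z) = mat_kernel (?H\<^sup>H * ?Ri)"
    proof
      show "mat_kernel (?H * Z) \<subseteq> mat_kernel (?H\<^sup>H * ?Ri)"
        using mat_kernel_mult_subset[OF HZ K] unfolding Zf(2) .
      have M: "?H * (Z * cov q X * Z\<^sup>H) \<in> carrier_mat ?m ?n"
        using H Zc(1) R by simp
      have "?H * (Z * cov q X * Z\<^sup>H) * (?H\<^sup>H * ?Ri)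
          = ?H * (Z * cov q X * Z\<^sup>H * (?H\<^sup>H * ?Ri))"
        using H Zc(1) R Ri by (intro mat_mult_assoc) auto
      then have "?H * (Z * cov q X * Z\<^sup>H) * (?H\<^sup>H * ?Ri) = ?H * Z"
        by (simp only: Zf(1)[symmetric])
      then show "mat_kernel (?H\<^sup>H * ?Ri) \<subseteq> mat_kernel (?H * Z)"
        using mat_kernel_mult_subset[OF K M] by simp
    qed
    show ?feas
      unfolding projection_feasible_def P using HZ Xo idem range kernel by simp
  }
qed

section \<open>Continuity, compactness and the optimal projection\<close>

lemma frobenius_interference_le:
  assumes "q \<in> players G" "r \<in> players G" "Y \<in> carrier_mat (nT r) (nT r)"
  shows "frob_norm (interference q r Y)
    \<le> frob_norm (H r q) * frob_norm Y * frob_norm (H r q)"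
proof -
  note C = channel_carrier[OF assms(2,1)]
  have "frob_norm (interference q r Y) \<le> frob_norm (H r q * Y) * frob_norm ((H r q)\<^sup>H)"
    unfolding interference_def using C assms(3) by (intro frob_norm_mult) auto
  also have "\<dots> \<le> frob_norm (H r q) * frob_norm Y * frob_norm (H r q)"
    using C assms(3) by (simp add: frob_norm_mult mult_right_mono)
  finally show ?thesis .
qed

lemma noise_plus_interference_continuous:
  assumes q: "q \<in> players G" and X: "\<And>n. psd_others q (X n)" and Y: "psd_others q Y"
    and lim: "\<And>r. r \<in> others q \<Longrightarrow> (\<lambda>n. frob_norm (X n r - Y r)) \<longlonglongrightarrow> 0"
  shows "(\<lambda>n. frob_norm (cov q Y - cov q (X n))) \<longlonglongrightarrow> 0"
proof -
  let ?m = "nR q" and ?P = "others q"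
  have c: "X n r \<in> carrier_mat (nT r) (nT r)" "Y r \<in> carrier_mat (nT r) (nT r)"
    if "r \<in> ?P" for r n
    using X[of n] Y that by (auto simp: psd_others_def psd_mat_def)
  let ?u = "\<lambda>n. \<Sum>r\<in>?P. frob_norm (H r q) * frob_norm (X n r - Y r) * frob_norm (H r q)"
  have le: "frob_norm (cov q Y - cov q (X n)) \<le> ?u n" for n
  proof -
    have ic: "interference q r (Y r - X n r) \<in> carrier_mat ?m ?m" if "r \<in> ?P" for r
      using c[OF that] q that by (intro interference_carrier minus_carrier_mat) auto
    \<comment> \<open>Identity factors are inserted so that the sandwiched sum estimate
      applies.\<close>
    have "frob_norm (cov q Y - cov q (X n))
        = frob_norm (1\<^sub>m ?m * mat_sum ?m ?P (\<lambda>r. interference q r (Y r - X n r)) * 1\<^sub>m ?m)"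
      unfolding noise_plus_interference_diff[OF q Y X]
      by (simp add: left_mult_one_mat[of _ ?m ?m] right_mult_one_mat[of _ ?m ?m])
    also have "\<dots> \<le> (\<Sum>r\<in>?P. frob_norm (1\<^sub>m ?m * interference q r (Y r - X n r) * 1\<^sub>m ?m))"
      by (rule frob_norm_mat_sum_sandwich) (use ic in auto)
    also have "\<dots> \<le> ?u n"
    proof (rule sum_mono)
      fix r assume r: "r \<in> ?P"
      have "frob_norm (interference q r (Y r - X n r))
          \<le> frob_norm (H r q) * frob_norm (Y r - X n r) * frob_norm (H r q)"
        using c[OF r] q r by (intro frobenius_interference_le minus_carrier_mat) auto
      then show "frob_norm (1\<^sub>m ?m * interference q r (Y r - X n r) * 1\<^sub>m ?m)
          \<le> frob_norm (H r q) * frob_norm (X n r - Y r) * frob_norm (H r q)"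
        using ic[OF r] frob_norm_minus_commute[OF c(1)[OF r, of n] c(2)[OF r]]
        by (simp add: left_mult_one_mat[OF ic[OF r]] right_mult_one_mat[OF ic[OF r]])
    qed
    finally show ?thesis .
  qed
  have "?u \<longlonglongrightarrow> (\<Sum>r\<in>?P. frob_norm (H r q) * 0 * frob_norm (H r q))"
    by (intro tendsto_intros lim) auto
  then have u: "?u \<longlonglongrightarrow> 0" by simp
  show ?thesis
  proof (rule tendsto_sandwich[OF _ _ tendsto_const u])
    show "\<forall>\<^sub>F n in sequentially. 0 \<le> frob_norm (cov q Y - cov q (X n))"
      by (intro always_eventually allI frob_norm_nonneg)
    show "\<forall>\<^sub>F n in sequentially. frob_norm (cov q Y - cov q (X n)) \<le> ?u n"
      by (intro always_eventually allI le)
  qed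
qed

text \<open>The exact difference formula, freed of the invertible \<open>?S\<close>, expresses the
  error as \<open>ZX n\<close> times a vanishing factor times the fixed \<open>K\<close>. No bound
  on \<open>ZX n\<close> is available beforehand, so it is estimated by the limit plus the error
  itself and the error is absorbed.\<close>

lemma gls_inverse_continuous:
  assumes q: "q \<in> players G" and X: "\<And>n. psd_others q (X n)" and Y: "psd_others q Y"
    and lim: "\<And>r. r \<in> others q \<Longrightarrow> (\<lambda>n. frob_norm (X n r - Y r)) \<longlonglongrightarrow> 0"
    and ZX: "\<And>n. gls_inverse q (X n) (ZX n)" and Z: "gls_inverse q Y Z"
  shows "(\<lambda>n. frob_norm (ZX n - Z)) \<longlonglongrightarrow> 0"
proof -
  let ?m = "nR q" and ?n = "nT q" and ?H = "H q q"
  let ?S = "cov q Y" and ?R = "\<lambda>n. cov q (X n)"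
  note H = channel_carrier[OF q q]
  note pd = noise_plus_interference_pd[OF q Y]
  note S = pd_matD(1,2)[OF pd] and Si = pd_inverse[OF pd]
  note R = pd_matD(1,2)[OF noise_plus_interference_pd[OF q X]]
  note Zc = gls_inverseD(1)[OF q Y Z] and ZXc = gls_inverseD(1)[OF q X ZX]
  define K where "K = (1\<^sub>m ?m - ?H * Z)\<^sup>H * mat_inv ?S"
  have Q: "(1\<^sub>m ?m - ?H * Z)\<^sup>H \<in> carrier_mat ?m ?m"
    unfolding mat_adjoint_carrier using H Zc by (intro minus_carrier_mat) auto
  have K: "K \<in> carrier_mat ?m ?m"
    unfolding K_def using Q Si(1) by (rule mult_carrier_mat)
  have diff: "ZX n - Z = ZX n * (?S - ?R n) * K" for n
  proof -
    have SR: "?S - ?R n \<in> carrier_mat ?m ?m"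
      by (rule minus_carrier_mat[OF R(1)])
    have ZZ: "ZX n - Z \<in> carrier_mat ?n ?m"
      by (rule minus_carrier_mat[OF Zc])
    have "ZX n - Z = (ZX n - Z) * (?S * mat_inv ?S)"
      unfolding Si(2) by (rule right_mult_one_mat[OF ZZ, symmetric])
    also have "\<dots> = (ZX n - Z) * ?S * mat_inv ?S"
      by (rule assoc_mult_mat[OF ZZ S(1) Si(1), symmetric])
    also have "(ZX n - Z) * ?S = ZX n * (?S - ?R n) * (1\<^sub>m ?m - ?H * Z)\<^sup>H"
      by (rule weighted_pinv_diff[OF H R ZX[unfolded gls_inverse_def] S Z[unfolded gls_inverse_def]])
    also have "ZX n * (?S - ?R n) * (1\<^sub>m ?m - ?H * Z)\<^sup>H * mat_inv ?S = ZX n * (?S - ?R n) * K"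
      unfolding K_def using ZXc SR Q Si(1) by (intro assoc_mult_mat[of _ ?n ?m _ ?m _ ?m] mult_carrier_mat)
    finally show ?thesis .
  qed
  let ?a = "\<lambda>n. frob_norm (?S - ?R n) * frob_norm K"
  show ?thesis
  proof (rule tendsto_0_of_relative_bound[where z = "frob_norm Z" and a = ?a])
    show "frob_norm (ZX n - Z) \<le> (frob_norm Z + frob_norm (ZX n - Z)) * ?a n" for n
    proof -
      have SR: "?S - ?R n \<in> carrier_mat ?m ?m"
        by (rule minus_carrier_mat[OF R(1)])
      have "frob_norm (ZX n - Z) \<le> frob_norm (ZX n * (?S - ?R n)) * frob_norm K"
        by (subst diff) (rule frob_norm_mult[OF mult_carrier_mat[OF ZXc SR] K])
      also have "\<dots> \<le> frob_norm (ZX n) * frob_norm (?S - ?R n) * frob_norm K"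
        by (intro mult_right_mono frob_norm_mult[OF ZXc SR]) simp
      also have "\<dots> = frob_norm (ZX n) * ?a n"
        by (simp add: mult.assoc)
      also have "frob_norm (ZX n) \<le> frob_norm Z + frob_norm (ZX n - Z)"
      proof -
        have "ZX n = Z + (ZX n - Z)"
          using Zc ZXc[of n] by (intro eq_matI) auto
        then show ?thesis
          using frob_norm_triangle[OF Zc minus_carrier_mat[OF Zc, of "ZX n"]] by simp
      qed
      then have "frob_norm (ZX n) * ?a n \<le> (frob_norm Z + frob_norm (ZX n - Z)) * ?a n"
        by (intro mult_right_mono) auto
      finally show ?thesis .
    qed
    have "(\<lambda>n. frob_norm (?S - ?R n) * frob_norm K) \<longlonglongrightarrow> 0 * frob_norm K"
      by (intro tendsto_intros noise_plus_interference_continuous[OF q X Y lim])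
    then show "?a \<longlonglongrightarrow> 0" by simp
  qed auto
qed

text \<open>The square root of the gain is the operator norm of \<open>Z * H r q\<close>, which is
  Lipschitz in \<open>Z\<close>; squaring recovers the gain.\<close>

lemma gls_gain_continuous:
  assumes q: "q \<in> players G" and r: "r \<in> players G"
    and ZX: "\<And>n. ZX n \<in> carrier_mat (nT q) (nR q)" and Z: "Z \<in> carrier_mat (nT q) (nR q)"
    and lim: "(\<lambda>n. frob_norm (ZX n - Z)) \<longlonglongrightarrow> 0"
  shows "(\<lambda>n. gls_gain q r (ZX n)) \<longlonglongrightarrow> gls_gain q r Z"
proof -
  let ?C = "H r q"
  note C = channel_carrier[OF r q] and pos = tx_dim_pos[OF r]
  have c: "ZX n * ?C \<in> carrier_mat (nT q) (nT r)" "Z * ?C \<in> carrier_mat (nT q) (nT r)" for n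
    by (rule mult_carrier_mat[OF ZX C], rule mult_carrier_mat[OF Z C])
  have d: "frob_norm (ZX n * ?C - Z * ?C) \<le> frob_norm (ZX n - Z) * frob_norm ?C" for n
    using frob_norm_mult[OF minus_carrier_mat[OF Z] C, of "ZX n"] minus_mult_distrib_mat[OF ZX[of n] Z C] by simp
  have le: "\<bar>sqrt (gls_gain q r (ZX n)) - sqrt (gls_gain q r Z)\<bar> \<le> frob_norm (ZX n - Z) * frob_norm ?C" for n
    using sqrt_spectral_radius_gram_le[OF c(1)[of n] c(2) pos] sqrt_spectral_radius_gram_le[OF c(2) c(1)[of n] pos]
      d[of n] frob_norm_minus_commute[OF c(1)[of n] c(2)]
    unfolding gls_gain_def by linarith
  have "(\<lambda>n. frob_norm (ZX n - Z) * frob_norm ?C) \<longlonglongrightarrow> 0 * frob_norm ?C"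
    by (intro tendsto_intros lim)
  then have "(\<lambda>n. frob_norm (ZX n - Z) * frob_norm ?C) \<longlonglongrightarrow> 0" by simp
  then have "(\<lambda>n. sqrt (gls_gain q r (ZX n)) - sqrt (gls_gain q r Z)) \<longlonglongrightarrow> 0"
    by (rule tendsto_0_le[where K = 1]) (use le in \<open>auto intro!: always_eventually\<close>)
  then have "(\<lambda>n. sqrt (gls_gain q r (ZX n))) \<longlonglongrightarrow> sqrt (gls_gain q r Z)"
    by (simp add: LIM_zero_iff)
  then have "(\<lambda>n. (sqrt (gls_gain q r (ZX n)))\<^sup>2) \<longlonglongrightarrow> (sqrt (gls_gain q r Z))\<^sup>2"
    by (rule tendsto_power)
  moreover have "0 \<le> gls_gain q r (ZX n)" "0 \<le> gls_gain q r Z" for n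
    unfolding gls_gain_def using spectral_radius_gram_nonneg c pos by blast+
  ultimately show ?thesis by simp
qed

lemma strategies_closed:
  assumes X: "\<And>n. X n \<in> strategies G q" and Y: "Y \<in> carrier_mat (nT q) (nT q)"
    and lim: "\<And>i j. i < nT q \<Longrightarrow> j < nT q \<Longrightarrow> (\<lambda>n. X n $$ (i, j)) \<longlonglongrightarrow> Y $$ (i, j)"
  shows "Y \<in> strategies G q"
proof -
  have "psd_mat (nT q) Y"
    by (rule psd_limit[OF strategiesD(1)[OF X] Y lim])
  moreover have "mat_trace Y = complex_of_real (power G q)"
  proof -
    have "(\<lambda>n. \<Sum>i<nT q. X n $$ (i, i)) \<longlonglongrightarrow> (\<Sum>i<nT q. Y $$ (i, i))"
      by (intro tendsto_intros lim) auto
    moreover have "(\<Sum>i<nT q. X n $$ (i, i)) = complex_of_real (power G q)" for n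
      using strategiesD(2,3)[OF X[of n]] by (simp add: mat_trace_def)
    ultimately have "(\<lambda>n :: nat. complex_of_real (power G q)) \<longlonglongrightarrow> (\<Sum>i<nT q. Y $$ (i, i))"
      by simp
    then show ?thesis
      using Y LIMSEQ_unique[OF _ tendsto_const] by (auto simp: mat_trace_def)
  qed
  ultimately show ?thesis by (simp add: strategies_def)
qed

text \<open>Bolzano-Weierstrass in finitely many coordinates: a profile is described by entries
  indexed by player, row and column, each bounded by the power of its player.\<close>

lemma others_profiles_sequentially_compact:
  assumes X: "\<And>n. X n \<in> others_profiles G q"
  shows "\<exists>s Y. strict_mono (s :: nat \<Rightarrow> nat) \<and> Y \<in> others_profiles G q \<and>
    (\<forall>r\<in>others q. (\<lambda>n. frob_norm (X (s n) r - Y r)) \<longlonglongrightarrow> 0)"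
proof -
  let ?P = "others q"
  define I where "I = (SIGMA r:?P. {..<nT r} \<times> {..<nT r})"
  have "finite I" unfolding I_def by auto
  have Xs: "psd_mat (nT r) (X n r)" "mat_trace (X n r) = complex_of_real (power G r)"
    "X n r \<in> carrier_mat (nT r) (nT r)" if "r \<in> ?P" for n r
    using strategiesD[OF others_profilesD(1)[OF X that]] by blast+
  have "\<exists>s l. strict_mono (s :: nat \<Rightarrow> nat) \<and> (\<forall>i\<in>I. (\<lambda>n. X (s n) (fst i) $$ snd i) \<longlonglongrightarrow> l i)"
  proof (rule simultaneous_convergent_subsequence[OF \<open>finite I\<close>])
    fix i n assume "i \<in> I"
    then obtain r a b where i: "i = (r, a, b)" "r \<in> ?P" "a < nT r" "b < nT r"
      by (auto simp: I_def)
    show "cmod (X n (fst i) $$ snd i) \<le> power G (fst i)"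
      using psd_norm_entry_le_trace[OF Xs(1)[OF i(2)] i(3,4), of n] Xs(2)[OF i(2), of n] i(1) by simp
  qed
  then obtain s l where s: "strict_mono (s :: nat \<Rightarrow> nat)"
    and l: "\<And>i. i \<in> I \<Longrightarrow> (\<lambda>n. X (s n) (fst i) $$ snd i) \<longlonglongrightarrow> l i" by blast
  \<comment> \<open>Restricted to the other players, since profiles are extensional
    functions.\<close>
  define Y where "Y = (\<lambda>r\<in>?P. mat (nT r) (nT r) (\<lambda>(a, b). l (r, a, b)))"
  have Yr: "Y r = mat (nT r) (nT r) (\<lambda>(a, b). l (r, a, b))"
    "Y r \<in> carrier_mat (nT r) (nT r)" if "r \<in> ?P" for r
    using that by (auto simp: Y_def)
  have lim: "(\<lambda>n. X (s n) r $$ (a, b)) \<longlonglongrightarrow> Y r $$ (a, b)" if "r \<in> ?P" "a < nT r" "b < nT r" for r a b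
    using l[of "(r, a, b)"] that by (simp add: Yr(1)[OF that(1)] I_def)
  have "Y r \<in> strategies G r" if r: "r \<in> ?P" for r
    by (rule strategies_closed[OF others_profilesD(1)[OF X r] Yr(2)[OF r] lim[OF r]])
  then have "Y \<in> others_profiles G q"
    unfolding others_profiles_def by (auto simp: Y_def)
  moreover have "(\<lambda>n. frob_norm (X (s n) r - Y r)) \<longlonglongrightarrow> 0" if r: "r \<in> ?P" for r
    using Xs(3)[OF r] Yr(2)[OF r] lim[OF r] by (rule frob_norm_diff_tendsto_0)
  ultimately show ?thesis using s by blast
qed

text \<open>\<open>arg_max\<close> picks a maximizer only if there is one. Compactness is used on
  the profiles; the matching projections follow along, because \<open>Z\<close> depends continuously
  on the profile.\<close>

lemma optimal_projection_maximal:
  assumes q: "q \<in> players G" and r: "r \<in> players G" and feas: "projection_feasible G q (P, X)"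
  shows "projected_gain G r q P \<le> projected_gain G r q (optimal_projection G r q)"
proof -
  let ?f = "\<lambda>(P, X :: nat \<Rightarrow> complex mat). projected_gain G r q P"
  let ?K = "Collect (projection_feasible G q)"
  have "\<exists>y\<in>?K. \<forall>x\<in>?K. ?f x \<le> ?f y"
  proof (rule sequentially_compact_attains_max)
    show "?K \<noteq> {}" using feas by blast
    fix x :: "nat \<Rightarrow> complex mat \<times> (nat \<Rightarrow> complex mat)" assume x: "\<And>n. x n \<in> ?K"
    have "\<forall>n. \<exists>Z. snd (x n) \<in> others_profiles G q \<and> gls_inverse q (snd (x n)) Z \<and> fst (x n) = H q q * Z"
      using x projection_feasible_iff[OF q, of "fst (x n)" "snd (x n)" for n] by simp
    from choice[OF this] obtain ZX where xX: "\<And>n. snd (x n) \<in> others_profiles G q"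
      and ZX: "\<And>n. gls_inverse q (snd (x n)) (ZX n)" "\<And>n. fst (x n) = H q q * ZX n" by blast
    obtain s Y where s: "strict_mono (s :: nat \<Rightarrow> nat)" and Y: "Y \<in> others_profiles G q"
      and lim: "\<And>r. r \<in> others q \<Longrightarrow> (\<lambda>n. frob_norm (snd (x (s n)) r - Y r)) \<longlonglongrightarrow> 0"
      using others_profiles_sequentially_compact[of "\<lambda>n. snd (x n)", OF xX] by blast
    note Yp = others_profilesD(2)[OF Y] and Xp = others_profilesD(2)[OF xX]
    obtain Z where Z: "gls_inverse q Y Z" using gls_inverse_exists[OF q Yp] by blast
    have "(\<lambda>n. frob_norm (ZX (s n) - Z)) \<longlonglongrightarrow> 0"
      by (rule gls_inverse_continuous[OF q Xp Yp lim ZX(1) Z])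
    then have "(\<lambda>n. gls_gain q r (ZX (s n))) \<longlonglongrightarrow> gls_gain q r Z"
      by (intro gls_gain_continuous[OF q r] gls_inverseD(1)[OF q Xp ZX(1)] gls_inverseD(1)[OF q Yp Z])
    moreover have "?f (x n) = gls_gain q r (ZX n)" for n
      using projected_gain_gls[OF q r Xp ZX(1), of n] ZX(2)[of n] by (simp add: case_prod_beta)
    moreover have "?f (H q q * Z, Y) = gls_gain q r Z"
      using projected_gain_gls[OF q r Yp Z] by simp
    moreover have "(H q q * Z, Y) \<in> ?K"
      using projection_feasible_iff[OF q] Y Z by auto
    ultimately show "\<exists>s y. strict_mono (s :: nat \<Rightarrow> nat) \<and> y \<in> ?K \<and> (\<lambda>n. ?f (x (s n))) \<longlonglongrightarrow> ?f y"
      using s by (intro exI[of _ s] exI[of _ "(H q q * Z, Y)"]) simp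
  qed
  then obtain y where "is_arg_max ?f (projection_feasible G q) y"
    by (force simp: is_arg_max_linorder)
  \<comment> \<open>Existence of a maximizer makes the choice behind \<open>arg_max\<close>
    meaningful.\<close>
  then have "is_arg_max ?f (projection_feasible G q) (arg_max ?f (projection_feasible G q))"
    unfolding arg_max_def by (rule someI)
  then have "?f (P, X) \<le> ?f (arg_max ?f (projection_feasible G q))"
    using feas by (simp only: is_arg_max_linorder)
  then show ?thesis
    by (simp add: optimal_projection_def case_prod_beta)
qed

section \<open>Contraction of the waterfilling map\<close>

lemma gls_gain_le_interference_coeff:
  assumes q: "q \<in> players G" and r: "r \<in> others q"
    and X: "\<And>s. s \<in> others q \<Longrightarrow> X s \<in> strategies G s" and Z: "gls_inverse q X Z"
  shows "gls_gain q r Z \<le> coeff q r"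
proof -
  have r': "r \<in> players G" "r \<noteq> q" using r by auto
  \<comment> \<open>Restriction makes the profile extensional, as feasibility requires; the
    covariance does not see the other components.\<close>
  define X' where "X' = restrict X (others q)"
  have X'o: "X' \<in> others_profiles G q"
    using X by (auto simp: X'_def others_profiles_def)
  note X'p = others_profilesD(2)[OF X'o]
  have "cov q X' = cov q X"
    unfolding noise_plus_interference_eq mat_sum_def by (simp add: X'_def)
  then have Z': "gls_inverse q X' Z"
    using Z by (simp add: gls_inverse_def)
  show ?thesis
  proof (cases "rk q = nR q")
    case True
    obtain Z2 where "gls_inverse q X' Z2" "H q q * Z2 = 1\<^sub>m (nR q)"
      using gls_inverse_exists[OF q X'p] True by metis
    \<comment> \<open>With full row rank the projection is the identity, so \<open>Z\<close> is the
      pseudo-inverse and the gain equals the coefficient.\<close>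
    then have HZ: "H q q * Z = 1\<^sub>m (nR q)"
      using gls_inverse_unique[OF q X'p Z'] by blast
    note ps = pseudo_inverse_gls[OF q X'p Z']
    have "pseudo_inverse (H q q) = Z"
      using ps HZ by simp
    then have "coeff q r
        = spectral_radius ((H r q)\<^sup>H * Z\<^sup>H * Z * H r q)"
      using True r' by (simp add: interference_coeff_def)
    also have "(H r q)\<^sup>H * Z\<^sup>H * Z * H r q = (Z * H r q)\<^sup>H * (Z * H r q)"
      using gls_inverseD(1)[OF q X'p Z'] channel_carrier[OF r'(1) q] by (simp add: mat_algebra)
    finally show ?thesis by (simp add: gls_gain_def)
  next
    case False
    have "projection_feasible G q (H q q * Z, X')"
      using projection_feasible_iff[OF q] X'o Z' by blast
    from optimal_projection_maximal[OF q r'(1) this]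
    show ?thesis
      using False r' projected_gain_gls[OF q r'(1) X'p Z'] by (simp add: interference_coeff_def)
  qed
qed

lemma interference_coeff_nonneg:
  assumes q: "q \<in> players G" and r: "r \<in> players G"
  shows "0 \<le> coeff q r"
proof (cases "r = q")
  case False
  obtain X where X: "X \<in> others_profiles G q" using others_profiles_nonempty by blast
  note Xp = others_profilesD[OF X]
  obtain Z where Z: "gls_inverse q X Z" using gls_inverse_exists[OF q Xp(2)] by blast
  have "0 \<le> gls_gain q r Z"
    unfolding gls_gain_def
    by (rule spectral_radius_gram_nonneg[OF mult_carrier_mat[OF gls_inverseD(1)[OF q Xp(2) Z] channel_carrier[OF r q]] tx_dim_pos[OF r]])
  also have "\<dots> \<le> coeff q r"
    using False r by (intro gls_gain_le_interference_coeff[OF q _ Xp(1) Z]) auto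
  finally show ?thesis .
qed (simp add: interference_coeff_def)

text \<open>Each player's term is the change of \<open>X r\<close> between \<open>Z * H r q\<close>
  and the adjoint of \<open>Z' * H r q\<close>. Both gains lie below the same coefficient, so the
  two-sided Frobenius estimate applies although \<open>Z\<close> and \<open>Z'\<close> belong to
  different profiles.\<close>

theorem waterfilling_contraction:
  assumes q: "q \<in> players G"
    and X: "\<And>r. r \<in> others q \<Longrightarrow> X r \<in> strategies G r"
    and Y: "\<And>r. r \<in> others q \<Longrightarrow> Y r \<in> strategies G r"
    and W: "is_waterfilling G q X W" and V: "is_waterfilling G q Y V"
  shows "frob_norm (W - V) \<le> (\<Sum>r\<in>others q. coeff q r * frob_norm (X r - Y r))"
proof -
  let ?P = "others q" and ?m = "nR q"
  have Xp: "psd_others q X" and Yp: "psd_others q Y"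
    using strategies_psd_others X Y by blast+
  obtain Z where Z: "gls_inverse q X Z" using gls_inverse_exists[OF q Xp] by blast
  obtain Z' where Z': "gls_inverse q Y Z'" using gls_inverse_exists[OF q Yp] by blast
  note Zc = gls_inverseD(1)[OF q Xp Z] and Zc' = gls_inverseD(1)[OF q Yp Z']
  have XY: "X r - Y r \<in> carrier_mat (nT r) (nT r)" if "r \<in> ?P" for r
    by (rule minus_carrier_mat[OF strategiesD(3)[OF Y[OF that]]])
  have "frob_norm (W - V) \<le> frob_norm
      (Z * mat_sum ?m ?P (\<lambda>r. interference q r (X r - Y r)) * Z'\<^sup>H)"
    using waterfilling_diff_le[OF q Xp Yp W V Z Z'] unfolding noise_plus_interference_diff[OF q Xp Yp] .
  also have "\<dots> \<le> (\<Sum>r\<in>?P. frob_norm (Z * interference q r (X r - Y r) * Z'\<^sup>H))"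
    using XY q Zc Zc' by (intro frob_norm_mat_sum_sandwich interference_carrier) auto
  also have "\<dots> \<le> (\<Sum>r\<in>?P. coeff q r * frob_norm (X r - Y r))"
  proof (rule sum_mono)
    fix r assume r: "r \<in> ?P"
    then have r': "r \<in> players G" by simp
    note C = channel_carrier[OF r' q]
    have "Z * interference q r (X r - Y r) * Z'\<^sup>H
        = (Z * H r q) * (X r - Y r) * (Z' * H r q)\<^sup>H"
      unfolding interference_def using Zc Zc' C XY[OF r] carrier_matD[OF XY[OF r]]
      by (simp add: mat_algebra del: index_minus_mat)
    then show "frob_norm (Z * interference q r (X r - Y r) * Z'\<^sup>H)
        \<le> coeff q r * frob_norm (X r - Y r)"
      using frob_norm_two_sided[OF mult_carrier_mat[OF Zc C] mult_carrier_mat[OF Zc' C] XY[OF r] tx_dim_pos[OF r']]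
        gls_gain_le_interference_coeff[OF q r X Z] gls_gain_le_interference_coeff[OF q r Y Z']
      unfolding gls_gain_def by simp
  qed
  finally show ?thesis .
qed

lemma contraction_weights_exist:
  assumes small_interference: "spectral_radius (interference_matrix G) < 1"
  shows
  "\<exists>w \<beta>. (\<forall>q\<in>players G. 0 < w q) \<and> 0 \<le> \<beta> \<and> \<beta> < 1 \<and>
    (\<forall>q\<in>players G. (\<Sum>r\<in>others q. coeff q r * w r) \<le> \<beta> * w q)"
proof -
  have n: "0 < num_users G"
    using game by (simp add: mimo_game_def)
  have Suc: "Suc i \<in> players G" if "i < num_users G" for i
    using that by (simp add: players_def)
  obtain w \<beta> where w: "\<And>i. i < num_users G \<Longrightarrow> 0 < w i" and \<beta>: "0 \<le> \<beta>" "\<beta> < 1"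
    and le: "\<And>i. i < num_users G \<Longrightarrow> (\<Sum>j<num_users G. coeff (Suc i) (Suc j) * w j) \<le> \<beta> * w i"
    using nonneg_spectral_radius_less_1_weights[of "num_users G" "\<lambda>i j. coeff (Suc i) (Suc j)"]
      interference_coeff_nonneg Suc n small_interference
    unfolding interference_matrix_def by blast
  \<comment> \<open>Players are numbered from 1, matrix indices from 0.\<close>
  define v where "v q = w (q - 1)" for q
  have "(\<Sum>r\<in>others q. coeff q r * v r) \<le> \<beta> * v q" if q: "q \<in> players G" for q
  proof -
    obtain i where i: "q = Suc i" "i < num_users G"
      using q by (cases q) (auto simp: players_def)
    \<comment> \<open>The diagonal coefficient is 0, so player \<open>q\<close> may be added to the
      sum.\<close>
    have "(\<Sum>r\<in>others q. coeff q r * v r) = (\<Sum>r\<in>players G. coeff q r * v r)"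
      by (rule sum.mono_neutral_left) (auto simp: interference_coeff_def)
    also have "\<dots> = (\<Sum>j<num_users G. coeff q (Suc j) * v (Suc j))"
      unfolding players_def lessThan_atLeast0
      by (rule sum.reindex_bij_witness[of _ Suc "\<lambda>r. r - 1"]) auto
    also have "\<dots> \<le> \<beta> * v q"
      using le[OF i(2)] by (simp add: v_def i(1))
    finally show ?thesis .
  qed
  moreover have "0 < v q" if "q \<in> players G" for q
    using that w[of "q - 1"] by (auto simp: v_def players_def)
  ultimately show ?thesis
    using \<beta> by blast
qed

end

section \<open>Fixed point, uniqueness and asynchronous convergence\<close>

locale contractive_mimo_setting = mimo_setting +
  fixes w :: "nat \<Rightarrow> real" and \<beta> :: real
  assumes w_pos: "\<And>q. q \<in> players G \<Longrightarrow> 0 < w q" and \<beta>: "0 \<le> \<beta>" "\<beta> < 1"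
    and w_le: "\<And>q. q \<in> players G \<Longrightarrow>
      (\<Sum>r\<in>others q. coeff q r * w r) \<le> \<beta> * w q"
begin

lemma weighted_contraction:
  assumes q: "q \<in> players G"
    and X: "\<And>r. r \<in> others q \<Longrightarrow> X r \<in> strategies G r"
    and Y: "\<And>r. r \<in> others q \<Longrightarrow> Y r \<in> strategies G r"
    and W: "is_waterfilling G q X W" "is_waterfilling G q Y V"
    and b: "0 \<le> b" "\<And>r. r \<in> others q \<Longrightarrow> frob_norm (X r - Y r) \<le> w r * b"
  shows "frob_norm (W - V) \<le> w q * (\<beta> * b)"
proof -
  have "frob_norm (W - V) \<le> (\<Sum>r\<in>others q. coeff q r * frob_norm (X r - Y r))"
    by (rule waterfilling_contraction[OF q X Y W])
  also have "\<dots> \<le> (\<Sum>r\<in>others q. coeff q r * (w r * b))"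
    using b(2) interference_coeff_nonneg[OF q] by (intro sum_mono mult_left_mono) auto
  also have "\<dots> = (\<Sum>r\<in>others q. coeff q r * w r) * b"
    by (simp add: sum_distrib_right mult.assoc)
  also have "\<dots> \<le> \<beta> * w q * b"
    using b(1) by (intro mult_right_mono w_le q)
  finally show ?thesis by (simp add: mult_ac)
qed

lemma waterfilling_strategies:
  assumes "q \<in> players G" "\<And>r. r \<in> others q \<Longrightarrow> X r \<in> strategies G r"
  shows "is_waterfilling G q X (waterfilling G q X)" "waterfilling G q X \<in> strategies G q"
proof -
  show "is_waterfilling G q X (waterfilling G q X)"
    by (rule waterfilling_is_waterfilling[OF assms(1) strategies_psd_others[OF assms(2)]])
  then show "waterfilling G q X \<in> strategies G q"
    by (rule is_waterfilling_strategy)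
qed

text \<open>Banach iteration with simultaneous updates: the increments decay geometrically in the
  weighted norm, so every entry converges. The limit is feasible because the strategy sets are
  closed.\<close>

lemma fixed_point_exists:
  "\<exists>L. L \<in> profiles G \<and> (\<forall>q\<in>players G. is_waterfilling G q L (L q))"
proof -
  have "\<forall>r\<in>players G. \<exists>W. W \<in> strategies G r"
    using strategies_nonempty by blast
  from bchoice[OF this] obtain X0 where X0: "\<And>r. r \<in> players G \<Longrightarrow> X0 r \<in> strategies G r" by blast
  define X where "X n = ((\<lambda>Y q. waterfilling G q Y) ^^ n) X0" for n
  have X_0: "X 0 = X0" and X_Suc: "X (Suc n) = (\<lambda>q. waterfilling G q (X n))" for n
    by (simp_all add: X_def)
  have Xs: "X n q \<in> strategies G q" if "q \<in> players G" for n q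
    using that
  proof (induction n arbitrary: q)
    case (Suc n)
    then show ?case unfolding X_Suc by (intro waterfilling_strategies(2)) auto
  qed (simp add: X_0 X0)
  have Xwf: "is_waterfilling G q (X n) (X (Suc n) q)" if "q \<in> players G" for n q
    unfolding X_Suc using that Xs by (intro waterfilling_strategies(1)) auto
  define b where "b = (\<Sum>q\<in>players G. frob_norm (X (Suc 0) q - X 0 q) / w q)"
  have b: "0 \<le> b"
    unfolding b_def using w_pos by (intro sum_nonneg divide_nonneg_pos) auto
  have step: "frob_norm (X (Suc n) q - X n q) \<le> w q * (\<beta> ^ n * b)" if "q \<in> players G" for n q
    using that
  proof (induction n arbitrary: q)
    case 0
    have "frob_norm (X (Suc 0) q - X 0 q) / w q \<le> b"
      unfolding b_def using w_pos 0
      by (intro member_le_sum[of q "players G" "\<lambda>q. frob_norm (X (Suc 0) q - X 0 q) / w q"])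
        (auto intro: divide_nonneg_pos)
    then show ?case
      using w_pos[OF 0] by (simp add: field_simps)
  next
    case (Suc n)
    have "frob_norm (X (Suc (Suc n)) q - X (Suc n) q) \<le> w q * (\<beta> * (\<beta> ^ n * b))"
      using Suc.prems Suc.IH Xs b \<beta> by (intro weighted_contraction[OF Suc.prems _ _ Xwf Xwf]) auto
    then show ?case by (simp add: mult.assoc)
  qed
  have Xc: "X n q \<in> carrier_mat (nT q) (nT q)" if "q \<in> players G" for n q
    by (rule strategiesD(3)[OF Xs[OF that]])
  have "\<exists>l. (\<lambda>n. X n q $$ (i, j)) \<longlonglongrightarrow> l"
    if q: "q \<in> players G" and ij: "i < nT q" "j < nT q" for q i j
  proof (rule convergent_of_geometric_increments[OF _ \<beta>])
    fix n
    have "cmod ((X (Suc n) q - X n q) $$ (i, j)) \<le> frob_norm (X (Suc n) q - X n q)"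
      using Xc[OF q, of n] ij by (intro norm_entry_le_frobenius) auto
    also have "\<dots> \<le> w q * (\<beta> ^ n * b)"
      by (rule step[OF q])
    finally show "cmod (X (Suc n) q $$ (i, j) - X n q $$ (i, j)) \<le> (w q * b) * \<beta> ^ n"
      using Xc[OF q, of n] ij by (simp add: mult_ac)
  qed
  then obtain l where l: "\<And>q i j. q \<in> players G \<Longrightarrow> i < nT q \<Longrightarrow> j < nT q \<Longrightarrow>
      (\<lambda>n. X n q $$ (i, j)) \<longlonglongrightarrow> l q i j"
    by metis
  define L where "L = (\<lambda>q\<in>players G. mat (nT q) (nT q) (\<lambda>(i, j). l q i j))"
  have Lq: "L q = mat (nT q) (nT q) (\<lambda>(i, j). l q i j)"
    "L q \<in> carrier_mat (nT q) (nT q)" if "q \<in> players G" for q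
    using that by (auto simp: L_def)
  have lim: "(\<lambda>n. X n q $$ (i, j)) \<longlonglongrightarrow> L q $$ (i, j)"
    if "q \<in> players G" "i < nT q" "j < nT q" for q i j
    using l[OF that] that(2,3) by (simp add: Lq(1)[OF that(1)])
  have Ls: "L q \<in> strategies G q" if q: "q \<in> players G" for q
    by (rule strategies_closed[OF Xs[OF q] Lq(2)[OF q] lim[OF q]])
  have fro: "(\<lambda>n. frob_norm (X n q - L q)) \<longlonglongrightarrow> 0" if q: "q \<in> players G" for q
    using Xc[OF q] Lq(2)[OF q] lim[OF q] by (rule frob_norm_diff_tendsto_0)
  have "is_waterfilling G q L (L q)" if q: "q \<in> players G" for q
  proof -
    define W where "W = waterfilling G q L"
    have W: "is_waterfilling G q L W" "W \<in> strategies G q"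
      unfolding W_def using waterfilling_strategies[of q L] q Ls by auto
    note Wc = strategiesD(3)[OF W(2)]
    \<comment> \<open>The distance from the response \<open>W\<close> to \<open>L q\<close>, routed
      through the next iterate. The first part is controlled by the contraction estimate, the second
      by convergence.\<close>
    let ?u = "\<lambda>n. (\<Sum>r\<in>others q. coeff q r * frob_norm (X n r - L r))
      + frob_norm (X (Suc n) q - L q)"
    have le: "frob_norm (W - L q) \<le> ?u n" for n
    proof -
      have "frob_norm (W - L q) = frob_norm ((W - X (Suc n) q) + (X (Suc n) q - L q))"
        using Wc Xc[OF q, of "Suc n"] Lq(2)[OF q] by (intro arg_cong[of _ _ frob_norm] eq_matI) auto
      also have "\<dots> \<le> frob_norm (W - X (Suc n) q) + frob_norm (X (Suc n) q - L q)"
        by (rule frob_norm_triangle[OF minus_carrier_mat[OF Xc[OF q]] minus_carrier_mat[OF Lq(2)[OF q]]])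
      also have "frob_norm (W - X (Suc n) q) = frob_norm (X (Suc n) q - W)"
        by (rule frob_norm_minus_commute[OF Wc Xc[OF q]])
      also have "\<dots> \<le> (\<Sum>r\<in>others q. coeff q r * frob_norm (X n r - L r))"
        using Xs Ls by (intro waterfilling_contraction[OF q _ _ Xwf[OF q] W(1)]) auto
      finally show ?thesis by simp
    qed
    have "?u \<longlonglongrightarrow> (\<Sum>r\<in>others q. coeff q r * 0) + 0"
      using LIMSEQ_Suc[OF fro[OF q]] by (intro tendsto_intros fro) auto
    then have "?u \<longlonglongrightarrow> 0" by simp
    then have "frob_norm (W - L q) \<le> 0"
      by (rule LIMSEQ_le_const) (use le in blast)
    then have "W = L q"
      by (rule frob_norm_diff_eq_0[OF Wc Lq(2)[OF q]])
    then show ?thesis using W(1) by simp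
  qed
  moreover have "L \<in> profiles G"
    unfolding profiles_def using Ls by (auto simp: L_def)
  ultimately show ?thesis by blast
qed

text \<open>Updates are described by the relation \<open>is_waterfilling\<close>, so that the lemma
  covers runs of the algorithm as well as constant sequences of fixed points.\<close>

lemma asynchronous_error_tendsto_0:
  assumes L: "\<And>q. q \<in> players G \<Longrightarrow> L q \<in> strategies G q"
    "\<And>q. q \<in> players G \<Longrightarrow> is_waterfilling G q L (L q)"
    and X: "\<And>n q. q \<in> players G \<Longrightarrow> X n q \<in> strategies G q"
    and idle: "\<And>n q. q \<in> players G \<Longrightarrow> n \<notin> T q \<Longrightarrow> X (Suc n) q = X n q"
    and upd: "\<And>n q. q \<in> players G \<Longrightarrow> n \<in> T q \<Longrightarrow>
      is_waterfilling G q (\<lambda>r. X (\<tau> q r n) r) (X (Suc n) q)"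
    and sched: "asynchronous_schedule G T \<tau>" and q: "q \<in> players G"
  shows "(\<lambda>n. frob_norm (X n q - L q)) \<longlonglongrightarrow> 0"
proof (rule asynchronous_contraction_tendsto_0[where e = "\<lambda>q n. frob_norm (X n q - L q)"
      and T = T and \<tau> = \<tau>, OF finite_players w_pos _ \<beta>])
  show "infinite (T q)" if "q \<in> players G" for q
    using sched that by (simp add: asynchronous_schedule_def)
  show "\<tau> q r n \<le> n" if "q \<in> players G" "r \<in> others q" for q r n
    using sched that by (simp add: asynchronous_schedule_def)
  show "\<exists>n0. \<forall>n\<ge>n0. n \<in> T q \<longrightarrow> N \<le> \<tau> q r n" if "q \<in> players G" "r \<in> others q" for q r N
    using sched that by (intro sequence_condition_uniform) (simp add: asynchronous_schedule_def)
  show "frob_norm (X (Suc n) q - L q) = frob_norm (X n q - L q)"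
    if "q \<in> players G" "n \<notin> T q" for q n
    using idle[OF that] by simp
  show "frob_norm (X (Suc n) q - L q) \<le> w q * (\<beta> * b)"
    if q: "q \<in> players G" "n \<in> T q" and b: "0 \<le> b"
      "\<And>r. r \<in> others q \<Longrightarrow> frob_norm (X (\<tau> q r n) r - L r) \<le> w r * b" for q n b
    by (rule weighted_contraction[OF q(1) _ _ upd[OF q] L(2)[OF q(1)] b]) (use X L(1) in auto)
qed (use q in auto)

text \<open>A second fixed point is a constant run without delay in which everyone always updates;
  its constant error tends to 0.\<close>

lemma waterfilling_fixed_point_unique:
  assumes L: "\<And>q. q \<in> players G \<Longrightarrow> L q \<in> strategies G q"
    "\<And>q. q \<in> players G \<Longrightarrow> is_waterfilling G q L (L q)"
    and Y: "\<And>q. q \<in> players G \<Longrightarrow> Y q \<in> strategies G q"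
    "\<And>q. q \<in> players G \<Longrightarrow> is_waterfilling G q Y (Y q)"
    and q: "q \<in> players G"
  shows "Y q = L q"
proof -
  have "(\<lambda>n :: nat. frob_norm (Y q - L q)) \<longlonglongrightarrow> 0"
    by (rule asynchronous_error_tendsto_0[where X = "\<lambda>_. Y" and T = "\<lambda>_. UNIV" and \<tau> = "\<lambda>_ _ n. n"])
      (use L Y q in \<open>auto simp: asynchronous_schedule_def\<close>)
  then have "frob_norm (Y q - L q) = 0"
    by (simp add: LIMSEQ_const_iff)
  then show ?thesis
    using strategiesD(3)[OF L(1)[OF q]] strategiesD(3)[OF Y(1)[OF q]]
    by (intro frob_norm_diff_eq_0) auto
qed

lemma iterative_waterfilling_converges:
  assumes L: "\<And>q. q \<in> players G \<Longrightarrow> L q \<in> strategies G q"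
    "\<And>q. q \<in> players G \<Longrightarrow> is_waterfilling G q L (L q)"
    and sched: "asynchronous_schedule G T \<tau>" and run: "iterative_waterfilling G T \<tau> X"
  shows "converges_to G X L"
proof -
  have X: "X n q \<in> strategies G q" if "q \<in> players G" for n q
    using that
  proof (induction n arbitrary: q rule: less_induct)
    case (less n)
    show ?case
    proof (cases n)
      case 0
      then show ?thesis using run less.prems by (simp add: iterative_waterfilling_def)
    next
      case (Suc m)
      \<comment> \<open>Perceived times never lie in the future, so the strong induction hypothesis
        supplies feasible inputs.\<close>
      have "waterfilling G q (\<lambda>r. X (\<tau> q r m) r) \<in> strategies G q"
      proof (rule waterfilling_strategies(2)[OF less.prems])
        fix r assume r: "r \<in> others q"
        then have "\<tau> q r m \<le> m"
          using sched less.prems by (simp add: asynchronous_schedule_def)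
        then show "X (\<tau> q r m) r \<in> strategies G r"
          using less.IH r Suc by simp
      qed
      then show ?thesis
        using run less Suc by (simp add: iterative_waterfilling_def)
    qed
  qed
  have err: "(\<lambda>n. frob_norm (X n q - L q)) \<longlonglongrightarrow> 0" if q: "q \<in> players G" for q
  proof (rule asynchronous_error_tendsto_0[OF L X _ _ sched q])
    show "X (Suc n) q = X n q" if "q \<in> players G" "n \<notin> T q" for n q
      using run that by (simp add: iterative_waterfilling_def)
    show "is_waterfilling G q (\<lambda>r. X (\<tau> q r n) r) (X (Suc n) q)" if "q \<in> players G" "n \<in> T q" for n q
      using run that X waterfilling_strategies(1)[of q "\<lambda>r. X (\<tau> q r n) r"]
      by (simp add: iterative_waterfilling_def)
  qed auto
  show ?thesis
    unfolding converges_to_def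
  proof (intro ballI allI impI)
    fix q i j assume q: "q \<in> players G" and ij: "i < nT q" "j < nT q"
    show "(\<lambda>n. X n q $$ (i, j)) \<longlonglongrightarrow> L q $$ (i, j)"
      by (rule frob_norm_tendsto_0_entry[OF strategiesD(3)[OF X[OF q]] strategiesD(3)[OF L(1)[OF q]] err[OF q] ij])
  qed
qed

end

theorem theorem12:
  fixes G :: mimo_system
  assumes "mimo_game G"
    and "spectral_radius (interference_matrix G) < 1"
  shows "\<exists>Xs. nash_equilibrium G Xs \<and> (\<forall>Y. nash_equilibrium G Y \<longrightarrow> Y = Xs) \<and>
    (\<forall>T \<tau> X. asynchronous_schedule G T \<tau> \<and> iterative_waterfilling G T \<tau> X \<longrightarrow>
       converges_to G X Xs)"
proof -
  interpret mimo_setting G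
    by unfold_locales (rule assms(1))
  obtain w \<beta> where w: "\<And>q. q \<in> players G \<Longrightarrow> 0 < w q" "0 \<le> \<beta>" "\<beta> < 1"
    "\<And>q. q \<in> players G \<Longrightarrow> (\<Sum>r\<in>players G - {q}. interference_coeff G q r * w r) \<le> \<beta> * w q"
    using contraction_weights_exist[OF assms(2)] by blast
  interpret contractive_mimo_setting G w \<beta>
    by unfold_locales (use w in auto)
  obtain L where L: "L \<in> profiles G" "\<And>q. q \<in> players G \<Longrightarrow> is_waterfilling G q L (L q)"
    using fixed_point_exists by blast
  have strat: "Y q \<in> strategies G q" if "Y \<in> profiles G" "q \<in> players G" for Y q
    using that by (auto simp: profiles_def PiE_def)
  have "nash_equilibrium G L"
    using nash_equilibrium_iff_waterfilling[OF L(1)] L(2) by blast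
  moreover have "Y = L" if ne: "nash_equilibrium G Y" for Y
  proof -
    have Y: "Y \<in> profiles G"
      using ne by (simp add: nash_equilibrium_def)
    then have "\<And>q. q \<in> players G \<Longrightarrow> is_waterfilling G q Y (Y q)"
      using nash_equilibrium_iff_waterfilling[OF Y] ne by blast
    then have "Y q = L q" if "q \<in> players G" for q
      using waterfilling_fixed_point_unique[OF strat[OF L(1)] L(2) strat[OF Y] _ that] by blast
    \<comment> \<open>Profiles are extensional, so agreement on the players is equality of
      functions.\<close>
    then show ?thesis
      using Y L(1) unfolding profiles_def by (intro PiE_ext)
  qed
  moreover have "converges_to G X L"
    if "asynchronous_schedule G T \<tau>" "iterative_waterfilling G T \<tau> X" for T \<tau> X
    by (rule iterative_waterfilling_converges[OF strat[OF L(1)] L(2) that])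
  ultimately show ?thesis by blast
qed

end
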